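(* Let $\mathcal{P}$ be a multicriteria discrete minimization problem (with a fixed number $k$ of objectives). The following statements are equivalent, both in the version where "approximation" means "constant factor approximation" and in the version where it means "FPTAS": (i) There is a constant factor approximation (FPTAS, respectively) for the Pareto set of $\mathcal{P}$. (ii) For every monotone and polynomially decidable norm $\|\cdot\|$ there is a constant factor approximation (FPTAS, respectively) for $\mathrm{RP}(\mathcal{P},\|\cdot\|)$. (iii) There is a constant factor approximation (FPTAS, respectively) for $\mathrm{RP}(\mathcal{P},\|\cdot\|_\infty)$. (iv) There is a family of algorithms that, for each $p\ge 1$, contains a constant factor approximation (FPTAS, respectively) for $\mathrm{RP}(\mathcal{P},\|\cdot\|_p)$ or for $\mathrm{RP}(\mathcal{P},\|\cdot\|_{[p]})$, and the running time of all these algorithms is bounded by a polynomial in the input size and $\log p$. (v) For every monotone and polynomially decidable norm $\|\cdot\|$ there is a constant factor approximation (FPTAS, respectively) for $\mathrm{CP}(\mathcal{P},\|\cdot\|)$. (vi) There is a constant factor approximation (FPTAS, respectively) for $\mathrm{CP}(\mathcal{P},\|\cdot\|_\infty)$. (vii) There is a family of algorithms that, for each $p\ge 1$, contains a constant factor approximation (FPTAS, respectively) for $\mathrm{CP}(\mathcal{P},\|\cdot\|_p)$ or for $\mathrm{CP}(\mathcal{P},\|\cdot\|_{[p]})$, and the running time of all these algorithms is bounded by a polynomial in the input size and $\log p$.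
   Context: A multicriteria discrete minimization problem $\mathcal{P}$ with a fixed number $k$ of objectives: an instance $I$ (encoding length $|I|$) consists of a set $\mathcal{X}$ of feasible solutions and an objective map $c:\mathcal{X}\to\mathbb{Z}_{\ge0}^k$; the objective vector set is $\mathcal{Y}=c(\mathcal{X})$. Standing assumption: for every instance one can compute $M>0$ with $\mathcal{Y}\subseteq[0,M]^k$ and $M\le 2^{\pi(|I|)}$ for a fixed polynomial $\pi$. Vectors are compared componentwise. $y\in\mathcal{Y}$ is Pareto optimal if there is no $y'\in\mathcal{Y}\setminus\{y\}$ with $y'\le y$; the Pareto set $\mathcal{Y}_P$ is the set of Pareto optimal vectors. For $\alpha>1$, an $\alpha$-approximate Pareto set is a set $\mathcal{Y}_\alpha\subseteq\mathcal{Y}$ such that for every $y\in\mathcal{Y}_P$ there is $y'\in\mathcal{Y}_\alpha$ with $y'\le\alpha y$; an $\alpha$-approximation algorithm for the Pareto set computes such a set in time polynomial in $|I|$; an FPTAS for the Pareto set is a family containing, for every $\epsilon>0$, a $(1+\epsilon)$-approximation algorithm with running time polynomial in $|I|$ and $1/\epsilon$. The ideal point $y^{\mathrm{id}}$ is given by $y^{\mathrm{id}}_i=\min_{y\in\mathcal{Y}}y_i$. A feasible reference point is $\bar y\in\mathbb{Z}^k_{\ge0}$ with $\bar y\le y^{\mathrm{id}}$. For a norm $\|\cdot\|$ on $\mathbb{R}^k$ and weights $\lambda\in\mathbb{Q}^k_{\ge0}$, $\|y\|^\lambda:=\|(\lambda_1y_1,\dots,\lambda_ky_k)\|$ and $r_{\bar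 y,\lambda}(y):=\|\bar y\|^\lambda+\|y-\bar y\|^\lambda$. $\mathrm{RP}(\mathcal{P},\|\cdot\|)$: given an instance, a feasible reference point $\bar y$ and $\lambda\in\mathbb{Q}^k_{\ge0}$, find $x\in\mathcal{X}$ minimizing $r_{\bar y,\lambda}(c(x))$. $\mathrm{CP}(\mathcal{P},\|\cdot\|)$ (compromise programming): given an instance and $\lambda$ (the ideal point is not part of the input), find $x\in\mathcal{X}$ minimizing $r_{y^{\mathrm{id}},\lambda}(c(x))$. A $\beta$-approximation for these problems is a polynomial-time algorithm returning a feasible solution whose objective value is at most $\beta$ times the optimum; an FPTAS contains a $(1+\epsilon)$-approximation for every $\epsilon>0$, running in time polynomial in the input size and $1/\epsilon$. A norm is monotone if $0\le y'\le y''$ implies $\|y'\|\le\|y''\|$, and polynomially decidable if whether $\|y'\|\le\|y''\|$ can be decided in time polynomial in the encoding length of $y',y''$. Norms used: $\|y\|_\infty=\max_i|y_i|$, $\|y\|_p=(\sum_i|y_i|^p)^{1/p}$, and the cornered $p$-norm $\|y\|_{[p]}=\max_i|y_i|+\frac1p\sum_i|y_i|$ ($p\ge1$).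
   Formalization: The formal version assumes every instance has a feasible solution and c can be evaluated in polynomial time, and in (i) the algorithm returns feasible solutions whose objective vectors form the approximate Pareto set; without these the equivalence fails. *)

theory Defs
  imports "HOL-Analysis.Analysis" "HOL-Library.Log_Nat" "HOL-Computational_Algebra.Polynomial"
begin

section \<open>Algorithms and running time\<close>

text \<open>
  Algorithms are structured while-programs on integers and pairs under the logarithmic cost
  criterion: every operation is charged the number of bits that it reads, copies and writes.
  Running times in this model and on Turing machines are polynomially related. Since copying and
  writing are charged, the size of every intermediate value is bounded by input size plus time.
\<close>

datatype data = Num int | Cell data data

fun dsize :: "data \<Rightarrow> nat" where
  "dsize (Num n) = 1 + floorlog 2 (nat \<bar>n\<bar>)"
| "dsize (Cell a b) = 1 + dsize a + dsize b"

datatype prim = Nop | First | Second | IsCell | Add | Sub | Mul | Div | Le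

fun arith :: "(int \<Rightarrow> int \<Rightarrow> int) \<Rightarrow> data \<Rightarrow> data" where
  "arith f (Cell (Num a) (Num b)) = Num (f a b)"
| "arith f _ = Num 0"

fun prim_val :: "prim \<Rightarrow> data \<Rightarrow> data" where
  "prim_val Nop v = v"
| "prim_val First v = (case v of Cell a b \<Rightarrow> a | Num n \<Rightarrow> Num 0)"
| "prim_val Second v = (case v of Cell a b \<Rightarrow> b | Num n \<Rightarrow> Num 0)"
| "prim_val IsCell v = (case v of Cell a b \<Rightarrow> Num 1 | Num n \<Rightarrow> Num 0)"
| "prim_val Add v = arith (+) v"
| "prim_val Sub v = arith (-) v"
| "prim_val Mul v = arith (*) v"
| "prim_val Div v = arith (div) v"
| "prim_val Le v = arith (\<lambda>a b. if a \<le> b then 1 else 0) v"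

datatype prog =
    Prim prim
  | Const data
  | Seq prog prog
  | Fork prog prog
  | Cond prog prog prog
  | While prog prog

text \<open>
  \<open>runs A v w t\<close>: started on \<open>v\<close>, the program \<open>A\<close> halts with result \<open>w\<close> after time \<open>t\<close>.
  The value \<open>Num 0\<close> is read as false by \<open>Cond\<close> and \<open>While\<close>, every other value as true.
\<close>

inductive runs :: "prog \<Rightarrow> data \<Rightarrow> data \<Rightarrow> nat \<Rightarrow> bool" where
  Prim: "w = prim_val f v \<Longrightarrow> runs (Prim f) v w (1 + dsize v + dsize w)"
| Const: "runs (Const c) v c (1 + dsize c)"
| Seq: "runs A u v s \<Longrightarrow> runs B v w t \<Longrightarrow> runs (Seq A B) u w (1 + s + t)"
| Fork: "runs A u v s \<Longrightarrow> runs B u w t \<Longrightarrow>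
    runs (Fork A B) u (Cell v w) (1 + dsize u + s + t)"
| CondT: "runs A u b s \<Longrightarrow> b \<noteq> Num 0 \<Longrightarrow> runs B u w t \<Longrightarrow>
    runs (Cond A B B') u w (1 + dsize u + s + t)"
| CondF: "runs A u (Num 0) s \<Longrightarrow> runs B' u w t \<Longrightarrow>
    runs (Cond A B B') u w (1 + dsize u + s + t)"
| WhileF: "runs A u (Num 0) s \<Longrightarrow> runs (While A B) u u (1 + dsize u + s)"
| WhileT: "runs A u b s \<Longrightarrow> b \<noteq> Num 0 \<Longrightarrow> runs B u v t \<Longrightarrow> runs (While A B) v w t' \<Longrightarrow>
    runs (While A B) u w (1 + dsize u + s + t + t')"

lemma runs_deterministic:
  "runs A u w t \<Longrightarrow> runs A u w' t' \<Longrightarrow> w' = w \<and> t' = t"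
proof (induction arbitrary: w' t' rule: runs.induct)
  case (Prim w f v)
  from Prim(2) show ?case by cases (use Prim(1) in auto)
next
  case (Const c v)
  then show ?case by cases auto
next
  case (Seq A u v s B w t)
  from Seq.prems show ?case by cases (use Seq.IH in blast)
next
  case (Fork A u v s B w t)
  from Fork.prems show ?case by cases (use Fork.IH in blast)
next
  case (CondT A u b s B w t B')
  from CondT.prems show ?case by cases (use CondT.IH CondT.hyps in blast)+
next
  case (CondF A u s B' w t B)
  from CondF.prems show ?case by cases (use CondF.IH in blast)+
next
  case (WhileF A u s B)
  from WhileF.prems show ?case by cases (use WhileF.IH in blast)+
next
  case (WhileT A u b s B v t w t')
  from WhileT.prems show ?case by cases (use WhileT.IH WhileT.hyps in blast)+
qed


section \<open>Encodings\<close>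

fun enc_list :: "data list \<Rightarrow> data" where
  "enc_list [] = Num 0"
| "enc_list (v # vs) = Cell v (enc_list vs)"

definition enc_rat :: "rat \<Rightarrow> data" where
  "enc_rat q = Cell (Num (fst (quotient_of q))) (Num (snd (quotient_of q)))"

text \<open>Class \<open>enum\<close> on the index type only fixes the order in which components are listed.\<close>

definition enc_natvec :: "nat ^ 'k::enum \<Rightarrow> data" where
  "enc_natvec y = enc_list (map (\<lambda>i. Num (int (y $ i))) enum_class.enum)"

definition enc_ratvec :: "rat ^ 'k::enum \<Rightarrow> data" where
  "enc_ratvec y = enc_list (map (\<lambda>i. enc_rat (y $ i)) enum_class.enum)"


section \<open>Multicriteria discrete minimization problems\<close>

text \<open>
  Instances and solutions are identified with their encodings, so the encoding length of an
  instance \<open>I\<close> is \<open>dsize I\<close>. The number of objectives is \<open>CARD('k)\<close>.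
\<close>

record 'k problem =
  instances :: "data set"
  feasible :: "data \<Rightarrow> data set"
  objective :: "data \<Rightarrow> data \<Rightarrow> nat ^ 'k"

definition objvecs :: "'k::enum problem \<Rightarrow> data \<Rightarrow> (nat ^ 'k::enum) set" where
  "objvecs P I = objective P I ` feasible P I"

text \<open>
  Two conditions are customarily left implicit: every instance has a feasible solution (otherwise
  there is no ideal point and nothing to return), and objective vectors of given solutions can be
  evaluated in polynomial time.
\<close>

definition multicriteria_problem :: "'k::enum problem \<Rightarrow> bool" where
  "multicriteria_problem P \<longleftrightarrow>
     (\<forall>I \<in> instances P. feasible P I \<noteq> {}) \<and>
     (\<exists>A (C::real) (d::nat). \<forall>I \<in> instances P. \<forall>x \<in> feasible P I. \<exists>t.
        runs A (Cell I x) (enc_natvec (objective P I x)) t \<and>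
        real t \<le> C * (1 + real (dsize (Cell I x))) ^ d) \<and>
     (\<exists>A (\<pi> :: nat poly). \<forall>I \<in> instances P. \<exists>(M::nat) t.
        runs A I (Num (int M)) t \<and> M > 0 \<and>
        (\<forall>y \<in> objvecs P I. \<forall>i. y $ i \<le> M) \<and> M \<le> 2 ^ poly \<pi> (dsize I))"

definition pareto_set :: "(nat ^ 'k) set \<Rightarrow> (nat ^ 'k::finite) set" where
  "pareto_set Y = {y \<in> Y. \<not> (\<exists>y' \<in> Y - {y}. y' \<le> y)}"

definition approx_pareto_set :: "real \<Rightarrow> (nat ^ 'k) set \<Rightarrow> (nat ^ 'k::finite) set \<Rightarrow> bool" where
  "approx_pareto_set \<alpha> Y Y\<^sub>\<alpha> \<longleftrightarrow>
     Y\<^sub>\<alpha> \<subseteq> Y \<and> (\<forall>y \<in> pareto_set Y. \<exists>y' \<in> Y\<^sub>\<alpha>. \<forall>i. real (y' $ i) \<le> \<alpha> * real (y $ i))"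

definition ideal_point :: "(nat ^ 'k) set \<Rightarrow> nat ^ 'k::finite" where
  "ideal_point Y = (\<chi> i. Min ((\<lambda>y. y $ i) ` Y))"


section \<open>Norms\<close>

definition is_norm :: "(real ^ 'k::finite \<Rightarrow> real) \<Rightarrow> bool" where
  "is_norm N \<longleftrightarrow>
     (\<forall>y. N y = 0 \<longleftrightarrow> y = 0) \<and>
     (\<forall>a y. N (a *\<^sub>R y) = \<bar>a\<bar> * N y) \<and>
     (\<forall>y z. N (y + z) \<le> N y + N z)"

definition monotone_norm :: "(real ^ 'k::finite \<Rightarrow> real) \<Rightarrow> bool" where
  "monotone_norm N \<longleftrightarrow> (\<forall>y z. 0 \<le> y \<and> y \<le> z \<longrightarrow> N y \<le> N z)"

definition real_vec_of_rat :: "rat ^ 'k \<Rightarrow> real ^ 'k::finite" where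
  "real_vec_of_rat y = (\<chi> i. of_rat (y $ i))"

definition real_vec_of_nat :: "nat ^ 'k \<Rightarrow> real ^ 'k::finite" where
  "real_vec_of_nat y = (\<chi> i. real (y $ i))"

definition polynomially_decidable :: "(real ^ 'k::enum \<Rightarrow> real) \<Rightarrow> bool" where
  "polynomially_decidable N \<longleftrightarrow>
     (\<exists>A (C::real) (d::nat). \<forall>y z :: rat ^ 'k::enum. \<exists>t.
        runs A (Cell (enc_ratvec y) (enc_ratvec z))
          (Num (if N (real_vec_of_rat y) \<le> N (real_vec_of_rat z) then 1 else 0)) t \<and>
        real t \<le> C * (1 + real (dsize (Cell (enc_ratvec y) (enc_ratvec z)))) ^ d)"

definition max_norm :: "real ^ 'k::finite \<Rightarrow> real" where
  "max_norm y = Max (range (\<lambda>i. \<bar>y $ i\<bar>))"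

definition p_norm :: "real \<Rightarrow> real ^ 'k::finite \<Rightarrow> real" where
  "p_norm p y = (\<Sum>i \<in> UNIV. \<bar>y $ i\<bar> powr p) powr (1 / p)"

definition cornered_norm :: "real \<Rightarrow> real ^ 'k::finite \<Rightarrow> real" where
  "cornered_norm p y = Max (range (\<lambda>i. \<bar>y $ i\<bar>)) + 1 / p * (\<Sum>i \<in> UNIV. \<bar>y $ i\<bar>)"

definition weighted :: "(real ^ 'k \<Rightarrow> real) \<Rightarrow> rat ^ 'k \<Rightarrow> real ^ 'k::finite \<Rightarrow> real" where
  "weighted N w y = N (\<chi> i. of_rat (w $ i) * y $ i)"

definition ref_obj ::
  "(real ^ 'k \<Rightarrow> real) \<Rightarrow> nat ^ 'k \<Rightarrow> rat ^ 'k \<Rightarrow> nat ^ 'k::finite \<Rightarrow> real" where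
  "ref_obj N r w y =
     weighted N w (real_vec_of_nat r) + weighted N w (real_vec_of_nat y - real_vec_of_nat r)"


section \<open>Approximation algorithms\<close>

text \<open>
  In the following three definitions \<open>A\<close> is an algorithm with approximation guarantee \<open>\<alpha>\<close> whose
  running time on inputs of size \<open>n\<close> is at most \<open>T n\<close>. An approximate Pareto set is returned as
  a list of feasible solutions whose objective vectors form the set.
\<close>

definition pareto_algorithm ::
  "'k::enum problem \<Rightarrow> real \<Rightarrow> (nat \<Rightarrow> real) \<Rightarrow> prog \<Rightarrow> bool" where
  "pareto_algorithm P \<alpha> T A \<longleftrightarrow>
     (\<forall>I \<in> instances P. \<exists>xs t.
        runs A I (enc_list xs) t \<and> real t \<le> T (dsize I) \<and>
        set xs \<subseteq> feasible P I \<and>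
        approx_pareto_set \<alpha> (objvecs P I) (objective P I ` set xs))"

definition rp_algorithm ::
  "'k::enum problem \<Rightarrow> (real ^ 'k::enum \<Rightarrow> real) \<Rightarrow> real \<Rightarrow> (nat \<Rightarrow> real) \<Rightarrow> prog \<Rightarrow> bool" where
  "rp_algorithm P N \<alpha> T A \<longleftrightarrow>
     (\<forall>I \<in> instances P. \<forall>r w.
        r \<le> ideal_point (objvecs P I) \<and> 0 \<le> w \<longrightarrow>
        (let input = Cell I (Cell (enc_natvec r) (enc_ratvec w)) in
         \<exists>x t. runs A input x t \<and> real t \<le> T (dsize input) \<and>
           x \<in> feasible P I \<and>
           ref_obj N r w (objective P I x) \<le> \<alpha> * Min (ref_obj N r w ` objvecs P I)))"

definition cp_algorithm ::
  "'k::enum problem \<Rightarrow> (real ^ 'k::enum \<Rightarrow> real) \<Rightarrow> real \<Rightarrow> (nat \<Rightarrow> real) \<Rightarrow> prog \<Rightarrow> bool" where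
  "cp_algorithm P N \<alpha> T A \<longleftrightarrow>
     (\<forall>I \<in> instances P. \<forall>w. 0 \<le> w \<longrightarrow>
        (let input = Cell I (enc_ratvec w); r = ideal_point (objvecs P I) in
         \<exists>x t. runs A input x t \<and> real t \<le> T (dsize input) \<and>
           x \<in> feasible P I \<and>
           ref_obj N r w (objective P I x) \<le> \<alpha> * Min (ref_obj N r w ` objvecs P I)))"

text \<open>
  Below, \<open>S \<alpha> T A\<close> is one of the three relations above. Any polynomial in nonnegative quantities
  \<open>a, b, \<dots>\<close> is bounded by some \<open>C * (1 + a + b + \<dots>) ^ d\<close>, so boundedness by a polynomial is
  expressed by bounds of this shape; \<open>C\<close> and \<open>d\<close> are common to all members of a family.
\<close>

definition has_constant_factor ::
  "(real \<Rightarrow> (nat \<Rightarrow> real) \<Rightarrow> prog \<Rightarrow> bool) \<Rightarrow> bool" where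
  "has_constant_factor S \<longleftrightarrow>
     (\<exists>\<alpha> > 1. \<exists>(C::real) (d::nat) A. S \<alpha> (\<lambda>n. C * (1 + real n) ^ d) A)"

definition has_fptas ::
  "(real \<Rightarrow> (nat \<Rightarrow> real) \<Rightarrow> prog \<Rightarrow> bool) \<Rightarrow> bool" where
  "has_fptas S \<longleftrightarrow>
     (\<exists>(C::real) (d::nat). \<forall>\<epsilon> > 0. \<exists>A. S (1 + \<epsilon>) (\<lambda>n. C * (1 + real n + 1 / \<epsilon>) ^ d) A)"

definition has_constant_factor_family ::
  "((real ^ 'k::enum \<Rightarrow> real) \<Rightarrow> real \<Rightarrow> (nat \<Rightarrow> real) \<Rightarrow> prog \<Rightarrow> bool) \<Rightarrow> bool" where
  "has_constant_factor_family S \<longleftrightarrow>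
     (\<exists>(C::real) (d::nat). \<forall>p \<ge> 1.
        (\<exists>\<alpha> > 1. \<exists>A. S (p_norm p) \<alpha> (\<lambda>n. C * (1 + real n + log 2 p) ^ d) A) \<or>
        (\<exists>\<alpha> > 1. \<exists>A. S (cornered_norm p) \<alpha> (\<lambda>n. C * (1 + real n + log 2 p) ^ d) A))"

definition has_fptas_family ::
  "((real ^ 'k::enum \<Rightarrow> real) \<Rightarrow> real \<Rightarrow> (nat \<Rightarrow> real) \<Rightarrow> prog \<Rightarrow> bool) \<Rightarrow> bool" where
  "has_fptas_family S \<longleftrightarrow>
     (\<exists>(C::real) (d::nat). \<forall>p \<ge> 1.
        (\<forall>\<epsilon> > 0. \<exists>A. S (p_norm p) (1 + \<epsilon>) (\<lambda>n. C * (1 + real n + 1 / \<epsilon> + log 2 p) ^ d) A) \<or>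
        (\<forall>\<epsilon> > 0. \<exists>A. S (cornered_norm p) (1 + \<epsilon>) (\<lambda>n. C * (1 + real n + 1 / \<epsilon> + log 2 p) ^ d) A))"

definition all_equivalent :: "bool list \<Rightarrow> bool" where
  "all_equivalent ss \<longleftrightarrow> (\<forall>a \<in> set ss. \<forall>b \<in> set ss. a \<longleftrightarrow> b)"

end

theory Submission
  imports Defs
begin

text \<open>
  From an \<open>\<alpha>\<close>-approximate Pareto set, the point minimizing \<open>N (w * (y - r))\<close> is an
  \<open>\<alpha>\<close>-approximation for the reference point problem, because \<open>z \<le> \<alpha> y\<close> gives
  \<open>z - r \<le> \<alpha> (y - r) + (\<alpha> - 1) r\<close>. For compromise programming the unknown ideal point is
  replaced by the componentwise minimum of the approximate Pareto set, which costs another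
  \<open>\<alpha> - 1\<close>. After clearing denominators of the weights, only comparisons of norms of integer
  vectors are needed.

  Conversely, a Pareto optimal \<open>y\<close> is approximated by solving the problem for the maximum norm
  with weights close to \<open>1 / max (m (y - r)) r\<close>, where \<open>1 / m\<close> is the desired precision. These
  weights are found in a grid with polynomially many points per coordinate; all of its tuples
  are tried.

  Both the \<open>p\<close>-norm and the cornered \<open>p\<close>-norm are within a factor \<open>1 + \<delta>\<close> of the maximum norm
  for \<open>p\<close> of order \<open>1 / \<delta>\<close>. The cornered \<open>p\<close>-norm of a real \<open>p\<close> is replaced by one with a
  rational coefficient of size polynomial in \<open>1 / \<delta>\<close>, which can be compared exactly.

  A constant factor algorithm and an FPTAS are both treated as families of programs indexed by
  an arbitrary type, with running time polynomial in the input size and a size parameter of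
  the index.
\<close>

section \<open>Sizes of values\<close>

text \<open>Three points shape the details. The program for the bound \<open>M\<close> in
  \<open>multicriteria_problem\<close> comes without a time bound, so it is not called; a large
  enough bound is recomputed from the size of the instance alone. Rationals are encoded as reduced
  fractions, and reducing them would need a gcd computation; hence the weights tried are reciprocals
  \<open>1 / u\<close> or an integer, and weighted differences are scaled to integers, whose
  denominator is 1. A norm can be compared but not evaluated; this suffices because for a given
  reference point the first term of \<open>ref_obj\<close> is the same for all candidates, so that
  it is enough to minimize the second one. The families over \<open>p\<close> allow a separate
  program for every real \<open>p\<close>, with one polynomial bound for all. Rounding
  \<open>1 / p\<close> to a multiple of \<open>1 / m\<close> makes the constants written into these
  programs independent of the magnitude of \<open>p\<close>. In the other direction only a
  \<open>p\<close> of moderate size is used, so \<open>log 2 p\<close> is harmless.\<close>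

lemma dsize_pos: "0 < dsize v"
  by (cases v) auto

lemma runs_size: "runs A v w t \<Longrightarrow> dsize w \<le> t"
  by (induction rule: runs.induct) auto

lemma dsize_Num_le: "\<bar>n\<bar> < 2 ^ e \<Longrightarrow> dsize (Num n) \<le> 1 + e"
proof -
  assume "\<bar>n\<bar> < 2 ^ e"
  then have "nat \<bar>n\<bar> < 2 ^ e"
    by (metis abs_ge_zero nat_less_iff of_nat_numeral of_nat_power)
  then show ?thesis by (simp add: floorlog_leI)
qed

lemma abs_less_power_floorlog: "\<bar>n\<bar> < 2 ^ floorlog 2 (nat \<bar>n\<bar>)"
proof (cases "n = 0")
  case False
  then have "nat \<bar>n\<bar> < 2 ^ floorlog 2 (nat \<bar>n\<bar>)"
    using floorlog_bounds[of "nat \<bar>n\<bar>" 2] by simp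
  then show ?thesis
    by (metis abs_ge_zero nat_less_iff of_nat_numeral of_nat_power)
qed (simp add: floorlog_def)

lemma dsize_Num_nat_le: "dsize (Num (int n)) \<le> 1 + n"
proof (rule dsize_Num_le)
  have "n < 2 ^ n" by (rule less_exp)
  then show "\<bar>int n\<bar> < 2 ^ n" by (metis abs_of_nat of_nat_less_numeral_power_cancel_iff)
qed

text \<open>An arithmetic primitive reads \<open>Cell (Num a) (Num b)\<close>, and the three
  constructors in this value leave room for the carry of a sum. Hence a primitive costs at most
  \<open>1 + 2 * dsize v\<close>.\<close>

lemma dsize_prim_val_le: "dsize (prim_val f v) \<le> dsize v"
proof -
  have zero: "dsize (Num 0) \<le> dsize v" for v
    using dsize_pos[of v] by (simp add: floorlog_def)
  have arith: "dsize (arith g v) \<le> dsize v"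
    if g: "\<And>a b. dsize (Num (g a b)) \<le> 3 + floorlog 2 (nat \<bar>a\<bar>) + floorlog 2 (nat \<bar>b\<bar>)" for g
  proof -
    consider a b where "v = Cell (Num a) (Num b)" | "arith g v = Num 0"
      by (induction g v rule: arith.induct) auto
    then show ?thesis
    proof cases
      case 1
      then show ?thesis using g[of a b] by simp
    qed (metis zero)
  qed
  have plus: "\<bar>a\<bar> + \<bar>b\<bar> < 2 ^ (2 + floorlog 2 (nat \<bar>a\<bar>) + floorlog 2 (nat \<bar>b\<bar>))" for a b :: int
  proof -
    let ?p = "floorlog 2 (nat \<bar>a\<bar>)" and ?q = "floorlog 2 (nat \<bar>b\<bar>)"
    have "\<bar>a\<bar> + \<bar>b\<bar> < 2 ^ ?p + 2 ^ ?q"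
      using abs_less_power_floorlog[of a] abs_less_power_floorlog[of b] by linarith
    also have "\<dots> \<le> 2 ^ (?p + ?q) + 2 ^ (?p + ?q)"
      by (intro add_mono power_increasing) auto
    also have "\<dots> \<le> 2 ^ (2 + ?p + ?q)" by (simp add: power_add)
    finally show ?thesis .
  qed
  have mult: "\<bar>a * b\<bar> < 2 ^ (2 + floorlog 2 (nat \<bar>a\<bar>) + floorlog 2 (nat \<bar>b\<bar>))" for a b :: int
  proof -
    let ?p = "floorlog 2 (nat \<bar>a\<bar>)" and ?q = "floorlog 2 (nat \<bar>b\<bar>)"
    have "\<bar>a * b\<bar> < 2 ^ ?p * 2 ^ ?q"
      unfolding abs_mult using abs_less_power_floorlog[of a] abs_less_power_floorlog[of b]
      by (rule mult_strict_mono) simp_all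
    also have "\<dots> = 2 ^ (?p + ?q)" by (simp add: power_add)
    also have "\<dots> \<le> 2 ^ (2 + ?p + ?q)" by (intro power_increasing) auto
    finally show ?thesis .
  qed
  \<comment> \<open>Rounding down does not leave the interval from \<open>- \<bar>a\<bar>\<close> to
    \<open>\<bar>a\<bar>\<close>, since its ends are integers. The weaker bound is the one that
    \<open>plus\<close> already handles.\<close>
  have quot: "\<bar>a div b\<bar> \<le> \<bar>a\<bar> + \<bar>b\<bar>" for a b :: int
  proof (cases "b = 0")
    case False
    have "1 \<le> \<bar>real_of_int b\<bar>" using False by (simp flip: of_int_abs)
    then have "\<bar>real_of_int a / real_of_int b\<bar> \<le> real_of_int \<bar>a\<bar>"
      using False by (simp add: abs_divide divide_le_eq mult_le_cancel_left1)
    then have "real_of_int (- \<bar>a\<bar>) \<le> real_of_int a / real_of_int b"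
      "real_of_int a / real_of_int b \<le> real_of_int \<bar>a\<bar>" by linarith+
    then have "- \<bar>a\<bar> \<le> \<lfloor>real_of_int a / real_of_int b\<rfloor>" "\<lfloor>real_of_int a / real_of_int b\<rfloor> \<le> \<bar>a\<bar>"
      unfolding le_floor_iff by linarith+
    then have "\<bar>a div b\<bar> \<le> \<bar>a\<bar>" unfolding floor_divide_of_int_eq by linarith
    then show ?thesis by linarith
  qed simp
  have "dsize (Num (a div b)) \<le> 3 + floorlog 2 (nat \<bar>a\<bar>) + floorlog 2 (nat \<bar>b\<bar>)" for a b
    using dsize_Num_le[of "a div b" "2 + floorlog 2 (nat \<bar>a\<bar>) + floorlog 2 (nat \<bar>b\<bar>)"]
      quot[of a b] plus[of a b] by linarith
  moreover have "dsize (Num (a + b)) \<le> 3 + floorlog 2 (nat \<bar>a\<bar>) + floorlog 2 (nat \<bar>b\<bar>)" for a b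
    using dsize_Num_le[of "a + b" "2 + floorlog 2 (nat \<bar>a\<bar>) + floorlog 2 (nat \<bar>b\<bar>)"]
      plus[of a b] by linarith
  moreover have "dsize (Num (a - b)) \<le> 3 + floorlog 2 (nat \<bar>a\<bar>) + floorlog 2 (nat \<bar>b\<bar>)" for a b
    using dsize_Num_le[of "a - b" "2 + floorlog 2 (nat \<bar>a\<bar>) + floorlog 2 (nat \<bar>b\<bar>)"]
      plus[of a b] by linarith
  moreover have "dsize (Num (a * b)) \<le> 3 + floorlog 2 (nat \<bar>a\<bar>) + floorlog 2 (nat \<bar>b\<bar>)" for a b
    using dsize_Num_le[of "a * b" "2 + floorlog 2 (nat \<bar>a\<bar>) + floorlog 2 (nat \<bar>b\<bar>)"]
      mult[of a b] by linarith
  moreover have "dsize (Num (if a \<le> b then 1 else 0)) \<le> 3 + floorlog 2 (nat \<bar>a\<bar>) + floorlog 2 (nat \<bar>b\<bar>)" for a b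
    by (auto simp: floorlog_def)
  ultimately show ?thesis
    using arith zero[of v] dsize_pos
    by (cases f) (auto split: data.split simp: floorlog_def Suc_le_eq)
qed

section \<open>Families of polynomial-time programs\<close>

text \<open>A base of at least 2 lets the exponent absorb constant factors and sums, so no leading
  coefficient has to be carried along. The exponent is common to all indices.\<close>

definition poly_bounded :: "('i \<Rightarrow> nat) \<Rightarrow> ('i \<Rightarrow> data set) \<Rightarrow> ('i \<Rightarrow> data \<Rightarrow> nat) \<Rightarrow> bool" where
  "poly_bounded s D h \<longleftrightarrow> (\<exists>d. \<forall>i. \<forall>v \<in> D i. h i v \<le> (2 + s i + dsize v) ^ d)"

text \<open>Programs of different indices need not be related to each other; only the bound is
  uniform. This matches families with one algorithm for each \<epsilon> and \<open>p\<close>.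
  Outside \<open>D\<close> the function is unconstrained.\<close>

definition polytime :: "('i \<Rightarrow> nat) \<Rightarrow> ('i \<Rightarrow> data set) \<Rightarrow> ('i \<Rightarrow> data \<Rightarrow> data) \<Rightarrow> bool" where
  "polytime s D f \<longleftrightarrow>
     (\<exists>A h. poly_bounded s D h \<and> (\<forall>i. \<forall>v \<in> D i. \<exists>t \<le> h i v. runs (A i) v (f i v) t))"

section \<open>Calculus of polynomial bounds\<close>

lemma poly_bounded_mono:
  "poly_bounded s D h \<Longrightarrow> (\<And>i v. v \<in> D i \<Longrightarrow> h' i v \<le> h i v) \<Longrightarrow> poly_bounded s D h'"
  unfolding poly_bounded_def by (meson le_trans)

lemma poly_bounded_subset:
  "poly_bounded s D h \<Longrightarrow> (\<And>i v. v \<in> D' i \<Longrightarrow> v \<in> D i) \<Longrightarrow> poly_bounded s D' h"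
  unfolding poly_bounded_def by blast

lemma poly_bounded_const: "poly_bounded s D (\<lambda>i v. c)"
proof -
  have "c \<le> (2 + s i + dsize v) ^ c" for i v
  proof -
    have "c \<le> 2 ^ c" by (simp add: less_imp_le)
    also have "\<dots> \<le> (2 + s i + dsize v) ^ c" by (intro power_mono) auto
    finally show ?thesis .
  qed
  then show ?thesis unfolding poly_bounded_def by blast
qed

lemma poly_bounded_size: "poly_bounded s D (\<lambda>i v. dsize v)"
  unfolding poly_bounded_def by (intro exI[of _ 1]) auto

lemma poly_bounded_param: "poly_bounded s D (\<lambda>i v. s i)"
  unfolding poly_bounded_def by (intro exI[of _ 1]) auto

lemma poly_bounded_mult:
  assumes "poly_bounded s D f" "poly_bounded s D g"
  shows "poly_bounded s D (\<lambda>i v. f i v * g i v)"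
proof -
  from assms obtain d e where de: "\<And>i v. v \<in> D i \<Longrightarrow> f i v \<le> (2 + s i + dsize v) ^ d"
    "\<And>i v. v \<in> D i \<Longrightarrow> g i v \<le> (2 + s i + dsize v) ^ e"
    unfolding poly_bounded_def by blast
  have "f i v * g i v \<le> (2 + s i + dsize v) ^ (d + e)" if "v \<in> D i" for i v
    unfolding power_add using de[OF that] by (rule mult_le_mono)
  then show ?thesis unfolding poly_bounded_def by blast
qed

lemma poly_bounded_add:
  assumes "poly_bounded s D f" "poly_bounded s D g"
  shows "poly_bounded s D (\<lambda>i v. f i v + g i v)"
proof -
  from assms obtain d e where de: "\<And>i v. v \<in> D i \<Longrightarrow> f i v \<le> (2 + s i + dsize v) ^ d"
    "\<And>i v. v \<in> D i \<Longrightarrow> g i v \<le> (2 + s i + dsize v) ^ e"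
    unfolding poly_bounded_def by blast
  have "f i v + g i v \<le> (2 + s i + dsize v) ^ (1 + (d + e))" if "v \<in> D i" for i v
  proof -
    define a where "a = 2 + s i + dsize v"
    have "a ^ d \<le> a ^ (d + e)" "a ^ e \<le> a ^ (d + e)" by (auto intro!: power_increasing simp: a_def)
    then have "f i v + g i v \<le> 2 * a ^ (d + e)"
      using de[OF that] unfolding a_def by linarith
    also have "\<dots> \<le> a * a ^ (d + e)" by (intro mult_right_mono) (auto simp: a_def)
    finally show ?thesis by (simp add: a_def)
  qed
  then show ?thesis unfolding poly_bounded_def by blast
qed

lemma poly_bounded_power:
  "poly_bounded s D f \<Longrightarrow> poly_bounded s D (\<lambda>i v. f i v ^ d)"
  by (induction d) (auto intro: poly_bounded_const[of _ _ 1, simplified] poly_bounded_mult)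

lemmas poly_bounded_intros =
  poly_bounded_const poly_bounded_size poly_bounded_param poly_bounded_mult poly_bounded_add
  poly_bounded_power

lemma poly_bounded_comp:
  assumes h: "poly_bounded s D' h" and f: "poly_bounded s D (\<lambda>i v. dsize (f i v))"
    and D: "\<And>i v. v \<in> D i \<Longrightarrow> f i v \<in> D' i"
  shows "poly_bounded s D (\<lambda>i v. h i (f i v))"
proof -
  from h obtain d where d: "\<And>i v. v \<in> D' i \<Longrightarrow> h i v \<le> (2 + s i + dsize v) ^ d"
    unfolding poly_bounded_def by blast
  have "poly_bounded s D (\<lambda>i v. (2 + s i + dsize (f i v)) ^ d)"
    by (intro poly_bounded_intros f)
  then show ?thesis
    by (rule poly_bounded_mono) (use d D in auto)
qed

section \<open>Closure properties of polynomial-time functions\<close>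

lemma polytimeI:
  assumes "poly_bounded s D h" "\<And>i v. v \<in> D i \<Longrightarrow> \<exists>t. t \<le> h i v \<and> runs (A i) v (f i v) t"
  shows "polytime s D f"
  using assms unfolding polytime_def by blast

text \<open>Writing is charged, so the running time bounds the size of the output. This is what
  \<open>poly_bounded_comp\<close> needs to keep compositions polynomial.\<close>

lemma polytime_size:
  assumes "polytime s D f"
  shows "poly_bounded s D (\<lambda>i v. dsize (f i v))"
proof -
  obtain A h where "poly_bounded s D h" "\<forall>i. \<forall>v \<in> D i. \<exists>t \<le> h i v. runs (A i) v (f i v) t"
    using assms unfolding polytime_def by blast
  then show ?thesis
    by (elim poly_bounded_mono) (meson le_trans runs_size)
qed

lemma polytime_subset:
  "polytime s D f \<Longrightarrow> (\<And>i v. v \<in> D' i \<Longrightarrow> v \<in> D i) \<Longrightarrow> polytime s D' f"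
  unfolding polytime_def using poly_bounded_subset by blast

lemma polytime_cong:
  "polytime s D f \<Longrightarrow> (\<And>i v. v \<in> D i \<Longrightarrow> f i v = g i v) \<Longrightarrow> polytime s D g"
  unfolding polytime_def by simp

lemma polytime_id: "polytime s D (\<lambda>i v. v)"
proof (rule polytimeI)
  show "poly_bounded s D (\<lambda>i v. 1 + dsize v + dsize v)" by (intro poly_bounded_intros)
  show "\<exists>t. t \<le> 1 + dsize v + dsize v \<and> runs (Prim Nop) v v t" for v
    using runs.Prim[of v Nop v] by auto
qed

text \<open>The constant is written into the program of its index. Data that no program could
  compute, such as the rounding of a real parameter, are thus available at the price of their
  size.\<close>

lemma polytime_param_const:
  assumes "poly_bounded s D (\<lambda>i v. dsize (c i))"
  shows "polytime s D (\<lambda>i v. c i)"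
proof (rule polytimeI)
  show "poly_bounded s D (\<lambda>i v. 1 + dsize (c i))" by (intro poly_bounded_intros assms)
  show "\<exists>t. t \<le> 1 + dsize (c i) \<and> runs (Const (c i)) v (c i) t" for i v
    using runs.Const by blast
qed

lemma polytime_const: "polytime s D (\<lambda>i v. c)"
  by (intro polytime_param_const poly_bounded_const)

lemma polytime_comp:
  assumes g: "polytime s D' g" and f: "polytime s D f" and D: "\<And>i v. v \<in> D i \<Longrightarrow> f i v \<in> D' i"
  shows "polytime s D (\<lambda>i v. g i (f i v))"
proof -
  obtain A h where A: "poly_bounded s D h" "\<forall>i. \<forall>v \<in> D i. \<exists>t \<le> h i v. runs (A i) v (f i v) t"
    using f unfolding polytime_def by blast
  obtain B h' where B: "poly_bounded s D' h'" "\<forall>i. \<forall>v \<in> D' i. \<exists>t \<le> h' i v. runs (B i) v (g i v) t"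
    using g unfolding polytime_def by blast
  show ?thesis
  proof (rule polytimeI)
    show "poly_bounded s D (\<lambda>i v. 1 + h i v + h' i (f i v))"
      by (intro poly_bounded_intros A poly_bounded_comp[OF B(1) polytime_size[OF f] D])
    fix i v
    assume v: "v \<in> D i"
    obtain t where t: "t \<le> h i v" "runs (A i) v (f i v) t" using A(2) v by blast
    obtain t' where t': "t' \<le> h' i (f i v)" "runs (B i) (f i v) (g i (f i v)) t'"
      using B(2) D[OF v] by blast
    show "\<exists>t. t \<le> 1 + h i v + h' i (f i v) \<and> runs (Seq (A i) (B i)) v (g i (f i v)) t"
      using runs.Seq[OF t(2) t'(2)] t(1) t'(1) by (intro exI[of _ "1 + t + t'"]) auto
  qed
qed

lemma polytime_prim:
  assumes "polytime s D f"
  shows "polytime s D (\<lambda>i v. prim_val p (f i v))"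
proof (rule polytime_comp[OF _ assms])
  show "polytime s (\<lambda>i. UNIV) (\<lambda>i. prim_val p)"
  proof (rule polytimeI)
    show "poly_bounded s (\<lambda>i. UNIV) (\<lambda>i v. 1 + dsize v + dsize v)" by (intro poly_bounded_intros)
    show "\<exists>t. t \<le> 1 + dsize v + dsize v \<and> runs (Prim p) v (prim_val p v) t" for v
      using runs.Prim[OF refl, of p v] dsize_prim_val_le[of p v] by (metis add_le_cancel_left)
  qed
qed auto

lemma polytime_Cell:
  assumes f: "polytime s D f" and g: "polytime s D g"
  shows "polytime s D (\<lambda>i v. Cell (f i v) (g i v))"
proof -
  obtain A h where A: "poly_bounded s D h" "\<forall>i. \<forall>v \<in> D i. \<exists>t \<le> h i v. runs (A i) v (f i v) t"
    using f unfolding polytime_def by blast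
  obtain B h' where B: "poly_bounded s D h'" "\<forall>i. \<forall>v \<in> D i. \<exists>t \<le> h' i v. runs (B i) v (g i v) t"
    using g unfolding polytime_def by blast
  show ?thesis
  proof (rule polytimeI)
    show "poly_bounded s D (\<lambda>i v. 1 + dsize v + h i v + h' i v)"
      by (intro poly_bounded_intros A B)
    fix i v
    assume v: "v \<in> D i"
    obtain t where t: "t \<le> h i v" "runs (A i) v (f i v) t" using A(2) v by blast
    obtain t' where t': "t' \<le> h' i v" "runs (B i) v (g i v) t'"
      using B(2) v by blast
    show "\<exists>t. t \<le> 1 + dsize v + h i v + h' i v \<and> runs (Fork (A i) (B i)) v (Cell (f i v) (g i v)) t"
      using runs.Fork[OF t(2) t'(2)] t(1) t'(1) by (intro exI[of _ "1 + dsize v + t + t'"]) auto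
  qed
qed

lemma polytime_if:
  assumes b: "polytime s D b" and f: "polytime s D f" and g: "polytime s D g"
  shows "polytime s D (\<lambda>i v. if b i v \<noteq> Num 0 then f i v else g i v)"
proof -
  obtain B h0 where B: "poly_bounded s D h0" "\<forall>i. \<forall>v \<in> D i. \<exists>t \<le> h0 i v. runs (B i) v (b i v) t"
    using b unfolding polytime_def by blast
  obtain F h1 where F: "poly_bounded s D h1" "\<forall>i. \<forall>v \<in> D i. \<exists>t \<le> h1 i v. runs (F i) v (f i v) t"
    using f unfolding polytime_def by blast
  obtain G h2 where G: "poly_bounded s D h2" "\<forall>i. \<forall>v \<in> D i. \<exists>t \<le> h2 i v. runs (G i) v (g i v) t"
    using g unfolding polytime_def by blast
  show ?thesis
  proof (rule polytimeI)
    show "poly_bounded s D (\<lambda>i v. 1 + dsize v + h0 i v + (h1 i v + h2 i v))"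
      by (intro poly_bounded_intros B F G)
    fix i v
    assume v: "v \<in> D i"
    obtain t0 where t0: "t0 \<le> h0 i v" "runs (B i) v (b i v) t0" using B(2) v by blast
    obtain t1 where t1: "t1 \<le> h1 i v" "runs (F i) v (f i v) t1" using F(2) v by blast
    obtain t2 where t2: "t2 \<le> h2 i v" "runs (G i) v (g i v) t2" using G(2) v by blast
    show "\<exists>t. t \<le> 1 + dsize v + h0 i v + (h1 i v + h2 i v) \<and>
        runs (Cond (B i) (F i) (G i)) v (if b i v \<noteq> Num 0 then f i v else g i v) t"
    proof (cases "b i v = Num 0")
      case True
      then show ?thesis using runs.CondF[OF _ t2(2), of "B i" t0 "F i"] t0 t2(1)
        by (intro exI[of _ "1 + dsize v + t0 + t2"]) auto
    next
      case False
      then show ?thesis using runs.CondT[OF t0(2) False t1(2), of "G i"] t0(1) t1(1)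
        by (intro exI[of _ "1 + dsize v + t0 + t1"]) auto
    qed
  qed
qed

text \<open>Polynomially many polynomial-time iterations may still blow up, for instance by repeated
  squaring. Therefore \<open>h\<close> bounds every reachable state in terms of the initial value.
  The invariant sees that initial value too, so it can say what has been computed from it.\<close>

lemma polytime_while:
  assumes b: "polytime s D' b" and g: "polytime s (\<lambda>i. {u \<in> D' i. b i u \<noteq> Num 0}) g"
    and h: "poly_bounded s D h" and n: "poly_bounded s D n"
    and init: "\<And>i v. v \<in> D i \<Longrightarrow> Inv i v v"
    and start: "\<And>i v. v \<in> D i \<Longrightarrow> \<mu> i v v \<le> n i v"
    and dom: "\<And>i v u. v \<in> D i \<Longrightarrow> Inv i v u \<Longrightarrow> u \<in> D' i"
    and size: "\<And>i v u. v \<in> D i \<Longrightarrow> Inv i v u \<Longrightarrow> dsize u \<le> h i v"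
    and step: "\<And>i v u. v \<in> D i \<Longrightarrow> Inv i v u \<Longrightarrow> b i u \<noteq> Num 0 \<Longrightarrow> Inv i v (g i u)"
    and decr: "\<And>i v u. v \<in> D i \<Longrightarrow> Inv i v u \<Longrightarrow> b i u \<noteq> Num 0 \<Longrightarrow> \<mu> i v (g i u) < (\<mu> i v u :: nat)"
  obtains f where "polytime s D f"
    and "\<And>i v. v \<in> D i \<Longrightarrow> Inv i v (f i v)" and "\<And>i v. v \<in> D i \<Longrightarrow> b i (f i v) = Num 0"
proof -
  obtain B h0 where B: "poly_bounded s D' h0" "\<forall>i. \<forall>v \<in> D' i. \<exists>t \<le> h0 i v. runs (B i) v (b i v) t"
    using b unfolding polytime_def by blast
  obtain G h1 where G: "poly_bounded s (\<lambda>i. {u \<in> D' i. b i u \<noteq> Num 0}) h1"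
      "\<forall>i. \<forall>v \<in> {u \<in> D' i. b i u \<noteq> Num 0}. \<exists>t \<le> h1 i v. runs (G i) v (g i v) t"
    using g unfolding polytime_def by blast
  obtain d0 where d0: "\<And>i v. v \<in> D' i \<Longrightarrow> h0 i v \<le> (2 + s i + dsize v) ^ d0"
    using B(1) unfolding poly_bounded_def by blast
  obtain d1 where d1: "\<And>i v. v \<in> D' i \<Longrightarrow> b i v \<noteq> Num 0 \<Longrightarrow> h1 i v \<le> (2 + s i + dsize v) ^ d1"
    using G(1) unfolding poly_bounded_def by blast
  \<comment> \<open>Cost of one iteration in any reachable state.\<close>
  define K where "K i v = 1 + h i v + (2 + s i + h i v) ^ d0 + (2 + s i + h i v) ^ d1" for i v
  \<comment> \<open>The summand 1 next to the measure pays for the last test, the one that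
    fails.\<close>
  have main: "\<exists>w t. runs (While (B i) (G i)) u w t \<and> Inv i v w \<and> b i w = Num 0 \<and>
      t \<le> (\<mu> i v u + 1) * K i v" if v: "v \<in> D i" and "Inv i v u" for i v u
    using that(2)
  proof (induction "\<mu> i v u" arbitrary: u rule: less_induct)
    case less
    note u = dom[OF v less.prems] size[OF v less.prems]
    obtain t0 where t0: "t0 \<le> h0 i u" "runs (B i) u (b i u) t0" using B(2) u by blast
    have K0: "(2 + s i + dsize u) ^ d0 \<le> (2 + s i + h i v) ^ d0"
      "(2 + s i + dsize u) ^ d1 \<le> (2 + s i + h i v) ^ d1"
      using u(2) by (auto intro!: power_mono)
    show ?case
    proof (cases "b i u = Num 0")
      case True
      then have "runs (While (B i) (G i)) u u (1 + dsize u + t0)"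
        using t0 runs.WhileF by metis
      moreover have "1 + dsize u + t0 \<le> K i v"
        using d0[OF u(1)] t0(1) u(2) K0 unfolding K_def by linarith
      then have "1 + dsize u + t0 \<le> (\<mu> i v u + 1) * K i v" by simp
      ultimately show ?thesis using less.prems True by blast
    next
      case False
      obtain t1 where t1: "t1 \<le> h1 i u" "runs (G i) u (g i u) t1" using G(2) u False by blast
      have K: "1 + dsize u + t0 + t1 \<le> K i v"
        using d0[OF u(1)] d1[OF u(1) False] t0(1) t1(1) u(2) K0 unfolding K_def by linarith
      note st = step[OF v less.prems False] decr[OF v less.prems False]
      obtain w t where w: "runs (While (B i) (G i)) (g i u) w t" "Inv i v w" "b i w = Num 0"
          "t \<le> (\<mu> i v (g i u) + 1) * K i v"
        using less.hyps[OF st(2,1)] by blast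
      have r: "runs (While (B i) (G i)) u w (1 + dsize u + t0 + t1 + t)"
        by (rule runs.WhileT[OF t0(2) False t1(2) w(1)])
      have "(\<mu> i v (g i u) + 1) * K i v \<le> \<mu> i v u * K i v"
        using st(2) by (intro mult_right_mono) auto
      then have "1 + dsize u + t0 + t1 + t \<le> (\<mu> i v u + 1) * K i v"
        using K w(4) by simp
      with r w show ?thesis by blast
    qed
  qed
  have "\<forall>i v. \<exists>w. v \<in> D i \<longrightarrow> (\<exists>t. runs (While (B i) (G i)) v w t \<and> Inv i v w \<and> b i w = Num 0 \<and>
      t \<le> (\<mu> i v v + 1) * K i v)" using main init by meson
  then obtain f where f: "\<And>i v. v \<in> D i \<Longrightarrow> \<exists>t. runs (While (B i) (G i)) v (f i v) t \<and>
      Inv i v (f i v) \<and> b i (f i v) = Num 0 \<and> t \<le> (\<mu> i v v + 1) * K i v" by metis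
  show thesis
  proof (rule that[of f])
    show "polytime s D f"
    proof (rule polytimeI)
      show "poly_bounded s D (\<lambda>i v. (n i v + 1) * K i v)"
        unfolding K_def by (intro poly_bounded_intros h n)
      fix i v
      assume v: "v \<in> D i"
      have "(\<mu> i v v + 1) * K i v \<le> (n i v + 1) * K i v"
        using start[OF v] by (intro mult_right_mono) auto
      then show "\<exists>t. t \<le> (n i v + 1) * K i v \<and> runs (While (B i) (G i)) v (f i v) t"
        using f[OF v] le_trans by blast
    qed
  qed (use f in auto)
qed

section \<open>Vectors and lists\<close>

declare prim_val.simps [simp del]

abbreviation dfst :: "data \<Rightarrow> data" where "dfst \<equiv> prim_val First"
abbreviation dsnd :: "data \<Rightarrow> data" where "dsnd \<equiv> prim_val Second"

lemma prim_val_simps [simp]: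
  "dfst (Cell a b) = a" "dsnd (Cell a b) = b"
  "prim_val IsCell (Cell a b) = Num 1" "prim_val IsCell (Num n) = Num 0"
  "dfst (Num n) = Num 0"
  by (simp_all add: prim_val.simps)

section \<open>Arithmetic on encoded integers\<close>

fun dint :: "data \<Rightarrow> int" where
  "dint (Num n) = n"
| "dint (Cell a b) = 0"

lemma polytime_dint: "polytime s D f \<Longrightarrow> polytime s D (\<lambda>i v. Num (dint (f i v)))"
proof (rule polytime_cong)
  \<comment> \<open>Adding zero acts as a coercion: on anything but a pair of numbers
    \<open>arith\<close> returns \<open>Num 0\<close>, which agrees with the default of
    \<open>dint\<close> on cells.\<close>
  show "polytime s D f \<Longrightarrow> polytime s D (\<lambda>i v. prim_val Add (Cell (f i v) (Num 0)))"
    by (intro polytime_prim polytime_Cell polytime_const)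
  show "prim_val Add (Cell (f i v) (Num 0)) = Num (dint (f i v))" for i v
    by (cases "f i v") (auto simp: prim_val.simps)
qed

lemma polytime_arith:
  assumes a: "polytime s D (\<lambda>i v. Num (a i v))" and b: "polytime s D (\<lambda>i v. Num (b i v))"
  shows polytime_add: "polytime s D (\<lambda>i v. Num (a i v + b i v))"
    and polytime_diff: "polytime s D (\<lambda>i v. Num (a i v - b i v))"
    and polytime_mult: "polytime s D (\<lambda>i v. Num (a i v * b i v))"
    and polytime_div: "polytime s D (\<lambda>i v. Num (a i v div b i v))"
    and polytime_le: "polytime s D (\<lambda>i v. Num (if a i v \<le> b i v then 1 else 0))"
  using polytime_prim[OF polytime_Cell[OF a b], of Add] polytime_prim[OF polytime_Cell[OF a b], of Sub]
    polytime_prim[OF polytime_Cell[OF a b], of Mul] polytime_prim[OF polytime_Cell[OF a b], of Div]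
    polytime_prim[OF polytime_Cell[OF a b], of Le]
  by (simp_all add: prim_val.simps)

lemma polytime_if_le:
  assumes "polytime s D (\<lambda>i v. Num (a i v))" "polytime s D (\<lambda>i v. Num (b i v))"
    "polytime s D f" "polytime s D g"
  shows "polytime s D (\<lambda>i v. if a i v \<le> b i v then f i v else g i v)"
  using polytime_if[OF polytime_le[OF assms(1,2)] assms(3,4)] by (rule polytime_cong) simp

lemma polytime_max:
  assumes "polytime s D (\<lambda>i v. Num (a i v))" "polytime s D (\<lambda>i v. Num (b i v))"
  shows "polytime s D (\<lambda>i v. Num (max (a i v) (b i v)))"
  using polytime_if_le[OF assms assms(2,1)] by (rule polytime_cong) simp

lemma polytime_abs:
  assumes "polytime s D (\<lambda>i v. Num (a i v))"
  shows "polytime s D (\<lambda>i v. Num \<bar>a i v\<bar>)"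
  using polytime_max[OF assms polytime_diff[OF polytime_const[of _ _ "Num 0"] assms]]
  by (rule polytime_cong) simp

text \<open>The index set is fixed, so the sum is unrolled inside the program. In use it ranges over
  the objectives.\<close>

lemma polytime_sum:
  assumes "finite S" "\<And>j. j \<in> S \<Longrightarrow> polytime s D (\<lambda>i v. Num (a j i v))"
  shows "polytime s D (\<lambda>i v. Num (\<Sum>j \<in> S. a j i v))"
  using assms by (induction S rule: finite_induct) (auto intro: polytime_const polytime_add)

lemma polytime_prod:
  assumes "finite S" "\<And>j. j \<in> S \<Longrightarrow> polytime s D (\<lambda>i v. Num (a j i v))"
  shows "polytime s D (\<lambda>i v. Num (\<Prod>j \<in> S. a j i v))"
  using assms by (induction S rule: finite_induct) (auto intro: polytime_const polytime_mult)

lemma polytime_Max: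
  assumes "finite S" "S \<noteq> {}" "\<And>j. j \<in> S \<Longrightarrow> polytime s D (\<lambda>i v. Num (a j i v))"
  shows "polytime s D (\<lambda>i v. Num (Max ((\<lambda>j. a j i v) ` S)))"
  using assms by (induction S rule: finite_ne_induct) (auto intro: polytime_max)

lemma polytime_enc_map:
  assumes "\<And>j. j \<in> set js \<Longrightarrow> polytime s D (\<lambda>i v. f j i v)"
  shows "polytime s D (\<lambda>i v. enc_list (map (\<lambda>j. f j i v) js))"
  using assms by (induction js) (auto intro: polytime_const polytime_Cell)

section \<open>Components of encoded vectors and unique decoding\<close>

fun dcomp :: "'k list \<Rightarrow> 'k \<Rightarrow> data \<Rightarrow> data" where
  "dcomp [] j v = Num 0"
| "dcomp (k # ks) j v = (if k = j then dfst v else dcomp ks j (dsnd v))"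

lemma dcomp_enc_list: "j \<in> set js \<Longrightarrow> dcomp js j (enc_list (map f js)) = f j"
  by (induction js) auto

lemma polytime_dcomp: "polytime s D f \<Longrightarrow> polytime s D (\<lambda>i v. dcomp js j (f i v))"
proof (induction js arbitrary: f)
  case (Cons k ks)
  show ?case
  proof (cases "k = j")
    case True
    then show ?thesis using polytime_prim[OF Cons.prems] by simp
  next
    case False
    then show ?thesis using Cons.IH[OF polytime_prim[OF Cons.prems]] by simp
  qed
qed (simp add: polytime_const)

abbreviation component :: "'k::enum \<Rightarrow> data \<Rightarrow> data" where
  "component \<equiv> dcomp enum_class.enum"

lemma component_enc_natvec [simp]: "component j (enc_natvec y) = Num (int (y $ j))"
  by (simp add: enc_natvec_def dcomp_enc_list enum_UNIV)

lemma component_enc_ratvec [simp]: "component j (enc_ratvec y) = enc_rat (y $ j)"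
  by (simp add: enc_ratvec_def dcomp_enc_list enum_UNIV)

text \<open>Unique decoding allows a requirement on an encoded input to be stated for all parameters
  that encode to it, since there is only one choice of them.\<close>

lemma enc_natvec_inject [simp]:
  fixes y z :: "nat ^ 'a::enum"
  shows "enc_natvec y = enc_natvec z \<longleftrightarrow> y = z"
proof
  assume "enc_natvec y = enc_natvec z"
  then have "component j (enc_natvec y) = component j (enc_natvec z)" for j :: 'a by simp
  then show "y = z" by (simp add: vec_eq_iff)
qed simp

lemma enc_rat_inject [simp]: "enc_rat p = enc_rat q \<longleftrightarrow> p = q"
  by (auto simp: enc_rat_def intro: quotient_of_inject prod_eqI)

lemma enc_ratvec_inject [simp]:
  fixes y z :: "rat ^ 'a::enum"
  shows "enc_ratvec y = enc_ratvec z \<longleftrightarrow> y = z"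
proof
  assume "enc_ratvec y = enc_ratvec z"
  then have "component j (enc_ratvec y) = component j (enc_ratvec z)" for j :: 'a by simp
  then show "y = z" by (simp add: vec_eq_iff)
qed simp

lemma enc_list_inject [simp]: "enc_list xs = enc_list ys \<longleftrightarrow> xs = ys"
proof (induction xs arbitrary: ys)
  case Nil
  then show ?case by (cases ys) auto
next
  case (Cons x xs)
  then show ?case by (cases ys) auto
qed

lemmas polytime_intros =
  polytime_id polytime_const polytime_Cell polytime_dint polytime_add polytime_diff polytime_mult
  polytime_div polytime_max polytime_abs polytime_dcomp polytime_if_le

lemmas polytime_Second = polytime_prim[where p = Second]

section \<open>Loops over lists\<close>

fun dlen :: "data \<Rightarrow> nat" where
  "dlen (Num n) = 0"
| "dlen (Cell a b) = Suc (dlen b)"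

lemma dlen_le_dsize: "dlen v \<le> dsize v"
  by (induction v) auto

lemma dlen_enc_list [simp]: "dlen (enc_list xs) = length xs"
  by (induction xs) auto

lemma dsize_mem_enc_list: "x \<in> set xs \<Longrightarrow> dsize x \<le> dsize (enc_list xs)"
  by (induction xs) auto

lemma length_le_dsize_enc_list: "length xs \<le> dsize (enc_list xs)"
  using dlen_le_dsize[of "enc_list xs"] by simp

lemma dsize_enc_list_drop: "dsize (enc_list (drop n xs)) \<le> dsize (enc_list xs)"
proof (induction xs arbitrary: n)
  case (Cons x xs)
  then show ?case by (cases n) (auto intro: le_SucI trans_le_add2)
qed simp

text \<open>The loop state holds the input, the rest of the list and the accumulator. The input
  stays available to \<open>g\<close> in every round. The size of the accumulator must be bounded
  separately, because \<open>g\<close> alone may let it grow in each round; \<open>D'\<close> has to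
  contain only the triples that really occur.\<close>

lemma polytime_foldl:
  assumes L: "polytime s D (\<lambda>i v. enc_list (L i v))" and a: "polytime s D a" and g: "polytime s D' g"
    and dom: "\<And>i v n. v \<in> D i \<Longrightarrow> n < length (L i v) \<Longrightarrow>
      Cell v (Cell (L i v ! n) (foldl (\<lambda>c x. g i (Cell v (Cell x c))) (a i v) (take n (L i v)))) \<in> D' i"
    and h: "poly_bounded s D h"
    and size: "\<And>i v n. v \<in> D i \<Longrightarrow> n \<le> length (L i v) \<Longrightarrow>
      dsize (foldl (\<lambda>c x. g i (Cell v (Cell x c))) (a i v) (take n (L i v))) \<le> h i v"
  shows "polytime s D (\<lambda>i v. foldl (\<lambda>c x. g i (Cell v (Cell x c))) (a i v) (L i v))"
proof -
  define F where "F i v n = foldl (\<lambda>c x. g i (Cell v (Cell x c))) (a i v) (take n (L i v))" for i v n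
  define st where "st i v n = Cell v (Cell (enc_list (drop n (L i v))) (F i v n))" for i v n
  define D0 where "D0 i = {st i v 0 | v. v \<in> D i}" for i
  define D1 where "D1 i = {st i v n | v n. v \<in> D i \<and> n \<le> length (L i v)}" for i
  define Inv where "Inv i w u \<longleftrightarrow> (\<exists>v n. v \<in> D i \<and> n \<le> length (L i v) \<and> w = st i v 0 \<and> u = st i v n)"
    for i w u
  define b where "b i u = prim_val IsCell (dfst (dsnd u))" for i :: 'a and u
  define G where "G i u = Cell (dfst u) (Cell (dsnd (dfst (dsnd u)))
    (g i (Cell (dfst u) (Cell (dfst (dfst (dsnd u)))
      (dsnd (dsnd u))))))" for i u
  have F_Suc: "F i v (Suc n) = g i (Cell v (Cell (L i v ! n) (F i v n)))" if "n < length (L i v)" for i v n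
    using that by (simp add: F_def take_Suc_conv_app_nth)
  have b: "b i (st i v n) \<noteq> Num 0 \<longleftrightarrow> n < length (L i v)" if "n \<le> length (L i v)" for i v n
  proof (cases "n = length (L i v)")
    case False
    with that have "n < length (L i v)" by simp
    then show ?thesis by (simp add: b_def st_def Cons_nth_drop_Suc[symmetric])
  qed (simp add: b_def st_def)
  have G: "G i (st i v n) = st i v (Suc n)" if "n < length (L i v)" for i v n
    using that by (simp add: G_def st_def F_Suc Cons_nth_drop_Suc[symmetric])
  have fst_st: "dfst (st i v n) = v" for i v n by (simp add: st_def)
  obtain f where f: "polytime s D0 f" "\<And>i v. v \<in> D0 i \<Longrightarrow> Inv i v (f i v)"
    "\<And>i v. v \<in> D0 i \<Longrightarrow> b i (f i v) = Num 0"
  proof (rule polytime_while[where D = D0 and D' = D1 and b = b and g = G and Inv = Inv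
        and s = s and \<mu> = "\<lambda>i v u. dlen (dfst (dsnd u))"
        and h = "\<lambda>i w. 2 + dsize w + dsize w + h i (dfst w)" and n = "\<lambda>i w. dsize w"])
    show "polytime s D1 b" unfolding b_def by (intro polytime_intros polytime_prim)
    show "polytime s (\<lambda>i. {u \<in> D1 i. b i u \<noteq> Num 0}) G"
      unfolding G_def
    proof (intro polytime_intros polytime_prim polytime_comp[OF g])
      fix i u
      assume "u \<in> {u \<in> D1 i. b i u \<noteq> Num 0}"
      then obtain v n where u: "v \<in> D i" "n < length (L i v)" "u = st i v n"
        using b unfolding D1_def by blast
      then show "Cell (dfst u) (Cell (dfst (dfst (dsnd u)))
          (dsnd (dsnd u))) \<in> D' i"
        using dom[OF u(1,2)] by (simp add: st_def F_def Cons_nth_drop_Suc[symmetric])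
    qed
    show "poly_bounded s D0 (\<lambda>i w. 2 + dsize w + dsize w + h i (dfst w))"
    proof (intro poly_bounded_intros poly_bounded_comp[OF h])
      show "poly_bounded s D0 (\<lambda>i v. dsize (dfst v))"
        by (rule poly_bounded_mono[OF poly_bounded_size dsize_prim_val_le])
      show "v \<in> D0 i \<Longrightarrow> dfst v \<in> D i" for i v unfolding D0_def by (auto simp: fst_st)
    qed
    show "poly_bounded s D0 (\<lambda>i. dsize)" by (rule poly_bounded_size)
    show "v \<in> D0 i \<Longrightarrow> Inv i v v" for i v unfolding D0_def Inv_def by blast
    show "dlen (dfst (dsnd v)) \<le> dsize v" for v
      using dlen_le_dsize dsize_prim_val_le le_trans by metis
    show "Inv i v u \<Longrightarrow> u \<in> D1 i" for i v u unfolding D1_def Inv_def by blast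
    show "dsize u \<le> 2 + dsize v + dsize v + h i (dfst v)" if inv: "Inv i v u" for i v u
    proof -
      obtain v' n where "v' \<in> D i" "n \<le> length (L i v')" "v = st i v' 0" "u = st i v' n"
        using inv unfolding Inv_def by blast
      then show ?thesis using dsize_enc_list_drop[of n "L i v'"] size[of v' i n]
        by (simp add: st_def F_def)
    qed
    show "Inv i v (G i u)" if "Inv i v u" "b i u \<noteq> Num 0" for i v u
      using that b G unfolding Inv_def by (metis Suc_le_eq)
    show "dlen (dfst (dsnd (G i u))) < dlen (dfst (dsnd u))"
      if inv: "Inv i v u" "b i u \<noteq> Num 0" for i v u
    proof -
      obtain v' n where "n < length (L i v')" "u = st i v' n"
        using inv b unfolding Inv_def by metis
      then show ?thesis using G by (simp add: st_def)
    qed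
  qed blast
  have res: "f i (st i v 0) = st i v (length (L i v))" if v: "v \<in> D i" for i v
  proof -
    have D0: "st i v 0 \<in> D0 i" using v unfolding D0_def by blast
    obtain v' n where vn: "v' \<in> D i" "n \<le> length (L i v')" "st i v 0 = st i v' 0"
        "f i (st i v 0) = st i v' n"
      using f(2)[OF D0] unfolding Inv_def by blast
    \<comment> \<open>Every state carries the input unchanged, so the initial state determines
      it.\<close>
    have "v' = v" using arg_cong[OF vn(3), of "dfst"] by (simp add: fst_st)
    with vn b f(3)[OF D0] show ?thesis by (metis le_neq_implies_less)
  qed
  have "polytime s D (\<lambda>i v. dsnd (dsnd (f i (Cell v (Cell (enc_list (L i v)) (a i v))))))"
  proof (intro polytime_prim polytime_comp[OF f(1)] polytime_Cell polytime_id L a)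
    show "v \<in> D i \<Longrightarrow> Cell v (Cell (enc_list (L i v)) (a i v)) \<in> D0 i" for i v
      unfolding D0_def st_def F_def by auto
  qed
  then show ?thesis
  proof (rule polytime_cong)
    fix i v
    assume "v \<in> D i"
    then show "dsnd (dsnd (f i (Cell v (Cell (enc_list (L i v)) (a i v))))) =
      foldl (\<lambda>c x. g i (Cell v (Cell x c))) (a i v) (L i v)"
      using res by (simp add: st_def F_def)
  qed
qed

lemma dsize_enc_list_append: "dsize (enc_list (xs @ ys)) \<le> dsize (enc_list xs) + dsize (enc_list ys)"
  by (induction xs) auto

lemma dsize_enc_list_rev [simp]: "dsize (enc_list (rev xs)) = dsize (enc_list xs)"
proof (induction xs)
  case (Cons x xs)
  have "dsize (enc_list (ys @ [x])) = 1 + dsize x + dsize (enc_list ys)" for ys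
    by (induction ys) auto
  with Cons show ?case by simp
qed simp

lemma dsize_enc_list_take: "dsize (enc_list (take n xs)) \<le> dsize (enc_list xs)"
proof (induction xs arbitrary: n)
  case (Cons x xs)
  then show ?case by (cases n) (auto simp: floorlog_def)
qed simp

lemma polytime_rev_append:
  assumes L: "polytime s D (\<lambda>i v. enc_list (L i v))" and K: "polytime s D (\<lambda>i v. enc_list (K i v))"
  shows "polytime s D (\<lambda>i v. enc_list (rev (L i v) @ K i v))"
proof -
  have fold: "foldl (\<lambda>c x. Cell x c) (enc_list ys) xs = enc_list (rev xs @ ys)" for xs ys
  proof (induction xs arbitrary: ys)
    case (Cons x xs)
    from Cons[of "x # ys"] show ?case by simp
  qed simp
  have "polytime s D (\<lambda>i v. foldl (\<lambda>c x. dsnd (Cell v (Cell x c))) (enc_list (K i v)) (L i v))"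
  proof (rule polytime_foldl[where D' = "\<lambda>i. UNIV"])
    show "polytime s (\<lambda>i. UNIV) (\<lambda>i. dsnd)" by (intro polytime_prim polytime_id)
    show "poly_bounded s D (\<lambda>i v. dsize (enc_list (L i v)) + dsize (enc_list (K i v)))"
      by (intro poly_bounded_intros polytime_size L K)
    show "dsize (foldl (\<lambda>c x. dsnd (Cell v (Cell x c))) (enc_list (K i v)) (take n (L i v)))
        \<le> dsize (enc_list (L i v)) + dsize (enc_list (K i v))" for i v n
      using dsize_enc_list_append[of "rev (take n (L i v))" "K i v"] dsize_enc_list_take[of n "L i v"]
      by (simp add: fold)
  qed (use L K in auto)
  then show ?thesis by (simp add: fold)
qed

lemma polytime_rev:
  assumes "polytime s D (\<lambda>i v. enc_list (L i v))"
  shows "polytime s D (\<lambda>i v. enc_list (rev (L i v)))"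
  using polytime_rev_append[OF assms, of "\<lambda>i v. []"] polytime_const[of s D "Num 0"] by simp

text \<open>Prepending is the cheap way to extend a list, so the result is accumulated in reverse
  and turned around once at the end. The function \<open>H\<close> receives the whole input together
  with the element.\<close>

lemma polytime_concat_map:
  assumes L: "polytime s D (\<lambda>i v. enc_list (L i v))" and H: "polytime s D' (\<lambda>i u. enc_list (H i u))"
    and dom: "\<And>i v x. v \<in> D i \<Longrightarrow> x \<in> set (L i v) \<Longrightarrow> Cell v x \<in> D' i"
  shows "polytime s D (\<lambda>i v. enc_list (concat (map (\<lambda>x. H i (Cell v x)) (L i v))))"
proof -
  \<comment> \<open>This only gives the accumulator the syntactic form of an encoded list; at run
    time nothing is decoded.\<close>
  define tails where "tails v = (SOME ys. v = enc_list ys)" for v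
  have tails [simp]: "tails (enc_list xs) = xs" for xs by (simp add: tails_def)
  define g where "g i w = enc_list (rev (H i (Cell (dfst w) (dfst (dsnd w))))
    @ tails (dsnd (dsnd w)))" for i w
  have fold: "foldl (\<lambda>c x. g i (Cell v (Cell x c))) (enc_list ys) xs =
      enc_list (rev (concat (map (\<lambda>x. H i (Cell v x)) xs)) @ ys)" for i v xs ys
    by (induction xs arbitrary: ys) (auto simp: g_def)
  obtain d where d: "\<And>i u. u \<in> D' i \<Longrightarrow> dsize (enc_list (H i u)) \<le> (2 + s i + dsize u) ^ d"
    using polytime_size[OF H] unfolding poly_bounded_def by blast
  \<comment> \<open>Bounds each single block, hence the accumulator by the number of blocks times
    \<open>q\<close>.\<close>
  define q where "q i v = (2 + s i + (1 + dsize v + dsize (enc_list (L i v)))) ^ d" for i v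
  have q: "dsize (enc_list (H i (Cell v x))) \<le> q i v" if "v \<in> D i" "x \<in> set (L i v)" for i v x
  proof -
    have "dsize (enc_list (H i (Cell v x))) \<le> (2 + s i + dsize (Cell v x)) ^ d"
      using that by (intro d dom)
    also have "\<dots> \<le> q i v"
      unfolding q_def using dsize_mem_enc_list[OF that(2)] by (intro power_mono) auto
    finally show ?thesis .
  qed
  have concat: "dsize (enc_list (concat (map (\<lambda>x. H i (Cell v x)) xs))) \<le> 1 + length xs * q i v"
    if "v \<in> D i" "set xs \<subseteq> set (L i v)" for i v xs
    using that(2)
  proof (induction xs)
    case (Cons x xs)
    then show ?case
      using dsize_enc_list_append[of "H i (Cell v x)" "concat (map (\<lambda>x. H i (Cell v x)) xs)"]
        q[OF that(1), of x] by simp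
  qed (simp add: floorlog_def)
  have "polytime s D (\<lambda>i v. foldl (\<lambda>c x. g i (Cell v (Cell x c))) (Num 0) (L i v))"
  proof (rule polytime_foldl[where D' = "\<lambda>i. {Cell v (Cell x (enc_list ys)) | v x ys. v \<in> D i \<and> x \<in> set (L i v)}"])
    show "polytime s (\<lambda>i. {Cell v (Cell x (enc_list ys)) | v x ys. v \<in> D i \<and> x \<in> set (L i v)}) g"
      unfolding g_def
    proof (rule polytime_rev_append)
      show "polytime s (\<lambda>i. {Cell v (Cell x (enc_list ys)) | v x ys. v \<in> D i \<and> x \<in> set (L i v)})
         (\<lambda>i w. enc_list (H i (Cell (dfst w) (dfst (dsnd w)))))"
        by (intro polytime_comp[OF H] polytime_Cell polytime_prim polytime_id) (auto intro: dom)
      show "polytime s (\<lambda>i. {Cell v (Cell x (enc_list ys)) | v x ys. v \<in> D i \<and> x \<in> set (L i v)})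
         (\<lambda>i w. enc_list (tails (dsnd (dsnd w))))"
        by (rule polytime_cong[OF polytime_Second[OF polytime_Second[OF polytime_id]]]) auto
    qed
    show "poly_bounded s D (\<lambda>i v. 1 + dsize (enc_list (L i v)) * q i v)"
      unfolding q_def by (intro poly_bounded_intros polytime_size L)
    show "dsize (foldl (\<lambda>c x. g i (Cell v (Cell x c))) (Num 0) (take n (L i v))) \<le>
        1 + dsize (enc_list (L i v)) * q i v" if "v \<in> D i" for i v n
    proof -
      have "dsize (foldl (\<lambda>c x. g i (Cell v (Cell x c))) (Num 0) (take n (L i v))) \<le>
          1 + length (take n (L i v)) * q i v"
        using concat[OF that, of "take n (L i v)"] fold[of i v "[]" "take n (L i v)"]
        by (simp add: set_take_subset)
      also have "\<dots> \<le> 1 + dsize (enc_list (L i v)) * q i v"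
        using length_le_dsize_enc_list[of "L i v"] by (intro add_left_mono mult_right_mono) auto
      finally show ?thesis .
    qed
    show "Cell v (Cell (L i v ! n) (foldl (\<lambda>c x. g i (Cell v (Cell x c))) (Num 0) (take n (L i v))))
       \<in> {Cell v (Cell x (enc_list ys)) | v x ys. v \<in> D i \<and> x \<in> set (L i v)}"
      if "v \<in> D i" "n < length (L i v)" for i v n
      using that fold[of i v "[]"] by (auto intro: exI)
  qed (intro L polytime_const)+
  then have "polytime s D (\<lambda>i v. enc_list (rev (concat (map (\<lambda>x. H i (Cell v x)) (L i v)))))"
    using fold[of _ _ "[]"] by simp
  from polytime_rev[OF this] show ?thesis by simp
qed

lemma polytime_map:
  assumes L: "polytime s D (\<lambda>i v. enc_list (L i v))" and f: "polytime s D' f"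
    and dom: "\<And>i v x. v \<in> D i \<Longrightarrow> x \<in> set (L i v) \<Longrightarrow> Cell v x \<in> D' i"
  shows "polytime s D (\<lambda>i v. enc_list (map (\<lambda>x. f i (Cell v x)) (L i v)))"
proof -
  have "polytime s D' (\<lambda>i u. enc_list [f i u])" using polytime_Cell[OF f polytime_const] by simp
  from polytime_concat_map[OF L this dom] show ?thesis by (simp add: concat_map_singleton)
qed

text \<open>The keys are reals and are never computed; \<open>le\<close> only compares two
  candidates. The accumulator is always an element of the list, which bounds its size.\<close>

lemma polytime_argmin:
  fixes key :: "'i \<Rightarrow> data \<Rightarrow> data \<Rightarrow> real"
  assumes L: "polytime s D (\<lambda>i v. enc_list (L i v))" and le: "polytime s D' le"
    and nonempty: "\<And>i v. v \<in> D i \<Longrightarrow> L i v \<noteq> []"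
    and dom: "\<And>i v x y. v \<in> D i \<Longrightarrow> x \<in> set (L i v) \<Longrightarrow> y \<in> set (L i v) \<Longrightarrow> Cell v (Cell x y) \<in> D' i"
    and key: "\<And>i v x y. v \<in> D i \<Longrightarrow> x \<in> set (L i v) \<Longrightarrow> y \<in> set (L i v) \<Longrightarrow>
      le i (Cell v (Cell x y)) = Num (if key i v x \<le> key i v y then 1 else 0)"
  obtains f where "polytime s D f" "\<And>i v. v \<in> D i \<Longrightarrow> f i v \<in> set (L i v)"
    "\<And>i v x. v \<in> D i \<Longrightarrow> x \<in> set (L i v) \<Longrightarrow> key i v (f i v) \<le> key i v x"
proof -
  define g where "g i w = (if le i w \<noteq> Num 0 then dfst (dsnd w)
    else dsnd (dsnd w))" for i w
  define F where "F i v = foldl (\<lambda>c x. g i (Cell v (Cell x c))) (dfst (enc_list (L i v)))" for i v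
  have head: "dfst (enc_list (L i v)) \<in> set (L i v)" if "v \<in> D i" for i v
    using nonempty[OF that] by (cases "L i v") auto
  have g: "g i (Cell v (Cell x c)) = (if key i v x \<le> key i v c then x else c)"
    if "v \<in> D i" "x \<in> set (L i v)" "c \<in> set (L i v)" for i v x c
    using key[OF that] by (simp add: g_def)
  have F: "F i v xs \<in> set (L i v) \<and> (\<forall>x \<in> set xs. key i v (F i v xs) \<le> key i v x)"
    if v: "v \<in> D i" and "set xs \<subseteq> set (L i v)" for i v xs
    using that(2)
  proof (induction xs rule: rev_induct)
    case (snoc x xs)
    then have "F i v (xs @ [x]) = (if key i v x \<le> key i v (F i v xs) then x else F i v xs)"
      using g[OF v, of x "F i v xs"] by (simp add: F_def)
    with snoc show ?case by force
  qed (simp add: F_def head[OF v])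
  show thesis
  proof (rule that[of "\<lambda>i v. F i v (L i v)"])
    show "polytime s D (\<lambda>i v. F i v (L i v))"
      unfolding F_def
    proof (rule polytime_foldl[where D' = D' and h = "\<lambda>i v. dsize (enc_list (L i v))"])
      show "polytime s D' g" unfolding g_def by (intro polytime_if le polytime_prim polytime_id)
      show "poly_bounded s D (\<lambda>i v. dsize (enc_list (L i v)))" by (rule polytime_size[OF L])
      fix i v n
      assume v: "v \<in> D i"
      have Fn: "F i v (take n (L i v)) \<in> set (L i v)"
        using F[OF v, of "take n (L i v)"] set_take_subset by fast
      then show "dsize (foldl (\<lambda>c x. g i (Cell v (Cell x c))) (dfst (enc_list (L i v))) (take n (L i v)))
          \<le> dsize (enc_list (L i v))"
        unfolding F_def by (rule dsize_mem_enc_list)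
      assume "n < length (L i v)"
      then show "Cell v (Cell (L i v ! n) (foldl (\<lambda>c x. g i (Cell v (Cell x c)))
          (dfst (enc_list (L i v))) (take n (L i v)))) \<in> D' i"
        using dom[OF v _ Fn] by (simp add: F_def)
    qed (intro L polytime_prim)+
  qed (use F in auto)
qed

section \<open>Enumeration of tuples of fixed length\<close>

fun tuples :: "nat \<Rightarrow> data list \<Rightarrow> data list" where
  "tuples 0 G = [Num 0]"
| "tuples (Suc n) G = concat (map (\<lambda>x. map (\<lambda>t. Cell x t) (tuples n G)) G)"

lemma set_tuples: "set (tuples n G) = {enc_list xs | xs. length xs = n \<and> set xs \<subseteq> set G}"
proof (induction n)
  case (Suc n)
  show ?case
  proof (intro set_eqI iffI)
    fix v
    assume "v \<in> set (tuples (Suc n) G)"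
    then obtain x xs where "v = enc_list (x # xs)" "x \<in> set G" "length xs = n" "set xs \<subseteq> set G"
      using Suc by auto
    then show "v \<in> {enc_list xs | xs. length xs = Suc n \<and> set xs \<subseteq> set G}"
      by (intro CollectI exI[of _ "x # xs"]) auto
  next
    fix v
    assume "v \<in> {enc_list xs | xs. length xs = Suc n \<and> set xs \<subseteq> set G}"
    then obtain x xs where v: "v = enc_list (x # xs)" "length xs = n" "set (x # xs) \<subseteq> set G"
      by (auto simp: length_Suc_conv)
    then have "enc_list xs \<in> set (tuples n G)" unfolding Suc by auto
    with v show "v \<in> set (tuples (Suc n) G)" by auto
  qed
qed auto

text \<open>The length \<open>n\<close> is fixed, so nesting \<open>n\<close> loops stays
  polynomial, with a degree depending on \<open>n\<close>. The domain is generalized in the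
  induction because the inner loop runs on the input extended by the current head.\<close>

lemma polytime_tuples:
  "polytime s D (\<lambda>i v. enc_list (G i v)) \<Longrightarrow> polytime s D (\<lambda>i v. enc_list (tuples n (G i v)))"
proof (induction n arbitrary: D G)
  case 0
  then show ?case by (simp add: polytime_const)
next
  case (Suc n)
  define D' where "D' i = {Cell v x | v x. v \<in> D i}" for i
  have "polytime s D' (\<lambda>i u. enc_list (tuples n (G i (dfst u))))"
    by (intro Suc.IH polytime_comp[OF Suc.prems] polytime_prim polytime_id) (auto simp: D'_def)
  \<comment> \<open>With \<open>u = Cell v x\<close>, the term \<open>dsnd (dfst (Cell u t))\<close>
    is the head \<open>x\<close> of the outer loop.\<close>
  then have "polytime s D' (\<lambda>i u. enc_list (map (\<lambda>t. Cell (dsnd (dfst (Cell u t)))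
      (dsnd (Cell u t))) (tuples n (G i (dfst u)))))"
    by (rule polytime_map[where D' = "\<lambda>i. UNIV"]) (intro polytime_Cell polytime_prim polytime_id UNIV_I)+
  from polytime_concat_map[OF Suc.prems this] show ?case by (simp add: D'_def)
qed

section \<open>Bounds on the objective values and the weight grid\<close>

text \<open>No primitive returns the size of a number, but \<open>4 * n * n + 4\<close> is an
  arithmetic expression of the right magnitude: if \<open>n\<close> has \<open>e\<close> bits, then
  \<open>2 ^ e \<le> 2 * \<bar>n\<bar> \<le> n * n + 1\<close> for nonzero \<open>n\<close>. The
  additional factor 2 in the lower bound accounts for the \<open>Cell\<close> above a leaf, and the
  upper bound keeps the product over all leaves of polynomial length.\<close>

lemma leaf_factor_bounds:
  "2 * 2 ^ dsize (Num n) \<le> 4 * n * n + 4" "4 * n * n + 4 \<le> 2 ^ (2 * (1 + dsize (Num n)))"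
proof -
  let ?e = "floorlog 2 (nat \<bar>n\<bar>)"
  have lower: "4 * (2::int) ^ ?e \<le> 4 * n * n + 4"
  proof (cases "n = 0")
    case False
    then have "(2::nat) ^ (?e - 1) \<le> nat \<bar>n\<bar>" using floorlog_bounds[of "nat \<bar>n\<bar>" 2] by simp
    then have "(2::int) ^ (?e - 1) \<le> \<bar>n\<bar>" by (simp add: nat_le_iff flip: of_nat_le_iff)
    moreover have "?e \<noteq> 0" using False by (simp add: floorlog_eq_zero_iff)
    then have "(2::int) ^ ?e = 2 * 2 ^ (?e - 1)"
      using power_minus_mult[of ?e "2::int"] by linarith
    moreover have "8 * \<bar>n\<bar> \<le> 4 * n * n + 4"
      using zero_le_power2[of "\<bar>n\<bar> - 1"] by (simp add: power2_eq_square algebra_simps)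
    ultimately show ?thesis by linarith
  qed (simp add: floorlog_def)
  then show "2 * 2 ^ dsize (Num n) \<le> 4 * n * n + 4" by simp
  have "n * n \<le> 2 ^ ?e * 2 ^ ?e"
    using abs_less_power_floorlog[of n] mult_mono[of "\<bar>n\<bar>" "2 ^ ?e" "\<bar>n\<bar>" "2 ^ ?e"] by simp
  moreover have "(1::int) \<le> 2 ^ ?e * 2 ^ ?e"
    using one_le_power[of "2::int" "?e + ?e"] by (simp add: power_add)
  moreover have "2 * (1 + dsize (Num n)) = 4 + (?e + ?e)" by simp
  then have "(2::int) ^ (2 * (1 + dsize (Num n))) = 16 * (2 ^ ?e * 2 ^ ?e)"
    by (simp only: power_add) simp
  ultimately show "4 * n * n + 4 \<le> 2 ^ (2 * (1 + dsize (Num n)))" by linarith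
qed

text \<open>
  The tree is traversed without a stack by rotating \<open>Cell (Cell a b) c\<close> to \<open>Cell a (Cell b c)\<close>
  until the left subtree is a leaf, which is then removed.
\<close>

lemma polytime_size_bound:
  obtains f :: "'i \<Rightarrow> data \<Rightarrow> nat" where "polytime s (\<lambda>i. UNIV) (\<lambda>i v. Num (int (f i v)))"
    "\<And>i v. 2 ^ dsize v \<le> f i v"
proof -
  define D0 where "D0 = (\<lambda>i::'i. {Cell t (Num 1) | t. True})"
  define D1 where "D1 = (\<lambda>i::'i. {Cell t (Num a) | t a. True})"
  define b where "b i u = prim_val IsCell (dfst u)" for i :: 'i and u
  define F where "F n = 4 * n * n + 4" for n :: int
  define g where "g i u = (let t = dfst u in
    if prim_val IsCell (dfst t) \<noteq> Num 0
    then Cell (Cell (dfst (dfst t))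
      (Cell (dsnd (dfst t)) (dsnd t))) (dsnd u)
    else Cell (dsnd t) (Num (dint (dsnd u) * F (dint (dfst t)))))"
    for i :: 'i and u
  \<comment> \<open>The number \<open>a\<close> stands for the part already removed: the lower
    estimate yields the result, the upper one bounds the length of \<open>a\<close> in every
    round.\<close>
  define Inv where "Inv i w u \<longleftrightarrow> (\<exists>t0 t a. w = Cell t0 (Num 1) \<and> u = Cell t (Num a) \<and> 0 < a \<and>
      dsize t \<le> dsize t0 \<and> 2 ^ dsize t0 \<le> a * 2 ^ dsize t \<and>
      a * 2 ^ (2 * dsize t) \<le> 2 ^ (2 * dsize t0))" for i :: 'i and w u
  \<comment> \<open>A rotation keeps the size and lengthens the right spine by one; removing a leaf
    lowers the size by at least two and the spine by one. Both decrease twice the size minus the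
    spine.\<close>
  have inv_step: "Inv i w (g i u) \<and> 2 * dsize (dfst (g i u)) - dlen (dfst (g i u))
      < 2 * dsize (dfst u) - dlen (dfst u)"
    if inv: "Inv i w u" and bu: "b i u \<noteq> Num 0" for i w u
  proof -
    obtain t0 t a where u: "w = Cell t0 (Num 1)" "u = Cell t (Num a)" "0 < a"
      "dsize t \<le> dsize t0" "2 ^ dsize t0 \<le> a * 2 ^ dsize t" "a * 2 ^ (2 * dsize t) \<le> 2 ^ (2 * dsize t0)"
      using inv unfolding Inv_def by blast
    obtain l r where t: "t = Cell l r" using bu u(2) by (cases t) (auto simp: b_def)
    show ?thesis
    proof (cases l)
      case (Cell l1 l2)
      let ?t = "Cell l1 (Cell l2 r)"
      have g: "g i u = Cell ?t (Num a)" using u(2) t Cell by (simp add: g_def)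
      have ds: "dsize ?t = dsize t" using t Cell by simp
      have "Inv i w (g i u)" unfolding Inv_def g
        by (intro exI[of _ t0] exI[of _ ?t] exI[of _ a]) (simp only: u ds simp_thms)
      then show ?thesis using g u(2) t Cell dlen_le_dsize[of r] by simp
    next
      case (Num n)
      have g: "g i u = Cell r (Num (a * F n))" using u(2) t Num by (simp add: g_def)
      have ds: "dsize t = 1 + dsize (Num n) + dsize r" using t Num by simp
      have F: "0 < F n" "2 * 2 ^ dsize (Num n) \<le> F n" "F n \<le> 2 ^ (2 * (1 + dsize (Num n)))"
        unfolding F_def using leaf_factor_bounds[of n] zero_le_square[of n] by linarith+
      have "a * 2 ^ dsize t = a * (2 * 2 ^ dsize (Num n)) * 2 ^ dsize r"
        unfolding ds by (simp add: power_add)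
      also have "\<dots> \<le> a * F n * 2 ^ dsize r"
        using F(2) u(3) by (intro mult_right_mono mult_left_mono) auto
      finally have 1: "2 ^ dsize t0 \<le> a * F n * 2 ^ dsize r" using u(5) by linarith
      have "a * F n * 2 ^ (2 * dsize r) \<le> a * 2 ^ (2 * (1 + dsize (Num n))) * 2 ^ (2 * dsize r)"
        using F(3) u(3) by (intro mult_right_mono mult_left_mono) auto
      also have "\<dots> = a * 2 ^ (2 * dsize t)" unfolding ds by (simp add: power_add distrib_left)
      finally have 2: "a * F n * 2 ^ (2 * dsize r) \<le> 2 ^ (2 * dsize t0)" using u(6) by linarith
      have "0 < a * F n" "dsize r \<le> dsize t0" using u(3,4) F(1) ds by simp_all
      then have "Inv i w (g i u)" unfolding Inv_def g using 1 2
        by (intro exI[of _ t0] exI[of _ r] exI[of _ "a * F n"]) (simp only: u simp_thms)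
      then show ?thesis using g u(2) t Num dlen_le_dsize[of r] by simp
    qed
  qed
  obtain f where f: "polytime s D0 f" "\<And>i v. v \<in> D0 i \<Longrightarrow> Inv i v (f i v)"
    "\<And>i v. v \<in> D0 i \<Longrightarrow> b i (f i v) = Num 0"
  proof (rule polytime_while[where D = D0 and D' = D1 and b = b and g = g and Inv = Inv
        and s = s and \<mu> = "\<lambda>i v u. 2 * dsize (dfst u) - dlen (dfst u)"
        and h = "\<lambda>i w. 5 + 3 * dsize w" and n = "\<lambda>i w. 2 * dsize w"])
    show "polytime s D1 b" unfolding b_def by (intro polytime_intros polytime_prim)
    show "polytime s (\<lambda>i. {u \<in> D1 i. b i u \<noteq> Num 0}) g"
      unfolding g_def Let_def F_def by (intro polytime_intros polytime_if polytime_prim)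
    show "poly_bounded s D0 (\<lambda>i w. 5 + 3 * dsize w)" "poly_bounded s D0 (\<lambda>i w. 2 * dsize w)"
      by (intro poly_bounded_intros)+
    show "v \<in> D0 i \<Longrightarrow> Inv i v v" for i v unfolding D0_def Inv_def by auto
    show "2 * dsize (dfst v) - dlen (dfst v) \<le> 2 * dsize v" for v
      using dsize_prim_val_le[of First v] by simp
    show "Inv i v u \<Longrightarrow> u \<in> D1 i" for i v u unfolding D1_def Inv_def by auto
    show "dsize u \<le> 5 + 3 * dsize v" if inv: "Inv i v u" for i v u
    proof -
      obtain t0 t a where u: "v = Cell t0 (Num 1)" "u = Cell t (Num a)" "0 < a"
        "dsize t \<le> dsize t0" "a * 2 ^ (2 * dsize t) \<le> 2 ^ (2 * dsize t0)"
        using inv unfolding Inv_def by blast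
      have "a \<le> a * 2 ^ (2 * dsize t)" using u(3) by simp
      also note u(5)
      also have "(2::int) ^ (2 * dsize t0) < 2 ^ (2 * dsize t0 + 1)" by simp
      finally have "\<bar>a\<bar> < 2 ^ (2 * dsize t0 + 1)" using u(3) by simp
      then have "dsize (Num a) \<le> 1 + (2 * dsize t0 + 1)" by (rule dsize_Num_le)
      then show ?thesis using u by simp
    qed
  qed (use inv_step in blast)+
  \<comment> \<open>The loop stops at a single leaf, whose factor is still missing.\<close>
  define R where "R i t = dint (dsnd (f i (Cell t (Num 1)))) *
    F (dint (dfst (f i (Cell t (Num 1)))))" for i t
  have "polytime s (\<lambda>i. UNIV) (\<lambda>i t. Num (R i t))"
    unfolding R_def F_def
    by (intro polytime_intros polytime_prim polytime_comp[OF f(1)]) (auto simp: D0_def)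
  moreover have R: "2 ^ dsize v \<le> R i v" for i v
  proof -
    have D0: "Cell v (Num 1) \<in> D0 i" by (auto simp: D0_def)
    obtain t a where u: "f i (Cell v (Num 1)) = Cell t (Num a)" "0 < a" "2 ^ dsize v \<le> a * 2 ^ dsize t"
      using f(2)[OF D0] unfolding Inv_def by auto
    obtain n where t: "t = Num n" using f(3)[OF D0] u(1) by (cases t) (auto simp: b_def)
    have "0 \<le> (2::int) ^ dsize (Num n)" by simp
    then have "2 ^ dsize (Num n) \<le> F n" using leaf_factor_bounds(1)[of n] unfolding F_def by linarith
    then have "a * 2 ^ dsize t \<le> a * F n" unfolding t using u(2) by (intro mult_left_mono) auto
    then have "2 ^ dsize v \<le> a * F n" using u(3) by linarith
    then show ?thesis using u(1) t by (simp add: R_def)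
  qed
  moreover have nonneg: "0 \<le> R i v" for i v using R[of v i] by (meson order_trans zero_le_numeral zero_le_power)
  ultimately have "polytime s (\<lambda>i. UNIV) (\<lambda>i v. Num (int (nat (R i v))))" by simp
  moreover have "2 ^ dsize v \<le> nat (R i v)" for i v using R[of v i] nonneg[of i v]
    by (metis nat_le_eq_zle nat_power_eq nat_numeral zero_le_numeral)
  ultimately show thesis by (rule that)
qed

text \<open>Halving \<open>x\<close> down to zero takes \<open>floorlog 2 x\<close> rounds with one
  multiplication by \<open>c\<close> each. Since the exponent is a bit length, the result has about
  as many bits as the product of the two bit lengths, so it can be written down in polynomial
  time.\<close>

lemma polytime_power_floorlog:
  assumes c: "polytime s D (\<lambda>i v. Num (int (c i v)))" and x: "polytime s D (\<lambda>i v. Num (int (x i v)))"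
  shows "polytime s D (\<lambda>i v. Num (int (c i v ^ floorlog 2 (x i v))))"
proof -
  define st where "st c x a = Cell (Num (int c)) (Cell (Num (int x)) (Num (int a)))" for c x a :: nat
  define D0 where "D0 = (\<lambda>i::'a. {st c x 1 | c x. True})"
  define D1 where "D1 = (\<lambda>i::'a. {st c x a | c x a. True})"
  define X where "X u = dint (dfst (dsnd u))" for u
  define b where "b i u = Num (if 1 \<le> X u then 1 else 0)" for i :: 'a and u
  define g where "g i u = Cell (dfst u) (Cell (Num (X u div 2))
    (Num (dint (dsnd (dsnd u)) * dint (dfst u))))" for i :: 'a and u
  define Inv where "Inv i w u \<longleftrightarrow> (\<exists>c x0 x j. w = st c x0 1 \<and> u = st c x (c ^ j) \<and>
    j + floorlog 2 x = floorlog 2 x0)" for i :: 'a and w u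
  have X: "X (st c x a) = int x" for c x a by (simp add: X_def st_def)
  have g: "g i (st c x a) = st c (x div 2) (a * c)" for i c x a
    by (simp add: g_def X st_def zdiv_int) (simp add: X_def)
  have fl: "floorlog 2 x = Suc (floorlog 2 (x div 2))" if "0 < x" for x
    using that compute_floorlog[of 2 x] by simp
  have inv_step: "Inv i w (g i u) \<and> floorlog 2 (nat (X (g i u))) < floorlog 2 (nat (X u))"
    if inv: "Inv i w u" and bu: "b i u \<noteq> Num 0" for i w u
  proof -
    obtain c x0 x j where u: "w = st c x0 1" "u = st c x (c ^ j)" "j + floorlog 2 x = floorlog 2 x0"
      using inv unfolding Inv_def by blast
    have x: "0 < x" using bu u(2) by (auto simp: b_def X split: if_splits)
    have "Inv i w (g i u)" unfolding Inv_def
      using u fl[OF x] by (intro exI[of _ c] exI[of _ x0] exI[of _ "x div 2"] exI[of _ "Suc j"]) (auto simp: g mult.commute)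
    then show ?thesis using u fl[OF x] by (simp add: g X)
  qed
  obtain f where f: "polytime s D0 f" "\<And>i v. v \<in> D0 i \<Longrightarrow> Inv i v (f i v)"
    "\<And>i v. v \<in> D0 i \<Longrightarrow> b i (f i v) = Num 0"
  proof (rule polytime_while[where D = D0 and D' = D1 and b = b and g = g and Inv = Inv
        and s = s and \<mu> = "\<lambda>i v u. floorlog 2 (nat (X u))"
        and h = "\<lambda>i w. 2 * dsize w + (2 + dsize w * dsize w)" and n = "\<lambda>i w. dsize w"])
    show "polytime s D1 b" unfolding b_def X_def by (intro polytime_intros polytime_le polytime_prim)
    show "polytime s (\<lambda>i. {u \<in> D1 i. b i u \<noteq> Num 0}) g"
      unfolding g_def X_def by (intro polytime_intros polytime_prim)
    show "poly_bounded s D0 (\<lambda>i w. 2 * dsize w + (2 + dsize w * dsize w))"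
      "poly_bounded s D0 (\<lambda>i w. dsize w)"
      by (intro poly_bounded_intros)+
    show "Inv i v v" if inD: "v \<in> D0 i" for i v
    proof -
      obtain c x where "v = st c x 1" using inD by (auto simp: D0_def)
      then show ?thesis unfolding Inv_def
        by (intro exI[of _ c] exI[of _ x] exI[of _ x] exI[of _ 0]) auto
    qed
    show "floorlog 2 (nat (X v)) \<le> dsize v" if "v \<in> D0 i" for i v
      using that by (auto simp: D0_def X) (simp add: st_def)
    show "Inv i v u \<Longrightarrow> u \<in> D1 i" for i v u unfolding D1_def Inv_def by auto
    show "dsize u \<le> 2 * dsize v + (2 + dsize v * dsize v)" if inv: "Inv i v u" for i v u
    proof -
      obtain c x0 x j where u: "v = st c x0 1" "u = st c x (c ^ j)" "j + floorlog 2 x = floorlog 2 x0"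
        using inv unfolding Inv_def by blast
      have "int c < 2 ^ floorlog 2 c" using abs_less_power_floorlog[of "int c"] by simp
      then have "int c ^ j \<le> (2 ^ floorlog 2 c) ^ j" by (intro power_mono) auto
      also have "\<dots> = 2 ^ (floorlog 2 c * j)" by (simp add: power_mult)
      also have "\<dots> < 2 ^ (floorlog 2 c * j + 1)" by simp
      finally have "dsize (Num (int (c ^ j))) \<le> 1 + (floorlog 2 c * j + 1)"
        by (intro dsize_Num_le) simp
      moreover have "floorlog 2 c * j \<le> dsize v * dsize v"
        using u by (intro mult_mono) (auto simp: st_def)
      moreover have "dsize (Num (int c)) + 2 \<le> dsize v" "dsize (Num (int x)) + 2 \<le> dsize v"
        using u by (auto simp: st_def)
      ultimately show ?thesis unfolding u(2) st_def dsize.simps(2) by linarith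
    qed
  qed (use inv_step in blast)+
  have res: "dint (dsnd (dsnd (f i (st c x 1)))) = int (c ^ floorlog 2 x)" for i c x
  proof -
    have D0: "st c x 1 \<in> D0 i" by (auto simp: D0_def)
    obtain c' x0 y j where u: "st c x 1 = st c' x0 1" "f i (st c x 1) = st c' y (c' ^ j)"
        "j + floorlog 2 y = floorlog 2 x0"
      using f(2)[OF D0] unfolding Inv_def by blast
    have "y = 0" using f(3)[OF D0] u(2) by (auto simp: b_def X split: if_splits)
    then show ?thesis using u by (auto simp: st_def floorlog_def)
  qed
  have "polytime s D (\<lambda>i v. Num (dint (dsnd (dsnd
      (f i (Cell (Num (int (c i v))) (Cell (Num (int (x i v))) (Num 1))))))))"
    by (intro polytime_intros polytime_prim polytime_comp[OF f(1)] c x) (auto simp: D0_def st_def)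
  then show ?thesis using res by (simp add: st_def)
qed

lemma poly_nat_le_power: "\<exists>d. \<forall>n. poly p n \<le> (n + 2) ^ d" for p :: "nat poly"
proof (induction p)
  case (pCons a p)
  then obtain d where d: "\<And>n. poly p n \<le> (n + 2) ^ d" by blast
  have "poly (pCons a p) n \<le> (n + 2) ^ (a + (d + 2))" for n
  proof -
    have "a \<le> 2 ^ a" by (simp add: less_imp_le)
    also have "\<dots> \<le> (n + 2) ^ a" by (intro power_mono) auto
    finally have "a \<le> (n + 2) ^ a * (n + 2) ^ (d + 1)"
      using one_le_power[of "n + 2" "d + 1"] by (metis le_add2 le_trans mult_le_mono nat_mult_1_right one_le_numeral)
    moreover have "n * poly p n \<le> (n + 2) * (n + 2) ^ d" using d by (intro mult_le_mono) auto
    then have "n * poly p n \<le> (n + 2) ^ a * (n + 2) ^ (d + 1)"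
      using one_le_power[of "n + 2" a] by (metis (no_types) Suc_eq_plus1 le_add2 le_trans mult_le_mono nat_mult_1 one_le_numeral power_Suc)
    ultimately have "poly (pCons a p) n \<le> 2 * ((n + 2) ^ a * (n + 2) ^ (d + 1))" by simp
    also have "\<dots> \<le> (n + 2) * ((n + 2) ^ a * (n + 2) ^ (d + 1))" by (intro mult_right_mono) auto
    also have "\<dots> = (n + 2) ^ (a + (d + 2))"
      by (simp only: power_add power_one_right power2_eq_square mult_ac)
    finally show ?thesis .
  qed
  then show ?case by blast
qed simp

text \<open>The stated bound \<open>2 ^ poly \<pi> (dsize I)\<close> is all that is used. It is
  exceeded by a power of two whose exponent is a power of \<open>floorlog 2 c\<close>, where
  \<open>c\<close> is at least \<open>4 * 2 ^ dsize I\<close>.\<close>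

lemma polytime_objective_bound:
  fixes P :: "'k::enum problem"
  assumes "multicriteria_problem P"
  obtains M :: "'i \<Rightarrow> data \<Rightarrow> nat" where "polytime s (\<lambda>i. UNIV) (\<lambda>i v. Num (int (M i v)))"
    "\<And>i I y j. I \<in> instances P \<Longrightarrow> y \<in> objvecs P I \<Longrightarrow> y $ j \<le> M i I"
proof -
  obtain \<pi> :: "nat poly" where \<pi>: "\<And>I y j. I \<in> instances P \<Longrightarrow> y \<in> objvecs P I \<Longrightarrow> y $ j \<le> 2 ^ poly \<pi> (dsize I)"
    using assms unfolding multicriteria_problem_def by (meson le_trans)
  obtain d where d: "\<And>n. poly \<pi> n \<le> (n + 2) ^ d" using poly_nat_le_power by blast
  obtain f :: "'i \<Rightarrow> data \<Rightarrow> nat" where f: "polytime s (\<lambda>i. UNIV) (\<lambda>i v. Num (int (f i v)))"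
    "\<And>i v. 2 ^ dsize v \<le> f i v" by (rule polytime_size_bound[of s]) blast
  \<comment> \<open>The factor 4 adds two bits and so reaches \<open>dsize I + 2\<close>, the base
    provided by \<open>poly_nat_le_power\<close>.\<close>
  define c where "c i v = 4 * f i v" for i v
  have c: "polytime s (\<lambda>i. UNIV) (\<lambda>i v. Num (int (c i v)))"
    using polytime_mult[OF polytime_const[of s _ "Num 4"] f(1)] by (simp add: c_def)
  \<comment> \<open>Raising to the power \<open>floorlog 2 c\<close> multiplies the exponent by
    \<open>floorlog 2 c\<close>; \<open>n\<close> repetitions give its \<open>n\<close>-th
    power.\<close>
  have "polytime s (\<lambda>i. UNIV) (\<lambda>i v. Num (int (2 ^ (floorlog 2 (c i v) ^ n))))" for n
  proof (induction n)
    case 0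
    then show ?case by (simp add: polytime_const)
  next
    case (Suc n)
    from polytime_power_floorlog[OF Suc c] show ?case
      by (simp only: power_Suc2 power_mult)
  qed
  moreover have "y $ j \<le> 2 ^ (floorlog 2 (c i I) ^ d)" if "I \<in> instances P" "y \<in> objvecs P I" for i I y j
  proof -
    have "2 ^ (dsize I + 2) \<le> c i I" using f(2)[of I i] by (simp add: c_def power_add)
    then have "dsize I + 2 \<le> floorlog 2 (c i I)"
      using floorlog_ge_SucI[of 2 "dsize I + 2" "c i I"] by simp
    then have "(dsize I + 2) ^ d \<le> floorlog 2 (c i I) ^ d" by (intro power_mono) auto
    then have "poly \<pi> (dsize I) \<le> floorlog 2 (c i I) ^ d" using d le_trans by blast
    then have "(2::nat) ^ poly \<pi> (dsize I) \<le> 2 ^ (floorlog 2 (c i I) ^ d)" by (intro power_increasing) auto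
    with \<pi>[OF that] show ?thesis using le_trans by blast
  qed
  ultimately show thesis by (rule that)
qed

section \<open>A geometric grid of integers with ratio about \<open>1 + 1 / m\<close>\<close>

definition grid_next :: "nat \<Rightarrow> nat \<Rightarrow> nat" where
  "grid_next m u = u + max 1 (u div m)"

definition grid_steps :: "nat \<Rightarrow> nat \<Rightarrow> nat \<Rightarrow> nat" where
  "grid_steps m K u = (LEAST n. K \<le> (grid_next m ^^ n) u)"

lemma grid_next_power_ge: "u + n * max 1 (u div m) \<le> (grid_next m ^^ n) u"
proof (induction n)
  case (Suc n)
  have "u \<le> (grid_next m ^^ n) u" using Suc by simp
  then have "max 1 (u div m) \<le> max 1 ((grid_next m ^^ n) u div m)" by (meson div_le_mono max.mono order_refl)
  moreover have "(grid_next m ^^ Suc n) u = (grid_next m ^^ n) u + max 1 ((grid_next m ^^ n) u div m)"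
    by (simp add: grid_next_def[of m "(grid_next m ^^ n) u"])
  ultimately show ?case using Suc by (simp only: mult_Suc)
qed simp

text \<open>Each of the steps adds at least \<open>max 1 (u div m)\<close>, which is no less than
  \<open>u / (2 * m)\<close>; the maximum covers \<open>u < m\<close>, where the quotient vanishes.
  So the number of grid points up to \<open>K\<close> is linear in \<open>m\<close> and in the bit
  length of \<open>K\<close>.\<close>

lemma grid_next_power_double: "1 \<le> m \<Longrightarrow> 2 * u \<le> (grid_next m ^^ (2 * m)) u"
proof -
  assume m: "1 \<le> m"
  have "u < m * (u div m) + m" using m by (metis dividend_less_div_times less_eq_Suc_le mult.commute One_nat_def add.commute)
  also have "\<dots> \<le> m * max 1 (u div m) + m * max 1 (u div m)" by (intro add_mono) (auto simp: Suc_le_eq)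
  finally have "u \<le> 2 * m * max 1 (u div m)" by simp
  then show ?thesis using grid_next_power_ge[of u "2 * m" m] by linarith
qed

lemma grid_next_mono: "1 \<le> m \<Longrightarrow> u \<le> v \<Longrightarrow> (grid_next m ^^ n) u \<le> (grid_next m ^^ n) v"
proof (induction n)
  case (Suc n)
  then show ?case unfolding funpow.simps o_def grid_next_def by (meson add_mono div_le_mono max.mono order_refl)
qed simp

lemma grid_next_power_ge_exp: "1 \<le> m \<Longrightarrow> 2 ^ e \<le> (grid_next m ^^ (2 * m * e)) 1"
proof (induction e)
  case (Suc e)
  have "2 ^ Suc e \<le> (grid_next m ^^ (2 * m)) (2 ^ e)" using grid_next_power_double[OF Suc.prems, of "2 ^ e"] by simp
  also have "\<dots> \<le> (grid_next m ^^ (2 * m)) ((grid_next m ^^ (2 * m * e)) 1)"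
    using Suc by (intro grid_next_mono) auto
  also have "\<dots> = (grid_next m ^^ (2 * m * Suc e)) 1" by (simp add: funpow_add)
  finally show ?case .
qed simp

lemma grid_steps_one_le:
  assumes "1 \<le> m" shows "grid_steps m K 1 \<le> 2 * m * floorlog 2 K"
  unfolding grid_steps_def
proof (rule Least_le)
  have "K \<le> 2 ^ floorlog 2 K"
    using abs_less_power_floorlog[of "int K"] by (simp add: less_imp_le)
  then show "K \<le> (grid_next m ^^ (2 * m * floorlog 2 K)) 1"
    using grid_next_power_ge_exp[OF assms] le_trans by blast
qed

lemma grid_steps_next:
  assumes "u < K" shows "grid_steps m K u = Suc (grid_steps m K (grid_next m u))"
proof -
  have "K * 1 \<le> K * max 1 (u div m)" by (intro mult_le_mono) auto
  then have "K \<le> (grid_next m ^^ K) u" using grid_next_power_ge[of u K m] by linarith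
  moreover have "\<not> K \<le> (grid_next m ^^ 0) u" using assms by simp
  ultimately show ?thesis unfolding grid_steps_def
    using Least_Suc[of "\<lambda>n. K \<le> (grid_next m ^^ n) u" K]
    by (simp only: funpow_Suc_right o_def simp_thms)
qed

text \<open>The entries are already in the form of encoded weights \<open>1 / u\<close>. Every
  \<open>V\<close> in the range is rounded up to a grid point with relative error at most
  \<open>1 / m\<close>.\<close>

lemma polytime_grid:
  fixes m :: "'i \<Rightarrow> nat"
  assumes K: "polytime s D (\<lambda>i v. Num (int (K i v)))"
    and m: "poly_bounded s (\<lambda>i. UNIV) (\<lambda>i v. m i)" "\<And>i. 1 \<le> m i"
  obtains G where "polytime s D (\<lambda>i v. enc_list (G i v))"
    "\<And>i v x. v \<in> D i \<Longrightarrow> x \<in> set (G i v) \<Longrightarrow> \<exists>u::nat. 1 \<le> u \<and> x = Cell (Num 1) (Num (int u))"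
    "\<And>i v V. v \<in> D i \<Longrightarrow> 1 \<le> V \<Longrightarrow> V \<le> K i v \<Longrightarrow>
      \<exists>u::nat. Cell (Num 1) (Num (int u)) \<in> set (G i v) \<and> V \<le> u \<and> m i * u \<le> (m i + 1) * V"
proof -
  define el where "el u = Cell (Num 1) (Num (int u))" for u :: nat
  define st where "st K u us = Cell (Num (int K)) (Cell (Num (int u)) (enc_list (map el us)))" for K u us
  define D0 where "D0 = (\<lambda>i::'i. {st K 1 [1] | K. True})"
  define D1 where "D1 = (\<lambda>i::'i. {st K u us | K u us. True})"
  define U where "U v = dint (dfst (dsnd v))" for v
  define b where "b i v = Num (if U v + 1 \<le> dint (dfst v) then 1 else 0)" for i :: 'i and v
  define N where "N i v = Num (U v + max 1 (U v div int (m i)))" for i v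
  define g where "g i v = Cell (dfst v) (Cell (N i v)
    (Cell (Cell (Num 1) (N i v)) (dsnd (dsnd v))))" for i v
  define cover where "cover i u us \<longleftrightarrow> (\<forall>V. 1 \<le> V \<and> V \<le> u \<longrightarrow>
    (\<exists>u' \<in> set us. V \<le> u' \<and> m i * u' \<le> (m i + 1) * V))" for i u us
  \<comment> \<open>The last point may overshoot \<open>K\<close>, but a step at most doubles
    \<open>u\<close>; the summand 1 admits the start \<open>u = 1\<close> for \<open>K = 0\<close>.
    The equation at the end says that each step taken has produced one entry.\<close>
  define Inv where "Inv i w v \<longleftrightarrow> (\<exists>K u us. w = st K 1 [1] \<and> v = st K u us \<and> 1 \<le> u \<and>
    u \<le> 2 * K + 1 \<and> (\<forall>u' \<in> set us. 1 \<le> u' \<and> u' \<le> 2 * K + 1) \<and> cover i u us \<and>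
    length us + grid_steps (m i) K u = 1 + grid_steps (m i) K 1)" for i w v
  have U: "U (st K u us) = int u" for K u us by (simp add: U_def st_def)
  have b: "b i (st K u us) = Num (if u < K then 1 else 0)" for i K u us
    unfolding b_def U by (simp add: st_def)
  have N: "N i (st K u us) = Num (int (grid_next (m i) u))" for i K u us
    unfolding N_def U grid_next_def by (simp add: zdiv_int of_nat_max)
  have g: "g i (st K u us) = st K (grid_next (m i) u) (grid_next (m i) u # us)" for i K u us
    unfolding g_def N by (simp add: st_def el_def)
  have inv_step: "Inv i w (g i v) \<and> grid_steps (m i) (nat (dint (dfst (g i v)))) (nat (U (g i v)))
      < grid_steps (m i) (nat (dint (dfst v))) (nat (U v))"
    if inv: "Inv i w v" and bu: "b i v \<noteq> Num 0" for i w v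
  proof -
    obtain K u us where v: "w = st K 1 [1]" "v = st K u us" "1 \<le> u" "u \<le> 2 * K + 1"
        "\<forall>u' \<in> set us. 1 \<le> u' \<and> u' \<le> 2 * K + 1" "cover i u us"
        "length us + grid_steps (m i) K u = 1 + grid_steps (m i) K 1"
      using inv unfolding Inv_def by blast
    have uK: "u < K" using bu v(2) by (auto simp: b split: if_splits)
    let ?u = "grid_next (m i) u"
    have "max 1 (u div m i) \<le> u" using v(3) by (simp add: div_le_dividend)
    then have u2: "1 \<le> ?u" "?u \<le> 2 * K + 1" unfolding grid_next_def using uK v(3) by linarith+
    have "cover i ?u (?u # us)"
      unfolding cover_def
    proof (intro allI impI)
      fix V
      assume V: "1 \<le> V \<and> V \<le> ?u"
      show "\<exists>u' \<in> set (?u # us). V \<le> u' \<and> m i * u' \<le> (m i + 1) * V"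
      proof (cases "V \<le> u")
        case True
        then show ?thesis using v(6) V unfolding cover_def by auto
      next
        case False
        have "m i * ?u \<le> (m i + 1) * V"
        \<comment> \<open>Either the step is 1 and leaves no gap, or it is \<open>u div m\<close>,
          which is at most \<open>V / m\<close> because \<open>u < V\<close>.\<close>
        proof (cases "u div m i \<le> 1")
          case True
          then have "V = ?u" using V False by (auto simp: grid_next_def)
          then show ?thesis by simp
        next
          case *: False
          then have "m i * ?u = m i * u + m i * (u div m i)" by (simp add: grid_next_def distrib_left)
          also have "\<dots> \<le> (m i + 1) * u" by (simp add: algebra_simps)
          also have "\<dots> \<le> (m i + 1) * V" using False by (intro mult_left_mono) auto
          finally show ?thesis .
        qed
        then show ?thesis using V by auto
      qed
    qed
    moreover have st: "grid_steps (m i) K u = Suc (grid_steps (m i) K ?u)" by (rule grid_steps_next[OF uK])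
    ultimately have "Inv i w (g i v)" unfolding Inv_def
      using v(1,2,5,7) u2 by (intro exI[of _ K] exI[of _ ?u] exI[of _ "?u # us"]) (auto simp: g)
    then show ?thesis unfolding v(2) g U using st by (simp add: st_def)
  qed
  have KU: "1 + dsize (Num (int K)) + 3 \<le> dsize (st K 1 [1])" for K by (simp add: st_def el_def)
  have small: "dsize (Num (int u)) \<le> dsize (Num (int K)) + 2" if "u \<le> 2 * K + 1" for u K
  proof -
    have "int K < 2 ^ floorlog 2 K" using abs_less_power_floorlog[of "int K"] by simp
    moreover have "int u \<le> 2 * int K + 1" using that by simp
    ultimately have "int u < 4 * 2 ^ floorlog 2 K" by linarith
    then have "\<bar>int u\<bar> < 2 ^ (floorlog 2 K + 2)" by (simp only: power_add) simp
    then show ?thesis using dsize_Num_le[of "int u" "floorlog 2 K + 2"] by simp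
  qed
  obtain f where f: "polytime s D0 f" "\<And>i v. v \<in> D0 i \<Longrightarrow> Inv i v (f i v)"
    "\<And>i v. v \<in> D0 i \<Longrightarrow> b i (f i v) = Num 0"
  proof (rule polytime_while[where D = D0 and D' = D1 and b = b and g = g and Inv = Inv
        and s = s and \<mu> = "\<lambda>i w v. grid_steps (m i) (nat (dint (dfst v))) (nat (U v))"
        and h = "\<lambda>i w. 5 + 2 * dsize w + (1 + 2 * m i * dsize w) * (6 + dsize w)"
        and n = "\<lambda>i w. 2 * m i * dsize w"])
    have m': "poly_bounded s D (\<lambda>i v. m i)" for D using poly_bounded_subset[OF m(1)] by blast
    have m'': "polytime s D (\<lambda>i v. Num (int (m i)))" for D
    proof (rule polytime_param_const, rule poly_bounded_mono)
      show "poly_bounded s D (\<lambda>i v. 1 + m i)" by (intro poly_bounded_intros m')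
    qed (rule dsize_Num_nat_le)
    show "polytime s D1 b" unfolding b_def U_def by (intro polytime_intros polytime_le polytime_prim)
    show "polytime s (\<lambda>i. {u \<in> D1 i. b i u \<noteq> Num 0}) g"
      unfolding g_def N_def U_def by (intro polytime_intros polytime_prim m'')
    show "poly_bounded s D0 (\<lambda>i w. 5 + 2 * dsize w + (1 + 2 * m i * dsize w) * (6 + dsize w))"
      "poly_bounded s D0 (\<lambda>i w. 2 * m i * dsize w)"
      by (intro poly_bounded_intros m')+
    show "Inv i v v" if inD: "v \<in> D0 i" for i v
    proof -
      obtain K where "v = st K 1 [1]" using inD by (auto simp: D0_def)
      then show ?thesis unfolding Inv_def cover_def
        by (intro exI[of _ K] exI[of _ 1] exI[of _ "[1]"]) auto
    qed
    show "grid_steps (m i) (nat (dint (dfst v))) (nat (U v)) \<le> 2 * m i * dsize v"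
      if inD: "v \<in> D0 i" for i v
    proof -
      obtain K where v: "v = st K 1 [1]" using inD by (auto simp: D0_def)
      have "2 * m i * floorlog 2 K \<le> 2 * m i * dsize v"
        unfolding v by (intro mult_left_mono) (auto simp: st_def)
      then show ?thesis using grid_steps_one_le[OF m(2), of i K] unfolding v U by (simp add: st_def)
    qed
    show "Inv i v u \<Longrightarrow> u \<in> D1 i" for i v u unfolding D1_def Inv_def by auto
    show "dsize v \<le> 5 + 2 * dsize w + (1 + 2 * m i * dsize w) * (6 + dsize w)"
      if inv: "Inv i w v" for i w v
    proof -
      obtain K u us where v: "w = st K 1 [1]" "v = st K u us" "u \<le> 2 * K + 1"
          "\<forall>u' \<in> set us. 1 \<le> u' \<and> u' \<le> 2 * K + 1"
          "length us + grid_steps (m i) K u = 1 + grid_steps (m i) K 1"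
        using inv unfolding Inv_def by blast
      have "dsize (enc_list (map el us)) \<le> 1 + length us * (6 + dsize w)"
        using v(4)
      proof (induction us)
        case (Cons u' us)
        have "dsize (el u') \<le> 5 + dsize w"
          using small[of u' K] KU[of K] Cons.prems v(1) by (simp add: el_def floorlog_def)
        then show ?case using Cons by simp
      qed (simp add: floorlog_def)
      moreover have "length us \<le> 1 + 2 * m i * dsize w"
      proof -
        have "2 * m i * floorlog 2 K \<le> 2 * m i * dsize w"
          unfolding v by (intro mult_left_mono) (auto simp: st_def)
        then show ?thesis using v(5) grid_steps_one_le[OF m(2), of i K] by linarith
      qed
      then have "length us * (6 + dsize w) \<le> (1 + 2 * m i * dsize w) * (6 + dsize w)"
        by (intro mult_right_mono) auto
      moreover have "dsize (Num (int u)) \<le> dsize w"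
        using small[OF v(3)] KU[of K] v(1) by simp
      moreover have "dsize (Num (int K)) \<le> dsize w" using KU[of K] v(1) by simp
      ultimately show ?thesis unfolding v(2) st_def dsize.simps(2) by linarith
    qed
  qed (use inv_step in blast)+
  define T where "T i v = f i (Cell (Num (int (K i v))) (Cell (Num 1) (enc_list [Cell (Num 1) (Num 1)])))" for i v
  have T: "\<exists>us u. T i v = st (K i v) u us \<and> (\<forall>u \<in> set us. 1 \<le> u) \<and> cover i (K i v) us" for i v
  proof -
    let ?w = "st (K i v) 1 [1]"
    have D0: "?w \<in> D0 i" by (auto simp: D0_def)
    obtain K' u us where u: "?w = st K' 1 [1]" "f i ?w = st K' u us" "\<forall>u' \<in> set us. 1 \<le> u'" "cover i u us"
      using f(2)[OF D0] unfolding Inv_def by blast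
    have K': "K' = K i v" using u(1) by (simp add: st_def)
    have "K i v \<le> u" using f(3)[OF D0] unfolding u(2) b K' by (auto split: if_splits)
    then have "cover i (K i v) us" using u(4) unfolding cover_def by auto
    then show ?thesis using u K' by (auto simp: T_def st_def el_def)
  qed
  then obtain us where us: "\<And>i v. \<exists>u. T i v = st (K i v) u (us i v)"
    "\<And>i v. \<forall>u \<in> set (us i v). 1 \<le> u" "\<And>i v. cover i (K i v) (us i v)" by metis
  show thesis
  proof (rule that[of "\<lambda>i v. map el (us i v)"])
    have "polytime s D (\<lambda>i v. dsnd (dsnd (T i v)))"
      unfolding T_def
      by (intro polytime_prim polytime_comp[OF f(1)] polytime_Cell K polytime_const)
        (auto simp: D0_def st_def el_def)
    then show "polytime s D (\<lambda>i v. enc_list (map el (us i v)))"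
    proof (rule polytime_cong)
      show "dsnd (dsnd (T i v)) = enc_list (map el (us i v))" for i v
        using us(1)[of i v] by (auto simp: st_def)
    qed
    show "x \<in> set (map el (us i v)) \<Longrightarrow> \<exists>u::nat. 1 \<le> u \<and> x = Cell (Num 1) (Num (int u))" for i v x
      using us(2)[of i v] by (auto simp: el_def)
    show "\<exists>u::nat. Cell (Num 1) (Num (int u)) \<in> set (map el (us i v)) \<and> V \<le> u \<and> m i * u \<le> (m i + 1) * V"
      if V: "1 \<le> V" "V \<le> K i v" for i v V
    proof -
      obtain u where "u \<in> set (us i v)" "V \<le> u" "m i * u \<le> (m i + 1) * V"
        using us(3)[of i v] V unfolding cover_def by blast
      then show ?thesis by (intro exI[of _ u]) (auto simp: el_def)
    qed
  qed
qed

section \<open>Norms and approximation guarantees\<close>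

lemma max_norm_le_iff: "max_norm (y :: real ^ 'k::finite) \<le> c \<longleftrightarrow> (\<forall>j. \<bar>y $ j\<bar> \<le> c)"
  unfolding max_norm_def by (subst Max_le_iff) auto

lemma component_le_max_norm: "\<bar>y $ j\<bar> \<le> max_norm (y :: real ^ 'k::finite)"
  using max_norm_le_iff[of y "max_norm y"] by simp

lemma max_norm_nonneg: "0 \<le> max_norm (y :: real ^ 'k::finite)"
  using component_le_max_norm[of y undefined] by linarith

text \<open>A cornered norm with an arbitrary coefficient. The value 0 is included: it gives the
  maximum norm, and \<open>1 / p\<close> is rounded to it when \<open>p\<close> is large.\<close>

definition sum_max_norm :: "real \<Rightarrow> real ^ 'k::finite \<Rightarrow> real" where
  "sum_max_norm q y = max_norm y + q * (\<Sum>j \<in> UNIV. \<bar>y $ j\<bar>)"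

lemma sum_max_norm_0: "sum_max_norm 0 = max_norm"
  by (simp add: sum_max_norm_def fun_eq_iff)

lemma cornered_norm_eq: "cornered_norm p = sum_max_norm (1 / p)"
  by (simp add: cornered_norm_def sum_max_norm_def max_norm_def fun_eq_iff)

lemma is_norm_max_norm: "is_norm (max_norm :: real ^ 'k::finite \<Rightarrow> real)"
proof -
  have zero: "max_norm y = 0 \<longleftrightarrow> y = 0" for y :: "real ^ 'k"
    using max_norm_le_iff[of y 0] max_norm_nonneg[of y] by (auto simp: vec_eq_iff order_antisym_conv)
  have le: "max_norm (a *\<^sub>R y) \<le> \<bar>a\<bar> * max_norm y" for a and y :: "real ^ 'k"
    by (auto simp: max_norm_le_iff abs_mult intro: mult_left_mono component_le_max_norm)
  have "max_norm (a *\<^sub>R y) = \<bar>a\<bar> * max_norm y" for a and y :: "real ^ 'k"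
  proof (cases "a = 0")
    case True
    then show ?thesis using zero[of 0] by simp
  next
    case False
    have "max_norm y \<le> \<bar>inverse a\<bar> * max_norm (a *\<^sub>R y)" using le[of "inverse a" "a *\<^sub>R y"] False by simp
    then have "\<bar>a\<bar> * max_norm y \<le> max_norm (a *\<^sub>R y)" using False by (simp add: field_simps abs_inverse)
    with le[of a y] show ?thesis by linarith
  qed
  moreover have "max_norm (y + z) \<le> max_norm y + max_norm z" for y z :: "real ^ 'k"
    unfolding max_norm_le_iff
  proof
    fix j
    show "\<bar>(y + z) $ j\<bar> \<le> max_norm y + max_norm z"
      using component_le_max_norm[of y j] component_le_max_norm[of z j] by simp
  qed
  ultimately show ?thesis using zero unfolding is_norm_def by blast
qed

lemma monotone_norm_max_norm: "monotone_norm (max_norm :: real ^ 'k::finite \<Rightarrow> real)"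
  unfolding monotone_norm_def max_norm_le_iff
proof (intro allI impI)
  fix y z :: "real ^ 'k" and j
  assume "0 \<le> y \<and> y \<le> z"
  then have "0 \<le> y $ j" "y $ j \<le> z $ j" by (auto simp: less_eq_vec_def)
  then show "\<bar>y $ j\<bar> \<le> max_norm z" using component_le_max_norm[of z j] by linarith
qed

lemma is_norm_sum_max_norm:
  assumes "0 \<le> q" shows "is_norm (sum_max_norm q :: real ^ 'k::finite \<Rightarrow> real)"
proof -
  have N: "max_norm y = 0 \<longleftrightarrow> y = 0" "max_norm (a *\<^sub>R y) = \<bar>a\<bar> * max_norm y"
    "max_norm (y + z) \<le> max_norm y + max_norm z" for a and y z :: "real ^ 'k"
    using is_norm_max_norm unfolding is_norm_def by blast+
  have S: "0 \<le> q * (\<Sum>j \<in> UNIV. \<bar>y $ j\<bar>)" for y :: "real ^ 'k"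
    using assms by (intro mult_nonneg_nonneg sum_nonneg) auto
  have "sum_max_norm q y = 0 \<longleftrightarrow> y = 0" for y :: "real ^ 'k"
    using S[of y] max_norm_nonneg[of y] N(1)[of y] unfolding sum_max_norm_def by force
  moreover have "sum_max_norm q (a *\<^sub>R y) = \<bar>a\<bar> * sum_max_norm q y" for a and y :: "real ^ 'k"
    unfolding sum_max_norm_def N(2) by (simp add: abs_mult algebra_simps flip: sum_distrib_left)
  moreover have "sum_max_norm q (y + z) \<le> sum_max_norm q y + sum_max_norm q z" for y z :: "real ^ 'k"
  proof -
    have "q * (\<Sum>j \<in> UNIV. \<bar>(y + z) $ j\<bar>) \<le> q * (\<Sum>j \<in> UNIV. \<bar>y $ j\<bar> + \<bar>z $ j\<bar>)"
      using assms by (intro mult_left_mono sum_mono) auto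
    then show ?thesis using N(3)[of y z] unfolding sum_max_norm_def by (simp add: sum.distrib distrib_left)
  qed
  ultimately show ?thesis unfolding is_norm_def by blast
qed

lemma monotone_norm_sum_max_norm:
  assumes "0 \<le> q" shows "monotone_norm (sum_max_norm q :: real ^ 'k::finite \<Rightarrow> real)"
  unfolding monotone_norm_def sum_max_norm_def
proof (intro allI impI add_mono mult_left_mono sum_mono assms)
  fix y z :: "real ^ 'k"
  assume yz: "0 \<le> y \<and> y \<le> z"
  then show "max_norm y \<le> max_norm z" using monotone_norm_max_norm unfolding monotone_norm_def by blast
  show "\<bar>y $ j\<bar> \<le> \<bar>z $ j\<bar>" for j
  proof -
    have "0 \<le> y $ j" "y $ j \<le> z $ j" using yz by (auto simp: less_eq_vec_def)
    then show ?thesis by linarith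
  qed
qed

lemma sum_abs_le_max_norm: "(\<Sum>j \<in> UNIV. \<bar>y $ j\<bar>) \<le> real CARD('k) * max_norm (y :: real ^ 'k::finite)"
  using sum_bounded_above[of UNIV "\<lambda>j. \<bar>y $ j\<bar>" "max_norm y"] component_le_max_norm by auto

lemma sum_max_norm_le_max_norm:
  "0 \<le> q \<Longrightarrow> sum_max_norm q y \<le> (1 + q * real CARD('k)) * max_norm (y :: real ^ 'k::finite)"
  using mult_left_mono[OF sum_abs_le_max_norm[of y], of q] by (simp add: sum_max_norm_def algebra_simps)

lemma max_norm_le_sum_max_norm: "0 \<le> q \<Longrightarrow> max_norm y \<le> sum_max_norm q (y :: real ^ 'k::finite)"
  by (simp add: sum_max_norm_def sum_nonneg)

lemma max_norm_attained: "\<exists>j. max_norm (y :: real ^ 'k::finite) = \<bar>y $ j\<bar>"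
proof -
  have "max_norm y \<in> range (\<lambda>j. \<bar>y $ j\<bar>)" unfolding max_norm_def by (intro Max_in) auto
  then show ?thesis by auto
qed

lemma max_norm_le_p_norm:
  assumes "1 \<le> p" shows "max_norm y \<le> p_norm p (y :: real ^ 'k::finite)"
proof -
  obtain j where j: "max_norm y = \<bar>y $ j\<bar>" using max_norm_attained by blast
  have "\<bar>y $ j\<bar> powr p \<le> (\<Sum>i \<in> UNIV. \<bar>y $ i\<bar> powr p)"
    by (intro member_le_sum) auto
  then have "(\<bar>y $ j\<bar> powr p) powr (1 / p) \<le> p_norm p y"
    unfolding p_norm_def using assms by (intro powr_mono2) auto
  then show ?thesis using assms j by (simp add: powr_powr)
qed

lemma p_norm_le_max_norm:
  assumes "1 \<le> p" shows "p_norm p y \<le> real CARD('k) powr (1 / p) * max_norm (y :: real ^ 'k::finite)"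
proof -
  have "(\<Sum>i \<in> UNIV. \<bar>y $ i\<bar> powr p) \<le> real CARD('k) * (max_norm y powr p)"
  proof -
    have "\<bar>y $ i\<bar> powr p \<le> max_norm y powr p" for i
      using assms component_le_max_norm[of y i] by (intro powr_mono2) auto
    then show ?thesis using sum_bounded_above[of UNIV "\<lambda>i. \<bar>y $ i\<bar> powr p"] by auto
  qed
  then have "p_norm p y \<le> (real CARD('k) * (max_norm y powr p)) powr (1 / p)"
    unfolding p_norm_def using assms by (intro powr_mono2 sum_nonneg) auto
  also have "\<dots> = real CARD('k) powr (1 / p) * max_norm y"
    using assms max_norm_nonneg[of y] by (simp add: powr_mult powr_powr)
  finally show ?thesis .
qed

text \<open>Weights may vanish, so \<open>weighted N w\<close> is only a seminorm.\<close>

lemma weighted_facts: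
  fixes N :: "real ^ 'k::finite \<Rightarrow> real"
  assumes N: "is_norm N" "monotone_norm N" and w: "0 \<le> w"
  shows weighted_mono: "0 \<le> y \<Longrightarrow> y \<le> z \<Longrightarrow> weighted N w y \<le> weighted N w z"
    and weighted_triangle: "weighted N w (y + z) \<le> weighted N w y + weighted N w z"
    and weighted_scale: "weighted N w (a *\<^sub>R y) = \<bar>a\<bar> * weighted N w y"
    and weighted_nonneg: "0 \<le> weighted N w y"
proof -
  have w': "0 \<le> real_of_rat (w $ j)" for j using w by (simp add: less_eq_vec_def)
  show "weighted N w y \<le> weighted N w z" if "0 \<le> y" "y \<le> z" for y z
  proof -
    have "0 \<le> (\<chi> j. real_of_rat (w $ j) * y $ j)"
      "(\<chi> j. real_of_rat (w $ j) * y $ j) \<le> (\<chi> j. real_of_rat (w $ j) * z $ j)"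
      using that w' by (auto simp: less_eq_vec_def intro: mult_left_mono)
    then show ?thesis using N(2) unfolding weighted_def monotone_norm_def by blast
  qed
  have add: "(\<chi> j. real_of_rat (w $ j) * (y + z) $ j) =
      (\<chi> j. real_of_rat (w $ j) * y $ j) + (\<chi> j. real_of_rat (w $ j) * z $ j)" for y z
    by (simp add: vec_eq_iff distrib_left)
  have tri: "weighted N w (y + z) \<le> weighted N w y + weighted N w z" for y z
    unfolding weighted_def add using N(1) unfolding is_norm_def by blast
  then show "weighted N w (y + z) \<le> weighted N w y + weighted N w z" .
  have scl: "(\<chi> j. real_of_rat (w $ j) * (a *\<^sub>R y) $ j) = a *\<^sub>R (\<chi> j. real_of_rat (w $ j) * y $ j)" for a y
    by (simp add: vec_eq_iff)
  have scale: "weighted N w (a *\<^sub>R y) = \<bar>a\<bar> * weighted N w y" for a y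
    unfolding weighted_def scl using N(1) unfolding is_norm_def by blast
  then show "weighted N w (a *\<^sub>R y) = \<bar>a\<bar> * weighted N w y" .
  have "weighted N w (y + (- 1) *\<^sub>R y) \<le> weighted N w y + weighted N w ((- 1) *\<^sub>R y)" by (rule tri)
  moreover have "weighted N w ((- 1) *\<^sub>R y) = weighted N w y" using scale[of "- 1" y] by simp
  moreover have "weighted N w (0 *\<^sub>R y) = 0" using scale[of 0 y] by simp
  ultimately show "0 \<le> weighted N w y" by simp
qed

lemma real_vec_of_nat_nth [simp]: "real_vec_of_nat y $ j = real (y $ j)"
  by (simp add: real_vec_of_nat_def)

section \<open>Approximation guarantees for the reference objective\<close>

lemma ref_obj_mono:
  assumes "is_norm N" "monotone_norm N" "0 \<le> w" "r \<le> y" "y \<le> z"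
  shows "ref_obj N r w y \<le> ref_obj N r w z"
  unfolding ref_obj_def using assms
  by (intro add_left_mono weighted_mono) (auto simp: less_eq_vec_def)

lemma ref_obj_transfer:
  assumes le: "\<And>y. N1 y \<le> N2 y" "\<And>y. N2 y \<le> c * N1 y"
  shows "ref_obj N1 r w y \<le> ref_obj N2 r w y" "ref_obj N2 r w y \<le> c * ref_obj N1 r w y"
  unfolding ref_obj_def weighted_def distrib_left by (intro add_mono le)+

text \<open>The surplus \<open>(\<alpha> - 1) * r\<close> is charged to the term
  \<open>weighted N w r\<close> of the objective; this keeps the guarantee multiplicative even when
  \<open>y - r\<close> is small.\<close>

lemma rp_quality:
  fixes N :: "real ^ 'k::finite \<Rightarrow> real" and r y y' z :: "nat ^ 'k"
  assumes N: "is_norm N" "monotone_norm N" and w: "0 \<le> w" and \<alpha>: "1 \<le> \<alpha>"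
    and r: "r \<le> z" and z: "\<And>j. real (z $ j) \<le> \<alpha> * real (y $ j)" and ry: "r \<le> y"
    and best: "weighted N w (real_vec_of_nat y' - real_vec_of_nat r) \<le>
      weighted N w (real_vec_of_nat z - real_vec_of_nat r)"
  shows "ref_obj N r w y' \<le> \<alpha> * ref_obj N r w y"
proof -
  let ?n = "weighted N w" and ?r = "real_vec_of_nat r" and ?y = "real_vec_of_nat y"
  let ?z = "real_vec_of_nat z" and ?y' = "real_vec_of_nat y'"
  note W = weighted_mono[OF N w] weighted_triangle[OF N w] weighted_scale[OF N w]
  have "?n (?z - ?r) \<le> ?n (\<alpha> *\<^sub>R (?y - ?r) + (\<alpha> - 1) *\<^sub>R ?r)"
    using r z by (intro W(1)) (auto simp: less_eq_vec_def algebra_simps)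
  also have "\<dots> \<le> \<alpha> * ?n (?y - ?r) + (\<alpha> - 1) * ?n ?r"
    using W(2)[of "\<alpha> *\<^sub>R (?y - ?r)" "(\<alpha> - 1) *\<^sub>R ?r"] W(3) \<alpha> by simp
  finally show ?thesis using best unfolding ref_obj_def by (simp add: algebra_simps)
qed

text \<open>Here \<open>r\<close> is the unknown ideal point and \<rho> the computed substitute.
  Replacing one by the other costs the norm of \<open>\<rho> - r\<close>, at most
  \<open>(\<alpha> - 1)\<close> times that of \<open>r\<close>; in the other direction
  \<open>z - \<rho> \<le> z - r\<close> costs nothing by monotonicity.\<close>

lemma cp_quality:
  fixes N :: "real ^ 'k::finite \<Rightarrow> real" and r y y' z \<rho> :: "nat ^ 'k"
  assumes N: "is_norm N" "monotone_norm N" and w: "0 \<le> w" and \<alpha>: "1 \<le> \<alpha>"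
    and \<rho>: "r \<le> \<rho>" "\<rho> \<le> z" "\<rho> \<le> y'" "\<And>j. real (\<rho> $ j) \<le> \<alpha> * real (r $ j)"
    and z: "\<And>j. real (z $ j) \<le> \<alpha> * real (y $ j)" and ry: "r \<le> y"
    and best: "weighted N w (real_vec_of_nat y' - real_vec_of_nat \<rho>) \<le>
      weighted N w (real_vec_of_nat z - real_vec_of_nat \<rho>)"
  shows "ref_obj N r w y' \<le> (2 * \<alpha> - 1) * ref_obj N r w y"
proof -
  let ?n = "weighted N w" and ?r = "real_vec_of_nat r" and ?y = "real_vec_of_nat y"
  let ?z = "real_vec_of_nat z" and ?y' = "real_vec_of_nat y'" and ?\<rho> = "real_vec_of_nat \<rho>"
  note W = weighted_mono[OF N w] weighted_triangle[OF N w] weighted_scale[OF N w] weighted_nonneg[OF N w]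
  have "?n (?y' - ?r) \<le> ?n (?y' - ?\<rho>) + ?n (?\<rho> - ?r)"
    using W(2)[of "?y' - ?\<rho>" "?\<rho> - ?r"] by simp
  moreover have "?n (?\<rho> - ?r) \<le> ?n ((\<alpha> - 1) *\<^sub>R ?r)"
    using \<rho> by (intro W(1)) (auto simp: less_eq_vec_def algebra_simps)
  then have "?n (?\<rho> - ?r) \<le> (\<alpha> - 1) * ?n ?r" using W(3) \<alpha> by simp
  moreover have "?n (?z - ?\<rho>) \<le> ?n (?z - ?r)"
    using \<rho> by (intro W(1)) (auto simp: less_eq_vec_def)
  moreover have "?n (?z - ?r) \<le> ?n (\<alpha> *\<^sub>R (?y - ?r) + (\<alpha> - 1) *\<^sub>R ?r)"
    using order_trans[OF \<rho>(1,2)] z by (intro W(1)) (auto simp: less_eq_vec_def algebra_simps)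
  then have "?n (?z - ?r) \<le> \<alpha> * ?n (?y - ?r) + (\<alpha> - 1) * ?n ?r"
    using W(2)[of "\<alpha> *\<^sub>R (?y - ?r)" "(\<alpha> - 1) *\<^sub>R ?r"] W(3) \<alpha> by simp
  ultimately have "ref_obj N r w y' \<le> (2 * \<alpha> - 1) * ?n ?r + \<alpha> * ?n (?y - ?r)"
    using best unfolding ref_obj_def by (simp add: algebra_simps)
  also have "\<alpha> * ?n (?y - ?r) \<le> (2 * \<alpha> - 1) * ?n (?y - ?r)"
    using \<alpha> W(4) by (intro mult_right_mono) auto
  finally show ?thesis unfolding ref_obj_def by (simp add: algebra_simps)
qed

text \<open>
  Here \<open>y\<close> is the point to be approximated and \<open>V j = max (m * (y $ j - r $ j)) (r $ j)\<close>; the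
  weights are \<open>1 / V j\<close> up to rounding. The second argument of \<open>max\<close> keeps the constant term
  of the objective bounded, so that its relative error stays small.
\<close>

lemma scalarization_quality:
  fixes r y y' :: "nat ^ 'k::finite" and m :: nat and \<alpha> B :: real
  assumes m: "1 \<le> m" and \<alpha>: "1 \<le> \<alpha>" and B: "\<alpha> / m + (\<alpha> - 1) < B"
    and r: "r \<le> y" "r \<le> y'"
    and w0: "\<And>j. y $ j = 0 \<Longrightarrow> real_of_rat (w $ j) = B"
    and w1: "\<And>j. y $ j \<noteq> 0 \<Longrightarrow> \<exists>u::nat. real_of_rat (w $ j) = 1 / real u \<and>
      max (m * (y $ j - r $ j)) (r $ j) \<le> u \<and> m * u \<le> (m + 1) * max (m * (y $ j - r $ j)) (r $ j)"
    and opt: "ref_obj max_norm r w y' \<le> \<alpha> * ref_obj max_norm r w y"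
    and \<kappa>: "\<kappa> = (\<alpha> + m * (\<alpha> - 1)) * (1 + 1 / m)" and \<gamma>: "\<kappa> \<le> \<gamma>" "1 + \<kappa> / m \<le> \<gamma>"
  shows "real (y' $ j) \<le> \<gamma> * real (y $ j)"
proof -
  \<comment> \<open>The weighted norm of \<open>r\<close> is at most 1 and that of
    \<open>y - r\<close> at most \<open>1 / m\<close>. So near-optimality leaves at most
    \<open>(\<alpha> - 1) * 1 + \<alpha> / m\<close> for \<open>y' - r\<close>.\<close>
  define \<theta> where "\<theta> = \<alpha> / m + (\<alpha> - 1)"
  have \<theta>: "0 \<le> \<theta>" "0 < B" using \<alpha> m B by (auto simp: \<theta>_def intro: le_less_trans[OF _ B])
  define l where "l j = real_of_rat (w $ j)" for j
  have rj: "r $ j \<le> y $ j" "r $ j \<le> y' $ j" for j using r by (auto simp: less_eq_vec_def)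
  have V: "real (max (m * (y $ j - r $ j)) (r $ j)) = max (m * (real (y $ j) - real (r $ j))) (real (r $ j))" for j
    using rj[of j] by (simp add: of_nat_max of_nat_diff)
  have pos: "0 \<le> l j" for j
  proof (cases "y $ j = 0")
    case True
    then show ?thesis using w0[of j] \<theta> by (simp add: l_def)
  next
    case False
    obtain u :: nat where "l j = 1 / real u" using w1[OF False] unfolding l_def by blast
    then show ?thesis by simp
  qed
  \<comment> \<open>Rounding \<open>V j\<close> up to \<open>u\<close> only lowers the weight, so
    each argument of the maximum gives one of the two bounds.\<close>
  have l1: "l j * real (r $ j) \<le> 1 \<and> l j * (real (y $ j) - real (r $ j)) \<le> 1 / m" for j
  proof (cases "y $ j = 0")
    case True
    then show ?thesis using rj[of j] by simp
  next
    case False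
    obtain u :: nat where u: "l j = 1 / real u" "max (m * (y $ j - r $ j)) (r $ j) \<le> u"
      using w1[OF False] unfolding l_def by blast
    have "max (m * (real (y $ j) - real (r $ j))) (real (r $ j)) \<le> real u"
      using u(2) V[of j] by (metis of_nat_le_iff)
    moreover have "0 < m * (y $ j - r $ j) \<or> 0 < r $ j" using m False rj[of j] by (cases "r $ j = 0") auto
    then have "0 < max (m * (y $ j - r $ j)) (r $ j)" by (simp only: less_max_iff_disj)
    then have "0 < u" using u(2) by (rule less_le_trans)
    then have "0 < real u" by simp
    ultimately show ?thesis unfolding u(1) using m by (simp add: field_simps)
  qed
  define wt where "wt z = (\<chi> j. real_of_rat (w $ j) * z $ j)" for z :: "real ^ 'k"
  have wt: "weighted max_norm w z = max_norm (wt z)" for z by (simp add: weighted_def wt_def)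
  let ?r = "real_vec_of_nat r" and ?y = "real_vec_of_nat y" and ?y' = "real_vec_of_nat y'"
  have a: "max_norm (wt ?r) \<le> 1"
    unfolding max_norm_le_iff using l1 pos by (auto simp: wt_def l_def abs_mult)
  have b: "max_norm (wt (?y - ?r)) \<le> 1 / m"
    unfolding max_norm_le_iff using l1 pos rj by (auto simp: wt_def l_def abs_mult)
  have c: "l j * (real (y' $ j) - real (r $ j)) \<le> max_norm (wt (?y' - ?r))" for j
    using component_le_max_norm[of "wt (?y' - ?r)" j] by (simp add: wt_def l_def)
  have bound: "l j * (real (y' $ j) - real (r $ j)) \<le> \<theta>" for j
  proof -
    have "max_norm (wt ?r) + max_norm (wt (?y' - ?r)) \<le> \<alpha> * (max_norm (wt ?r) + max_norm (wt (?y - ?r)))"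
      using opt unfolding ref_obj_def wt .
    then have "max_norm (wt (?y' - ?r)) \<le> (\<alpha> - 1) * max_norm (wt ?r) + \<alpha> * max_norm (wt (?y - ?r))"
      by (simp add: algebra_simps)
    also have "\<dots> \<le> (\<alpha> - 1) * 1 + \<alpha> * (1 / m)"
      using \<alpha> a b by (intro add_mono mult_left_mono) auto
    finally show ?thesis using c[of j] by (simp add: \<theta>_def)
  qed
  have m0: "0 < real m" using m by simp
  \<comment> \<open>The weight \<open>1 / u\<close> turns \<theta> into a distance of
    \<open>\<theta> * u\<close>, and \<open>u\<close> is at most \<open>(1 + 1 / m) * V j\<close>;
    together this is \<open>\<kappa> / m * V j\<close>.\<close>
  have "\<kappa> = \<theta> * (m + 1)" using m0 unfolding \<kappa> \<theta>_def by (simp add: field_simps)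
  with \<theta>(1) have \<kappa>\<theta>: "\<kappa> = \<theta> * (m + 1)" "0 \<le> \<kappa>" by simp_all
  have \<gamma>1: "1 \<le> \<gamma>" using \<gamma>(2) \<kappa>\<theta>(2) m0 by (meson add_increasing2 divide_nonneg_pos order_refl order_trans)
  show ?thesis
  proof (cases "y $ j = 0")
    \<comment> \<open>Now \<open>V j\<close> is 0 and has no reciprocal. Its substitute
      \<open>B\<close> exceeds \<theta>, which pushes the integer \<open>y' $ j\<close> below
      1.\<close>
    case True
    then have "r $ j = 0" using rj[of j] by simp
    then have "B * real (y' $ j) \<le> \<theta>" using bound[of j] w0[OF True] by (simp add: l_def)
    then have "B * real (y' $ j) < B * 1" using B by (simp add: \<theta>_def)
    then have "real (y' $ j) < 1" using \<theta>(2) mult_less_cancel_left_pos by blast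
    then show ?thesis using True by simp
  next
    case False
    obtain u :: nat where u: "l j = 1 / real u" "max (m * (y $ j - r $ j)) (r $ j) \<le> u"
        "m * u \<le> (m + 1) * max (m * (y $ j - r $ j)) (r $ j)"
      using w1[OF False] unfolding l_def by blast
    define v where "v = max (m * (real (y $ j) - real (r $ j))) (real (r $ j))"
    have "0 < m * (y $ j - r $ j) \<or> 0 < r $ j" using m False rj[of j] by (cases "r $ j = 0") auto
    then have "0 < max (m * (y $ j - r $ j)) (r $ j)" by (simp only: less_max_iff_disj)
    then have "0 < u" using u(2) by (rule less_le_trans)
    then have u0: "0 < real u" by simp
    have "real (m * u) \<le> real ((m + 1) * max (m * (y $ j - r $ j)) (r $ j))"
      using u(3) by (rule of_nat_mono)
    then have "real m * real u \<le> (real m + 1) * v" unfolding v_def using V[of j] by (simp add: algebra_simps)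
    then have "real u \<le> (m + 1) * v / m" using m0 by (simp add: field_simps)
    then have "\<theta> * real u \<le> \<theta> * ((m + 1) * v / m)" using \<theta>(1) by (rule mult_left_mono)
    moreover have "real (y' $ j) - real (r $ j) \<le> \<theta> * real u"
      using bound[of j] u(1) u0 by (simp add: field_simps)
    ultimately have y': "real (y' $ j) \<le> real (r $ j) + \<kappa> / m * v" unfolding \<kappa>\<theta>(1) by simp
    show ?thesis
    \<comment> \<open>The deviation \<open>\<kappa> / m * v\<close> is small relative to
      \<open>r $ j\<close> if \<open>r $ j\<close> is the maximum, and otherwise equals \<kappa>
      times \<open>y $ j - r $ j\<close>.\<close>
    proof (cases "m * (real (y $ j) - real (r $ j)) \<le> real (r $ j)")
      case True
      then have "v = real (r $ j)" by (simp add: v_def)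
      then have "real (y' $ j) \<le> (1 + \<kappa> / m) * real (r $ j)" using y' by (simp add: algebra_simps)
      also have "\<dots> \<le> \<gamma> * real (y $ j)" using \<gamma>(2) \<gamma>1 rj[of j] by (intro mult_mono) auto
      finally show ?thesis .
    next
      case False
      then have "\<kappa> / m * v = \<kappa> * (real (y $ j) - real (r $ j))" using m0 by (simp add: v_def)
      moreover have "\<kappa> * (real (y $ j) - real (r $ j)) \<le> \<gamma> * (real (y $ j) - real (r $ j))"
        using \<gamma>(1) rj[of j] by (intro mult_right_mono) auto
      moreover have "real (r $ j) \<le> \<gamma> * real (r $ j)" using mult_right_mono[OF \<gamma>1, of "real (r $ j)"] by simp
      ultimately show ?thesis using y' by (simp add: algebra_simps)
    qed
  qed
qed

lemma pareto_set_below: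
  fixes Y :: "(nat ^ 'k::finite) set"
  assumes "finite Y" "y \<in> Y"
  shows "\<exists>z \<in> pareto_set Y. z \<le> y"
proof -
  obtain z where "z \<in> Y" "z \<le> y" "\<forall>b \<in> Y. b \<le> z \<longrightarrow> z = b"
    using finite_has_minimal2[OF assms] by blast
  then show ?thesis unfolding pareto_set_def by (intro bexI[of _ z]) auto
qed

lemma finite_objvecs:
  fixes P :: "'k::enum problem"
  assumes "multicriteria_problem P" "I \<in> instances P"
  shows "finite (objvecs P I)" "objvecs P I \<noteq> {}"
proof -
  obtain M where M: "\<forall>y \<in> objvecs P I. \<forall>j. y $ j \<le> M"
    using assms unfolding multicriteria_problem_def by meson
  have "objvecs P I \<subseteq> vec_lambda ` (PiE UNIV (\<lambda>_. {..M}))"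
  proof
    fix y
    assume "y \<in> objvecs P I"
    then have "vec_nth y \<in> PiE UNIV (\<lambda>_. {..M})" using M by auto
    then show "y \<in> vec_lambda ` (PiE UNIV (\<lambda>_. {..M}))" by (metis image_eqI vec_nth_inverse)
  qed
  then show "finite (objvecs P I)" by (rule finite_subset) (intro finite_imageI finite_PiE, auto)
  show "objvecs P I \<noteq> {}" using assms unfolding multicriteria_problem_def objvecs_def by auto
qed

lemma ideal_point_le:
  "finite Y \<Longrightarrow> y \<in> Y \<Longrightarrow> ideal_point Y \<le> (y :: nat ^ 'k::finite)"
  by (auto simp: ideal_point_def less_eq_vec_def)

text \<open>Because the minimum of each objective occurs at a Pareto optimal vector, an
  \<alpha>-approximate Pareto set comes within the factor \<alpha> of every ideal
  coordinate.\<close>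

lemma ideal_point_attained:
  fixes Y :: "(nat ^ 'k::finite) set"
  assumes "finite Y" "Y \<noteq> {}"
  shows "\<exists>y \<in> pareto_set Y. y $ j = ideal_point Y $ j"
proof -
  have "Min ((\<lambda>y. y $ j) ` Y) \<in> (\<lambda>y. y $ j) ` Y" using assms by (intro Min_in) auto
  then obtain y where y: "y \<in> Y" "y $ j = ideal_point Y $ j" by (auto simp: ideal_point_def)
  obtain z where z: "z \<in> pareto_set Y" "z \<le> y" using pareto_set_below[OF assms(1) y(1)] by blast
  have "ideal_point Y \<le> z" using z(1) assms(1) by (intro ideal_point_le) (auto simp: pareto_set_def)
  then have "z $ j = ideal_point Y $ j" using z(2) y(2) by (metis less_eq_vec_def order_antisym)
  with z(1) show ?thesis by blast
qed

section \<open>Reductions between Pareto sets and norm minimization\<close>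

definition solves :: "data set \<Rightarrow> (data \<Rightarrow> data \<Rightarrow> bool) \<Rightarrow> (nat \<Rightarrow> real) \<Rightarrow> prog \<Rightarrow> bool" where
  "solves D R T A \<longleftrightarrow> (\<forall>v \<in> D. \<exists>w t. runs A v w t \<and> real t \<le> T (dsize v) \<and> R v w)"

text \<open>Unifies the cases: index type \<open>unit\<close> with size 0 for a single algorithm,
  \<epsilon> for an FPTAS, pairs of \<open>p\<close> and \<epsilon> for the families. The set
  \<open>X\<close> holds the indices at which something is demanded, such as positive
  \<epsilon>.\<close>

definition poly_family :: "'i set \<Rightarrow> ('i \<Rightarrow> nat) \<Rightarrow> ('i \<Rightarrow> (nat \<Rightarrow> real) \<Rightarrow> prog \<Rightarrow> bool) \<Rightarrow> bool" where
  "poly_family X s Q \<longleftrightarrow> (\<exists>d. \<forall>i \<in> X. \<exists>A. Q i (\<lambda>n. real ((2 + s i + n) ^ d)) A)"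

text \<open>Choosing one output for each input turns a family of programs into a function in
  \<open>polytime\<close>, so that reductions use only the closure rules. Indices outside
  \<open>X\<close> get an empty domain.\<close>

lemma poly_family_solves_iff:
  "poly_family X s (\<lambda>i. solves (D i) (R i)) \<longleftrightarrow>
    (\<exists>f. polytime s (\<lambda>i. {v \<in> D i. i \<in> X}) f \<and> (\<forall>i \<in> X. \<forall>v \<in> D i. R i v (f i v)))"
    (is "?L \<longleftrightarrow> ?R")
proof
  assume ?L
  then obtain d where d: "\<forall>i \<in> X. \<exists>A. \<forall>v \<in> D i. \<exists>w t. runs A v w t \<and>
      t \<le> (2 + s i + dsize v) ^ d \<and> R i v w"
    unfolding poly_family_def solves_def of_nat_le_iff by blast
  then obtain A where A: "\<forall>i \<in> X. \<forall>v \<in> D i. \<exists>w t. runs (A i) v w t \<and>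
      t \<le> (2 + s i + dsize v) ^ d \<and> R i v w" by metis
  then have "\<forall>i v. \<exists>w. i \<in> X \<and> v \<in> D i \<longrightarrow> (\<exists>t. runs (A i) v w t \<and> t \<le> (2 + s i + dsize v) ^ d \<and> R i v w)"
    by blast
  then obtain f where f: "\<And>i v. i \<in> X \<Longrightarrow> v \<in> D i \<Longrightarrow>
      \<exists>t. runs (A i) v (f i v) t \<and> t \<le> (2 + s i + dsize v) ^ d \<and> R i v (f i v)" by metis
  have "polytime s (\<lambda>i. {v \<in> D i. i \<in> X}) f"
  proof (rule polytimeI)
    show "poly_bounded s (\<lambda>i. {v \<in> D i. i \<in> X}) (\<lambda>i v. (2 + s i + dsize v) ^ d)"
      by (intro poly_bounded_intros)
    show "\<exists>t. t \<le> (2 + s i + dsize v) ^ d \<and> runs (A i) v (f i v) t" if "v \<in> {v \<in> D i. i \<in> X}" for i v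
      using f[of i v] that by blast
  qed
  then show ?R using f by blast
next
  assume ?R
  then obtain f A h where f: "\<forall>i \<in> X. \<forall>v \<in> D i. R i v (f i v)"
    and h: "poly_bounded s (\<lambda>i. {v \<in> D i. i \<in> X}) h"
    and A: "\<forall>i. \<forall>v \<in> {v \<in> D i. i \<in> X}. \<exists>t \<le> h i v. runs (A i) v (f i v) t"
    unfolding polytime_def by blast
  obtain d where d: "\<And>i v. i \<in> X \<Longrightarrow> v \<in> D i \<Longrightarrow> h i v \<le> (2 + s i + dsize v) ^ d"
    using h unfolding poly_bounded_def by blast
  have "solves (D i) (R i) (\<lambda>n. real ((2 + s i + n) ^ d)) (A i)" if i: "i \<in> X" for i
    unfolding solves_def
  proof
    fix v
    assume v: "v \<in> D i"
    then obtain t where "t \<le> h i v" "runs (A i) v (f i v) t" using A i by blast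
    then show "\<exists>w t. runs (A i) v w t \<and> real t \<le> real ((2 + s i + dsize v) ^ d) \<and> R i v w"
      using d[OF i v] f i v unfolding of_nat_le_iff by (meson le_trans)
  qed
  then show ?L unfolding poly_family_def by blast
qed

definition approx_solution ::
  "'k::enum problem \<Rightarrow> (real ^ 'k::enum \<Rightarrow> real) \<Rightarrow> real \<Rightarrow> data \<Rightarrow> nat ^ 'k::enum \<Rightarrow> rat ^ 'k::enum \<Rightarrow> data \<Rightarrow> bool" where
  "approx_solution P N \<alpha> I r w x \<longleftrightarrow> x \<in> feasible P I \<and>
     ref_obj N r w (objective P I x) \<le> \<alpha> * Min (ref_obj N r w ` objvecs P I)"

definition rp_inputs :: "'k::enum problem \<Rightarrow> data set" where
  "rp_inputs P = {Cell I (Cell (enc_natvec r) (enc_ratvec w)) | I r (w :: rat ^ 'k::enum).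
     I \<in> instances P \<and> r \<le> ideal_point (objvecs P I) \<and> 0 \<le> w}"

definition cp_inputs :: "'k::enum problem \<Rightarrow> data set" where
  "cp_inputs P = {Cell I (enc_ratvec w) | I (w :: rat ^ 'k::enum). I \<in> instances P \<and> 0 \<le> w}"

lemma pareto_algorithm_eq:
  "pareto_algorithm P \<alpha> = solves (instances P) (\<lambda>I v. \<exists>xs. v = enc_list xs \<and>
     set xs \<subseteq> feasible P I \<and> approx_pareto_set \<alpha> (objvecs P I) (objective P I ` set xs))"
  unfolding pareto_algorithm_def solves_def fun_eq_iff by blast

text \<open>The universal quantifier over decodings is harmless, as the encodings are
  injective.\<close>

lemma rp_algorithm_eq:
  "rp_algorithm P N \<alpha> = solves (rp_inputs P) (\<lambda>v x. \<forall>I r w.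
     v = Cell I (Cell (enc_natvec r) (enc_ratvec w)) \<longrightarrow> approx_solution P N \<alpha> I r w x)"
  unfolding rp_algorithm_def solves_def rp_inputs_def approx_solution_def Let_def fun_eq_iff
  by (fastforce simp: Ball_def)

lemma cp_algorithm_eq:
  "cp_algorithm P N \<alpha> = solves (cp_inputs P) (\<lambda>v x. \<forall>I w.
     v = Cell I (enc_ratvec w) \<longrightarrow> approx_solution P N \<alpha> I (ideal_point (objvecs P I)) w x)"
  unfolding cp_algorithm_def solves_def cp_inputs_def approx_solution_def Let_def fun_eq_iff
  by (fastforce simp: Ball_def)

section \<open>From a maximum norm oracle to approximate Pareto sets\<close>

lemma enc_rat_inverse_nat: "1 \<le> u \<Longrightarrow> enc_rat (1 / of_nat u) = Cell (Num 1) (Num (int u))"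
proof -
  assume "1 \<le> u"
  then have "quotient_of (1 / of_nat u) = (1, int u)"
    using quotient_of_Fract[of 1 "int u"] by (simp add: Fract_of_int_quotient Rat.normalize_def)
  then show ?thesis by (simp add: enc_rat_def)
qed

lemma enc_rat_of_int: "enc_rat (of_int z) = Cell (Num z) (Num 1)"
  by (simp add: enc_rat_def)

text \<open>The oracle is run on all tuples of grid entries, but terminates in time only on legal
  inputs. Hence every tuple has to be the encoding of a nonnegative weight vector.\<close>

lemma enc_list_eq_enc_ratvec:
  assumes "length xs = length (enum_class.enum :: 'k::enum list)" "\<And>x. x \<in> set xs \<Longrightarrow> \<exists>q \<ge> 0. x = enc_rat q"
  obtains w :: "rat ^ 'k::enum" where "0 \<le> w" "enc_list xs = enc_ratvec w"
proof -
  let ?e = "enum_class.enum :: 'k list"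
  define n where "n j = (THE n. n < length ?e \<and> ?e ! n = j)" for j
  have n: "n (?e ! l) = l" if "l < length ?e" for l
    unfolding n_def using that by (intro the_equality) (auto simp: nth_eq_iff_index_eq[OF enum_distinct])
  obtain q where q: "\<And>x. x \<in> set xs \<Longrightarrow> 0 \<le> q x \<and> x = enc_rat (q x)" using assms(2) by metis
  have ne: "n j < length ?e" for j
  proof -
    obtain l where "l < length ?e" "?e ! l = j" using UNIV_enum[where 'a = 'k] by (metis UNIV_I in_set_conv_nth)
    then show ?thesis using n by metis
  qed
  define w :: "rat ^ 'k::enum" where "w = (\<chi> j. q (xs ! n j))"
  have "xs = map (\<lambda>j. enc_rat (w $ j)) ?e"
    using assms(1) q n by (intro nth_equalityI) (auto simp: w_def)
  moreover have "0 \<le> w" using q ne assms(1) by (auto simp: w_def less_eq_vec_def)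
  ultimately show thesis by (intro that[of w]) (auto simp: enc_ratvec_def)
qed

text \<open>The reference point \<open>r I\<close> is never computed: the grid depends only on the
  bound on the objective values, and the good weights merely have to occur in it. The same algorithm
  therefore serves the point 0 and the unknown ideal point.\<close>

theorem pareto_family_of_max_norm_oracle:
  fixes P :: "'k::enum problem" and \<alpha> \<gamma> :: "'i \<Rightarrow> real" and c :: real
  assumes P: "multicriteria_problem P"
    and f: "polytime s (\<lambda>i. {v \<in> cp_inputs P. i \<in> X}) f"
    and r: "\<And>I. I \<in> instances P \<Longrightarrow> r I \<le> ideal_point (objvecs P I)"
    and approx: "\<And>i I w. i \<in> X \<Longrightarrow> I \<in> instances P \<Longrightarrow> 0 \<le> w \<Longrightarrow>
      approx_solution P max_norm (\<alpha> i) I (r I) w (f i (Cell I (enc_ratvec w)))"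
    and m: "poly_bounded s (\<lambda>i. UNIV) (\<lambda>i v. m i)" "\<And>i. 1 \<le> m i"
    and \<alpha>: "\<And>i. i \<in> X \<Longrightarrow> 1 \<le> \<alpha> i \<and> \<alpha> i \<le> c"
    and \<gamma>: "\<And>i. i \<in> X \<Longrightarrow> (\<alpha> i + m i * (\<alpha> i - 1)) * (1 + 1 / m i) \<le> \<gamma> i"
      "\<And>i. i \<in> X \<Longrightarrow> 1 + (\<alpha> i + m i * (\<alpha> i - 1)) * (1 + 1 / m i) / m i \<le> \<gamma> i"
  shows "poly_family X s (\<lambda>i. pareto_algorithm P (\<gamma> i))"
proof -
  define D where "D i = {I \<in> instances P. i \<in> X}" for i
  \<comment> \<open>One value for all indices:
    \<open>\<alpha> / m + (\<alpha> - 1) \<le> 2 * \<alpha> - 1 < 2 * c\<close>.\<close>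
  define B :: nat where "B = nat \<lceil>2 * c\<rceil>"
  have B: "\<alpha> i / m i + (\<alpha> i - 1) < B" if "i \<in> X" for i
  proof -
    have "\<alpha> i / m i \<le> \<alpha> i / 1" using \<alpha>[OF that] m(2)[of i] by (intro divide_left_mono) auto
    then show ?thesis using \<alpha>[OF that] by (simp add: B_def) linarith
  qed
  obtain M :: "'i \<Rightarrow> data \<Rightarrow> nat" where M: "polytime s (\<lambda>i. UNIV) (\<lambda>i v. Num (int (M i v)))"
    "\<And>i I y j. I \<in> instances P \<Longrightarrow> y \<in> objvecs P I \<Longrightarrow> y $ j \<le> M i I"
    by (rule polytime_objective_bound[OF P, of s]) blast
  \<comment> \<open>Both arguments of the maximum \<open>V j\<close> are at most
    \<open>m * M\<close>, so this is the end of the grid.\<close>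
  have "polytime s D (\<lambda>i v. Num (int (m i * M i v)))"
  proof -
    have "polytime s D (\<lambda>i v. Num (int (m i)))"
    proof (rule polytime_param_const, rule poly_bounded_mono)
      show "poly_bounded s D (\<lambda>i v. 1 + m i)"
        by (intro poly_bounded_intros poly_bounded_subset[OF m(1)]) auto
    qed (rule dsize_Num_nat_le)
    from polytime_mult[OF this polytime_subset[OF M(1)]] show ?thesis by simp
  qed
  then obtain G where G: "polytime s D (\<lambda>i v. enc_list (G i v))"
    "\<And>i v x. v \<in> D i \<Longrightarrow> x \<in> set (G i v) \<Longrightarrow> \<exists>u::nat. 1 \<le> u \<and> x = Cell (Num 1) (Num (int u))"
    "\<And>i v V. v \<in> D i \<Longrightarrow> 1 \<le> V \<Longrightarrow> V \<le> m i * M i v \<Longrightarrow>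
      \<exists>u::nat. Cell (Num 1) (Num (int u)) \<in> set (G i v) \<and> V \<le> u \<and> m i * u \<le> (m i + 1) * V"
    by (rule polytime_grid[OF _ m]) blast
  \<comment> \<open>The extra entry is the weight for coordinates with
    \<open>y $ j = 0\<close>.\<close>
  define G' where "G' i v = Cell (Num (int B)) (Num 1) # G i v" for i v
  define k where "k = length (enum_class.enum :: 'k list)"
  define ts where "ts i v = tuples k (G' i v)" for i v
  have "polytime s D (\<lambda>i v. enc_list (G' i v))"
    using polytime_Cell[OF polytime_const G(1)] by (simp add: G'_def)
  then have ts: "polytime s D (\<lambda>i v. enc_list (ts i v))" unfolding ts_def by (rule polytime_tuples)
  have B_enc: "Cell (Num (int B)) (Num 1) = enc_rat (of_nat B)" using enc_rat_of_int[of "int B"] by simp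
  have G'_rat: "\<exists>q \<ge> 0. x = enc_rat q" if v: "v \<in> D i" and x: "x \<in> set (G' i v)" for i v x
  proof (cases "x = Cell (Num (int B)) (Num 1)")
    case True
    then show ?thesis using B_enc by (metis of_nat_0_le_iff)
  next
    case False
    then obtain u :: nat where "1 \<le> u" "x = Cell (Num 1) (Num (int u))"
      using G(2)[OF v] x by (auto simp: G'_def)
    then show ?thesis using enc_rat_inverse_nat[of u]
      by (metis of_nat_0_le_iff zero_le_divide_1_iff)
  qed
  have ts_rat: "\<exists>w :: rat ^ 'k::enum. 0 \<le> w \<and> t = enc_ratvec w" if v: "v \<in> D i" and t: "t \<in> set (ts i v)" for i v t
  proof -
    obtain xs where xs: "t = enc_list xs" "length xs = k" "set xs \<subseteq> set (G' i v)"
      using t unfolding ts_def set_tuples by blast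
    obtain w :: "rat ^ 'k::enum" where "0 \<le> w" "enc_list xs = enc_ratvec w"
      using xs(2,3) G'_rat[OF v] by (elim enc_list_eq_enc_ratvec[of xs, where 'k = 'k, unfolded k_def[symmetric]]) blast+
    then show ?thesis using xs(1) by blast
  qed
  define xs where "xs i v = map (\<lambda>t. f i (Cell v t)) (ts i v)" for i v
  have xs: "polytime s D (\<lambda>i v. enc_list (xs i v))"
    unfolding xs_def
  proof (rule polytime_map[OF ts f])
    show "Cell v t \<in> {v \<in> cp_inputs P. i \<in> X}" if "v \<in> D i" "t \<in> set (ts i v)" for i v t
      using ts_rat[OF that] that(1) by (auto simp: D_def cp_inputs_def)
  qed
  have correct: "set (xs i I) \<subseteq> feasible P I \<and>
      approx_pareto_set (\<gamma> i) (objvecs P I) (objective P I ` set (xs i I))"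
    if i: "i \<in> X" and I: "I \<in> instances P" for i I
  proof (intro conjI)
    have ID: "I \<in> D i" using i I by (simp add: D_def)
    note fin = finite_objvecs[OF P I]
    show feas: "set (xs i I) \<subseteq> feasible P I"
      using ts_rat[OF ID] approx[OF i I] by (auto simp: xs_def approx_solution_def)
    show "approx_pareto_set (\<gamma> i) (objvecs P I) (objective P I ` set (xs i I))"
      unfolding approx_pareto_set_def
    proof (intro conjI ballI)
      show "objective P I ` set (xs i I) \<subseteq> objvecs P I" using feas by (auto simp: objvecs_def)
      fix y
      assume "y \<in> pareto_set (objvecs P I)"
      then have y: "y \<in> objvecs P I" by (simp add: pareto_set_def)
      have ry: "r I \<le> y" using r[OF I] ideal_point_le[OF fin(1) y] by (rule order_trans)
      define V where "V j = max (m i * (y $ j - r I $ j)) (r I $ j)" for j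
      have ex: "\<exists>q. enc_rat q \<in> set (G' i I) \<and> (y $ j = 0 \<longrightarrow> q = of_nat B) \<and>
          (y $ j \<noteq> 0 \<longrightarrow> (\<exists>u::nat. q = 1 / of_nat u \<and> V j \<le> u \<and> m i * u \<le> (m i + 1) * V j)) \<and> 0 \<le> q" for j
      proof (cases "y $ j = 0")
        case True
        then show ?thesis using B_enc by (intro exI[of _ "of_nat B"]) (auto simp: G'_def)
      next
        case False
        have rj: "r I $ j \<le> y $ j" using ry by (simp add: less_eq_vec_def)
        have "0 < m i * (y $ j - r I $ j) \<or> 0 < r I $ j"
          using m(2)[of i] False rj by (cases "r I $ j = 0") auto
        then have "0 < V j" unfolding V_def by (simp only: less_max_iff_disj)
        moreover have "V j \<le> m i * M i I"
          unfolding V_def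
        proof (rule max.boundedI)
          have "y $ j \<le> M i I" by (rule M(2)[OF I y])
          then show "m i * (y $ j - r I $ j) \<le> m i * M i I" by (intro mult_left_mono) auto
          have "1 * (r I $ j) \<le> m i * M i I" using \<open>y $ j \<le> M i I\<close> rj m(2)[of i] by (intro mult_mono) auto
          then show "r I $ j \<le> m i * M i I" by simp
        qed
        ultimately obtain u :: nat where u: "Cell (Num 1) (Num (int u)) \<in> set (G i I)" "V j \<le> u"
            "m i * u \<le> (m i + 1) * V j"
          using G(3)[OF ID, of "V j"] by auto
        then have "1 \<le> u" using \<open>0 < V j\<close> by simp
        then show ?thesis using u False enc_rat_inverse_nat[of u]
          by (intro exI[of _ "1 / of_nat u"]) (auto simp: G'_def)
      qed
      then obtain q where q: "\<And>j. enc_rat (q j) \<in> set (G' i I) \<and> (y $ j = 0 \<longrightarrow> q j = of_nat B) \<and>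
          (y $ j \<noteq> 0 \<longrightarrow> (\<exists>u::nat. q j = 1 / of_nat u \<and> V j \<le> u \<and> m i * u \<le> (m i + 1) * V j)) \<and> 0 \<le> q j"
        by metis
      define w :: "rat ^ 'k::enum" where "w = (\<chi> j. q j)"
      have w: "0 \<le> w" using q by (auto simp: w_def less_eq_vec_def)
      have "enc_ratvec w \<in> set (ts i I)"
        unfolding ts_def set_tuples enc_ratvec_def using q
        by (intro CollectI exI[of _ "map (\<lambda>j. enc_rat (w $ j)) enum_class.enum"]) (auto simp: k_def w_def)
      then have fx: "f i (Cell I (enc_ratvec w)) \<in> set (xs i I)" by (auto simp: xs_def)
      define y' where "y' = objective P I (f i (Cell I (enc_ratvec w)))"
      have ap: "f i (Cell I (enc_ratvec w)) \<in> feasible P I"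
        "ref_obj max_norm (r I) w y' \<le> \<alpha> i * Min (ref_obj max_norm (r I) w ` objvecs P I)"
        using approx[OF i I w] by (auto simp: approx_solution_def y'_def)
      have "Min (ref_obj max_norm (r I) w ` objvecs P I) \<le> ref_obj max_norm (r I) w y"
        using fin y by (intro Min_le) auto
      then have opt: "ref_obj max_norm (r I) w y' \<le> \<alpha> i * ref_obj max_norm (r I) w y"
        using ap(2) \<alpha>[OF i] mult_left_mono[of _ _ "\<alpha> i"] by (meson order_trans zero_le_one)
      have "y' \<in> objvecs P I" using ap(1) by (auto simp: objvecs_def y'_def)
      then have ry': "r I \<le> y'" using r[OF I] ideal_point_le[OF fin(1)] order_trans by blast
      have "real (y' $ j) \<le> \<gamma> i * real (y $ j)" for j
      proof (rule scalarization_quality[OF m(2) _ B[OF i] ry ry' _ _ opt refl \<gamma>(1)[OF i] \<gamma>(2)[OF i]])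
        show "1 \<le> \<alpha> i" using \<alpha>[OF i] by simp
        show "real_of_rat (w $ j) = real B" if "y $ j = 0" for j
          using q[of j] that by (simp add: w_def)
        show "\<exists>u::nat. real_of_rat (w $ j) = 1 / real u \<and> max (m i * (y $ j - r I $ j)) (r I $ j) \<le> u \<and>
            m i * u \<le> (m i + 1) * max (m i * (y $ j - r I $ j)) (r I $ j)" if y0: "y $ j \<noteq> 0" for j
        proof -
          obtain u :: nat where "q j = 1 / of_nat u" "V j \<le> u" "m i * u \<le> (m i + 1) * V j"
            using q[of j] y0 by blast
          then show ?thesis unfolding V_def by (intro exI[of _ u]) (simp add: w_def of_rat_divide)
        qed
      qed
      then show "\<exists>y' \<in> objective P I ` set (xs i I). \<forall>j. real (y' $ j) \<le> \<gamma> i * real (y $ j)"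
        using fx unfolding y'_def by blast
    qed
  qed
  show ?thesis
    unfolding pareto_algorithm_eq poly_family_solves_iff
    using xs correct unfolding D_def by blast
qed

lemma poly_le_power:
  fixes C :: real
  shows "\<exists>e. \<forall>n s x. 0 \<le> x \<longrightarrow> x \<le> real s \<longrightarrow> C * (1 + real n + x) ^ d \<le> real ((2 + s + n) ^ e)"
proof -
  define c where "c = nat \<lceil>\<bar>C\<bar>\<rceil>"
  have "C * (1 + real n + x) ^ d \<le> real ((2 + s + n) ^ (c + d))" if "0 \<le> x" "x \<le> real s" for n s x
  proof -
    have "C \<le> real c" unfolding c_def by linarith
    also have "\<dots> \<le> 2 ^ c" by (rule order.strict_implies_order[OF of_nat_less_two_power])
    also have "\<dots> \<le> (2 + real s + real n) ^ c" by (intro power_mono) auto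
    finally have "C * (1 + real n + x) ^ d \<le> (2 + real s + real n) ^ c * (2 + real s + real n) ^ d"
      using that by (intro mult_mono power_mono) auto
    then show ?thesis by (simp add: power_add add.assoc)
  qed
  then show ?thesis by blast
qed

section \<open>Evaluation of objectives and exact comparison of norms\<close>

lemma polytime_objective:
  fixes P :: "'k::enum problem"
  assumes "multicriteria_problem P"
  obtains ev where "polytime s (\<lambda>i. {Cell I x | I x. I \<in> instances P \<and> x \<in> feasible P I}) (\<lambda>i. ev)"
    "\<And>I x. I \<in> instances P \<Longrightarrow> x \<in> feasible P I \<Longrightarrow> ev (Cell I x) = enc_natvec (objective P I x)"
proof -
  obtain A and C :: real and d :: nat where A: "\<forall>I \<in> instances P. \<forall>x \<in> feasible P I. \<exists>t.
      runs A (Cell I x) (enc_natvec (objective P I x)) t \<and> real t \<le> C * (1 + real (dsize (Cell I x))) ^ d"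
    using assms unfolding multicriteria_problem_def by blast
  obtain e where e: "\<And>n s. C * (1 + real n) ^ d \<le> real ((2 + s + n) ^ e)"
    using poly_le_power[of C d] by (metis add.right_neutral of_nat_0_le_iff order_refl)
  define ev where "ev v = enc_natvec (objective P (dfst v) (dsnd v))" for v
  have "polytime s (\<lambda>i. {Cell I x | I x. I \<in> instances P \<and> x \<in> feasible P I}) (\<lambda>i. ev)"
  proof (rule polytimeI)
    show "poly_bounded s (\<lambda>i. {Cell I x | I x. I \<in> instances P \<and> x \<in> feasible P I})
      (\<lambda>i v. (2 + s i + dsize v) ^ e)" by (intro poly_bounded_intros)
    fix i v
    assume "v \<in> {Cell I x | I x. I \<in> instances P \<and> x \<in> feasible P I}"
    then obtain I x where v: "v = Cell I x" "I \<in> instances P" "x \<in> feasible P I" by blast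
    then obtain t where t: "runs A v (ev v) t" "real t \<le> C * (1 + real (dsize v)) ^ d"
      using A unfolding v(1) ev_def prim_val_simps by blast
    have "t \<le> (2 + s i + dsize v) ^ e" using t(2) e[of "dsize v" "s i"] by (meson of_nat_le_iff order_trans)
    with t(1) show "\<exists>t. t \<le> (2 + s i + dsize v) ^ e \<and> runs A v (ev v) t" by blast
  qed
  then show thesis by (rule that) (simp add: ev_def)
qed

text \<open>The weights multiplied by the product of all denominators. This common positive factor
  does not affect comparisons of a norm, and the product avoids computing a least common
  multiple.\<close>

definition int_weight :: "'k::enum \<Rightarrow> data \<Rightarrow> int" where
  "int_weight j v = dint (dfst (component j v)) *
     ((\<Prod>l \<in> UNIV. dint (dsnd (component (l :: 'k) v))) div dint (dsnd (component j v)))"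

definition denominator :: "'k::enum itself \<Rightarrow> data \<Rightarrow> int" where
  "denominator k v = (\<Prod>l \<in> UNIV. dint (dsnd (component (l :: 'k) v)))"

lemma denominator_pos: "0 < denominator TYPE('k) (enc_ratvec (w :: rat ^ 'k::enum))"
  unfolding denominator_def by (intro prod_pos) (auto simp: enc_rat_def quotient_of_denom_pos')

lemma int_weight_enc_ratvec:
  fixes w :: "rat ^ 'k::enum"
  shows "real_of_int (int_weight j (enc_ratvec w)) =
    real_of_int (denominator TYPE('k) (enc_ratvec w)) * real_of_rat (w $ j)"
proof -
  define a where "a j = fst (quotient_of (w $ j))" for j
  define b where "b j = snd (quotient_of (w $ j))" for j
  have b: "0 < b j" for j by (simp add: b_def quotient_of_denom_pos')
  have "w $ j = of_int (a j) / of_int (b j)" for j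
    by (rule quotient_of_div) (simp add: a_def b_def)
  then have w: "real_of_rat (w $ j) = real_of_int (a j) / real_of_int (b j)" for j
    by (simp add: of_rat_divide)
  have W: "int_weight j (enc_ratvec w) = a j * ((\<Prod>l \<in> UNIV. b l) div b j)"
    by (simp add: int_weight_def enc_rat_def a_def b_def)
  have D: "denominator TYPE('k) (enc_ratvec w) = (\<Prod>l \<in> UNIV. b l)"
    by (simp add: denominator_def enc_rat_def b_def)
  have "b j dvd (\<Prod>l \<in> UNIV. b l)" by (rule dvd_prodI) auto
  then have "real_of_int ((\<Prod>l \<in> UNIV. b l) div b j) = real_of_int (\<Prod>l \<in> UNIV. b l) / real_of_int (b j)"
    by (rule real_of_int_div)
  then show ?thesis unfolding W D w by simp
qed

lemma polytime_int_weight: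
  "polytime s D f \<Longrightarrow> polytime s D (\<lambda>i v. Num (int_weight (j :: 'k::enum) (f i v)))"
  unfolding int_weight_def by (intro polytime_intros polytime_prim polytime_prod finite)

lemma polytime_denominator:
  "polytime s D f \<Longrightarrow> polytime s D (\<lambda>i v. Num (denominator TYPE('k::enum) (f i v)))"
  unfolding denominator_def by (intro polytime_intros polytime_prim polytime_prod finite)

text \<open>Polynomial decidability for a whole family of norms with one exponent, as required for
  cornered norms whose coefficient varies with \<open>p\<close> and \<epsilon>.\<close>

definition decides :: "('i \<Rightarrow> nat) \<Rightarrow> ('i \<Rightarrow> real ^ 'k::enum \<Rightarrow> real) \<Rightarrow> ('i \<Rightarrow> data \<Rightarrow> data) \<Rightarrow> bool" where
  "decides s N dec \<longleftrightarrow>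
     polytime s (\<lambda>i. {Cell (enc_ratvec y) (enc_ratvec z) | (y :: rat ^ 'k::enum) (z :: rat ^ 'k::enum). True}) dec \<and>
     (\<forall>i y z. dec i (Cell (enc_ratvec y) (enc_ratvec z)) =
        Num (if N i (real_vec_of_rat y) \<le> N i (real_vec_of_rat z) then 1 else 0))"

lemma polynomially_decidable_decides:
  assumes "polynomially_decidable N"
  shows "\<exists>dec. decides s (\<lambda>i. N :: real ^ 'k::enum \<Rightarrow> real) dec"
proof -
  obtain A and C :: real and d :: nat where A: "\<forall>y z :: rat ^ 'k::enum. \<exists>t.
        runs A (Cell (enc_ratvec y) (enc_ratvec z))
          (Num (if N (real_vec_of_rat y) \<le> N (real_vec_of_rat z) then 1 else 0)) t \<and>
        real t \<le> C * (1 + real (dsize (Cell (enc_ratvec y) (enc_ratvec z)))) ^ d"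
    using assms unfolding polynomially_decidable_def by blast
  obtain e where e: "\<And>n s. C * (1 + real n) ^ d \<le> real ((2 + s + n) ^ e)"
    using poly_le_power[of C d] by (metis add.right_neutral of_nat_0_le_iff order_refl)
  \<comment> \<open>A decoding by choice, used only to write the answer as a function of the input;
    the program itself is \<open>A\<close>.\<close>
  define un where "un v = (SOME y :: rat ^ 'k::enum. v = enc_ratvec y)" for v
  have un: "un (enc_ratvec y) = y" for y by (simp add: un_def)
  define dec where "dec v = Num (if N (real_vec_of_rat (un (dfst v))) \<le>
    N (real_vec_of_rat (un (dsnd v))) then 1 else 0)" for v
  have "polytime s (\<lambda>i. {Cell (enc_ratvec y) (enc_ratvec z) | (y :: rat ^ 'k::enum) (z :: rat ^ 'k::enum). True}) (\<lambda>i. dec)"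
  proof (rule polytimeI)
    show "poly_bounded s (\<lambda>i. {Cell (enc_ratvec y) (enc_ratvec z) | (y :: rat ^ 'k::enum) (z :: rat ^ 'k::enum). True})
      (\<lambda>i v. (2 + s i + dsize v) ^ e)" by (intro poly_bounded_intros)
    fix i v
    assume "v \<in> {Cell (enc_ratvec y) (enc_ratvec z) | (y :: rat ^ 'k::enum) (z :: rat ^ 'k::enum). True}"
    then obtain y z :: "rat ^ 'k::enum" where v: "v = Cell (enc_ratvec y) (enc_ratvec z)" by blast
    obtain t where t: "runs A v (dec v) t" "real t \<le> C * (1 + real (dsize v)) ^ d"
      using A unfolding v dec_def prim_val_simps un by blast
    have "t \<le> (2 + s i + dsize v) ^ e" using t(2) e[of "dsize v" "s i"] by (meson of_nat_le_iff order_trans)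
    with t(1) show "\<exists>t. t \<le> (2 + s i + dsize v) ^ e \<and> runs A v (dec v) t" by blast
  qed
  then show ?thesis unfolding decides_def by (intro exI[of _ "\<lambda>i. dec"]) (simp add: dec_def un)
qed

lemma decides_polynomially_decidable:
  assumes "decides (\<lambda>i::unit. 0) (\<lambda>i. N :: real ^ 'k::enum \<Rightarrow> real) dec"
  shows "polynomially_decidable N"
proof -
  let ?D = "{Cell (enc_ratvec y) (enc_ratvec z) | (y :: rat ^ 'k::enum) (z :: rat ^ 'k::enum). True}"
  obtain A h where h: "poly_bounded (\<lambda>i::unit. 0) (\<lambda>i. ?D) h"
    and A: "\<And>i v. v \<in> ?D \<Longrightarrow> \<exists>t \<le> h i v. runs (A i) v (dec i v) t"
    using assms unfolding decides_def polytime_def by blast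
  obtain d where d: "\<And>i v. v \<in> ?D \<Longrightarrow> h i v \<le> (2 + dsize v) ^ d"
    using h unfolding poly_bounded_def by auto
  show ?thesis
    unfolding polynomially_decidable_def
  proof (rule exI[of _ "A ()"], rule exI[of _ "2 ^ d"], rule exI[of _ d], intro allI)
    fix y z :: "rat ^ 'k::enum"
    let ?v = "Cell (enc_ratvec y) (enc_ratvec z)"
    have v: "?v \<in> ?D" by blast
    obtain t where t: "t \<le> h () ?v" "runs (A ()) ?v (dec () ?v) t" using A[OF v] by blast
    have "t \<le> (2 + dsize ?v) ^ d" using t(1) d[OF v, of "()"] by (rule le_trans)
    then have "real t \<le> (2 + real (dsize ?v)) ^ d" by (metis of_nat_add of_nat_le_iff of_nat_numeral of_nat_power)
    also have "\<dots> \<le> (2 * (1 + real (dsize ?v))) ^ d" by (intro power_mono) auto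
    finally have "real t \<le> 2 ^ d * (1 + real (dsize ?v)) ^ d" unfolding power_mult_distrib .
    moreover have "runs (A ()) ?v (Num (if N (real_vec_of_rat y) \<le> N (real_vec_of_rat z) then 1 else 0)) t"
      using t(2) assms unfolding decides_def by metis
    ultimately show "\<exists>t. runs (A ()) ?v (Num (if N (real_vec_of_rat y) \<le> N (real_vec_of_rat z) then 1 else 0)) t \<and>
      real t \<le> 2 ^ d * (1 + real (dsize ?v)) ^ d" by blast
  qed
qed

lemma real_vec_of_rat_nth [simp]: "real_vec_of_rat y $ j = real_of_rat (y $ j)"
  by (simp add: real_vec_of_rat_def)

lemma real_Max_image:
  "finite S \<Longrightarrow> S \<noteq> {} \<Longrightarrow> real_of_int (Max (g ` S)) = Max ((\<lambda>j. real_of_int (g j)) ` S)"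
  by (subst mono_Max_commute[of real_of_int]) (auto simp: mono_def image_image)

text \<open>Multiplying by \<open>m\<close> and by the common denominator of the vector makes the
  norm an integer, here \<open>val\<close>. Two vectors are then compared by cross-multiplying with
  each other's denominator.\<close>

lemma decides_sum_max_norm:
  fixes a m :: "'i \<Rightarrow> nat"
  assumes a: "poly_bounded s (\<lambda>i. UNIV) (\<lambda>i v. a i)" and m: "poly_bounded s (\<lambda>i. UNIV) (\<lambda>i v. m i)"
    and m1: "\<And>i. 1 \<le> m i"
  shows "\<exists>dec. decides s (\<lambda>i. sum_max_norm (a i / m i) :: real ^ 'k::enum \<Rightarrow> real) dec"
proof -
  let ?D = "\<lambda>i::'i. {Cell (enc_ratvec y) (enc_ratvec z) | (y :: rat ^ 'k::enum) (z :: rat ^ 'k::enum). True}"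
  define sc where "sc j v = \<bar>int_weight (j :: 'k) v\<bar>" for j v
  define val where "val i v = int (m i) * Max ((\<lambda>j. sc j v) ` UNIV) + int (a i) * (\<Sum>j \<in> UNIV. sc j v)" for i v
  define den where "den = denominator TYPE('k)"
  define dec where "dec i u = Num (if val i (dfst u) * den (dsnd u) \<le>
    val i (dsnd u) * den (dfst u) then 1 else 0)" for i u
  have const: "polytime s ?D (\<lambda>i v. Num (int (n i)))" if "poly_bounded s (\<lambda>i. UNIV) (\<lambda>i v. n i)" for n
  proof (rule polytime_param_const, rule poly_bounded_mono)
    show "poly_bounded s ?D (\<lambda>i v. 1 + n i)"
      by (intro poly_bounded_intros poly_bounded_subset[OF that]) auto
  qed (rule dsize_Num_nat_le)
  have val: "polytime s ?D (\<lambda>i u. Num (val i (f i u)))" if f: "polytime s ?D f" for f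
    unfolding val_def sc_def
    by (intro polytime_add polytime_mult const a m polytime_Max polytime_sum polytime_abs
        polytime_int_weight f finite UNIV_not_empty)
  have den: "polytime s ?D (\<lambda>i u. Num (den (f i u)))" if f: "polytime s ?D f" for f
    unfolding den_def by (rule polytime_denominator[OF f])
  have "polytime s ?D dec"
    unfolding dec_def by (intro polytime_le polytime_mult val den polytime_prim polytime_id)
  moreover have val_eq: "real_of_int (val i (enc_ratvec y)) =
      real_of_int (den (enc_ratvec y)) * (real (m i) * sum_max_norm (a i / m i) (real_vec_of_rat y))" for i and y :: "rat ^ 'k::enum"
  proof -
    define d where "d = real_of_int (den (enc_ratvec y))"
    have d: "0 < d" unfolding d_def den_def using denominator_pos[of y] by simp
    have sc: "real_of_int (sc j (enc_ratvec y)) = d * \<bar>real_vec_of_rat y $ j\<bar>" for j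
      using d unfolding sc_def by (simp add: int_weight_enc_ratvec abs_mult d_def den_def)
    have "real_of_int (Max ((\<lambda>j. sc j (enc_ratvec y)) ` UNIV)) = Max ((\<lambda>j. d * \<bar>real_vec_of_rat y $ j\<bar>) ` UNIV)"
      by (subst real_Max_image) (auto simp: sc)
    also have "\<dots> = d * max_norm (real_vec_of_rat y)"
      unfolding max_norm_def using d
      by (subst mono_Max_commute[of "\<lambda>x. d * x"]) (auto simp: mono_def image_image)
    finally have M: "real_of_int (Max ((\<lambda>j. sc j (enc_ratvec y)) ` UNIV)) = d * max_norm (real_vec_of_rat y)" .
    have S: "real_of_int (\<Sum>j \<in> UNIV. sc j (enc_ratvec y)) = d * (\<Sum>j \<in> UNIV. \<bar>real_vec_of_rat y $ j\<bar>)"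
      by (simp only: of_int_sum sc sum_distrib_left)
    have "real_of_int (val i (enc_ratvec y)) = real (m i) * real_of_int (Max ((\<lambda>j. sc j (enc_ratvec y)) ` UNIV)) +
        real (a i) * real_of_int (\<Sum>j \<in> UNIV. sc j (enc_ratvec y))"
      by (simp add: val_def)
    also have "\<dots> = d * (real (m i) * sum_max_norm (a i / m i) (real_vec_of_rat y))"
      unfolding M S sum_max_norm_def using m1[of i] by (simp add: field_simps)
    finally show ?thesis by (simp add: d_def)
  qed
  moreover have "dec i (Cell (enc_ratvec y) (enc_ratvec z)) =
      Num (if sum_max_norm (a i / m i) (real_vec_of_rat y) \<le> sum_max_norm (a i / m i) (real_vec_of_rat z) then 1 else 0)"
    for i and y z :: "rat ^ 'k::enum"
  proof -
    define p where "p = real_of_int (den (enc_ratvec y))"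
    define q where "q = real_of_int (den (enc_ratvec z))"
    have pq: "0 < p" "0 < q" unfolding p_def q_def den_def using denominator_pos[of y] denominator_pos[of z] by simp_all
    have "val i (enc_ratvec y) * den (enc_ratvec z) \<le> val i (enc_ratvec z) * den (enc_ratvec y) \<longleftrightarrow>
      real_of_int (val i (enc_ratvec y)) * q \<le> real_of_int (val i (enc_ratvec z)) * p"
      unfolding p_def q_def by (simp flip: of_int_mult)
    also have "\<dots> \<longleftrightarrow> (p * q * real (m i)) * sum_max_norm (a i / m i) (real_vec_of_rat y) \<le>
        (p * q * real (m i)) * sum_max_norm (a i / m i) (real_vec_of_rat z)"
      unfolding val_eq p_def[symmetric] q_def[symmetric] by (simp only: mult_ac)
    also have "\<dots> \<longleftrightarrow> sum_max_norm (a i / m i) (real_vec_of_rat y) \<le> sum_max_norm (a i / m i) (real_vec_of_rat z)"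
      using pq m1[of i] by (intro mult_le_cancel_left_pos) auto
    finally show ?thesis by (simp add: dec_def)
  qed
  ultimately show ?thesis unfolding decides_def by blast
qed

text \<open>The selection step common to both problems: they differ only in where the point \<rho>
  comes from, the input or the approximate Pareto set itself.\<close>

lemma pareto_select:
  fixes P :: "'k::enum problem" and N :: "'i \<Rightarrow> real ^ 'k::enum \<Rightarrow> real"
    and W \<rho> :: "'k \<Rightarrow> 'i \<Rightarrow> data \<Rightarrow> int"
  assumes P: "multicriteria_problem P"
    and xs: "polytime s D (\<lambda>i v. enc_list (xs i (dfst v)))"
    and inst: "\<And>i v. v \<in> D i \<Longrightarrow> dfst v \<in> instances P"
    and feas: "\<And>i v. v \<in> D i \<Longrightarrow> set (xs i (dfst v)) \<subseteq> feasible P (dfst v)"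
    and ne: "\<And>i v. v \<in> D i \<Longrightarrow> xs i (dfst v) \<noteq> []"
    and dec: "decides s N dec"
    and W: "\<And>j. polytime s D (\<lambda>i v. Num (W j i v))" and \<rho>: "\<And>j. polytime s D (\<lambda>i v. Num (\<rho> j i v))"
  obtains b where "polytime s D b" "\<And>i v. v \<in> D i \<Longrightarrow> b i v \<in> set (xs i (dfst v))"
    "\<And>i v x. v \<in> D i \<Longrightarrow> x \<in> set (xs i (dfst v)) \<Longrightarrow>
      N i (\<chi> j. real_of_int (W j i v * (int (objective P (dfst v) (b i v) $ j) - \<rho> j i v))) \<le>
      N i (\<chi> j. real_of_int (W j i v * (int (objective P (dfst v) x $ j) - \<rho> j i v)))"
proof -
  obtain ev where ev: "polytime s (\<lambda>i. {Cell I x | I x. I \<in> instances P \<and> x \<in> feasible P I}) (\<lambda>i. ev)"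
    "\<And>I x. I \<in> instances P \<Longrightarrow> x \<in> feasible P I \<Longrightarrow> ev (Cell I x) = enc_natvec (objective P I x)"
    by (rule polytime_objective[OF P, of s]) blast
  define D1 where "D1 i = {Cell v x | v x. v \<in> D i \<and> x \<in> feasible P (dfst v)}" for i
  define D2 where "D2 i = {Cell v (Cell x y) | v x y. v \<in> D i \<and>
    x \<in> feasible P (dfst v) \<and> y \<in> feasible P (dfst v)}" for i
  define key where "key i v x = (\<chi> j. rat_of_int (W j i v * (int (objective P (dfst v) x $ j) - \<rho> j i v)))"
    for i v x
  \<comment> \<open>Computes the encoding of \<open>key\<close>. Its entries are integers, so the
    denominator 1 is correct without reducing a fraction.\<close>
  define vec where "vec i u = enc_list (map (\<lambda>j. Cell (Num (W j i (dfst u) *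
    (dint (component j (ev (Cell (dfst (dfst u)) (dsnd u)))) -
      \<rho> j i (dfst u)))) (Num 1)) (enum_class.enum :: 'k list))" for i u
  have vec: "polytime s D1 vec"
    unfolding vec_def
  proof (intro polytime_enc_map polytime_Cell polytime_mult polytime_diff polytime_dint polytime_dcomp polytime_const)
    fix j :: 'k
    have First: "polytime s D1 (\<lambda>i. dfst)" by (intro polytime_prim polytime_id)
    show "polytime s D1 (\<lambda>i v. Num (W j i (dfst v)))"
      by (rule polytime_comp[OF W[of j] First]) (auto simp: D1_def)
    show "polytime s D1 (\<lambda>i v. Num (\<rho> j i (dfst v)))"
      by (rule polytime_comp[OF \<rho>[of j] First]) (auto simp: D1_def)
    show "polytime s D1 (\<lambda>i v. ev (Cell (dfst (dfst v)) (dsnd v)))"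
      by (intro polytime_comp[OF ev(1)] polytime_Cell polytime_prim polytime_id) (auto simp: D1_def inst)
  qed
  have vec_key: "vec i (Cell v x) = enc_ratvec (key i v x)"
    if "v \<in> D i" "x \<in> feasible P (dfst v)" for i v x
    unfolding vec_def enc_ratvec_def key_def
    by (simp only: prim_val_simps ev(2)[OF inst[OF that(1)] that(2)] component_enc_natvec dint.simps
        vec_lambda_beta enc_rat_of_int)
  define le where "le i u = dec i (Cell (vec i (Cell (dfst u) (dfst (dsnd u))))
    (vec i (Cell (dfst u) (dsnd (dsnd u)))))" for i u
  have le: "polytime s D2 le"
    unfolding le_def
  proof (intro polytime_comp[OF conjunct1[OF dec[unfolded decides_def]]] polytime_comp[OF vec]
      polytime_Cell polytime_prim polytime_id)
    fix i u
    assume "u \<in> D2 i"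
    then obtain v x y where u: "u = Cell v (Cell x y)" "v \<in> D i"
      "x \<in> feasible P (dfst v)" "y \<in> feasible P (dfst v)" unfolding D2_def by blast
    then show "Cell (dfst u) (dfst (dsnd u)) \<in> D1 i"
      "Cell (dfst u) (dsnd (dsnd u)) \<in> D1 i" by (auto simp: D1_def)
    show "Cell (vec i (Cell (dfst u) (dfst (dsnd u))))
          (vec i (Cell (dfst u) (dsnd (dsnd u))))
         \<in> {Cell (enc_ratvec y) (enc_ratvec z) | (y :: rat ^ 'k::enum) (z :: rat ^ 'k::enum). True}"
      using u vec_key by auto
  qed
  have real_key: "real_vec_of_rat (key i v x) =
      (\<chi> j. real_of_int (W j i v * (int (objective P (dfst v) x $ j) - \<rho> j i v)))" for i v x
    by (simp add: vec_eq_iff key_def of_rat_mult of_rat_diff)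
  obtain b where b: "polytime s D b" "\<And>i v. v \<in> D i \<Longrightarrow> b i v \<in> set (xs i (dfst v))"
    "\<And>i v x. v \<in> D i \<Longrightarrow> x \<in> set (xs i (dfst v)) \<Longrightarrow>
       N i (real_vec_of_rat (key i v (b i v))) \<le> N i (real_vec_of_rat (key i v x))"
  proof (rule polytime_argmin[OF xs le, where key = "\<lambda>i v x. N i (real_vec_of_rat (key i v x))"])
    fix i v x y
    assume v: "v \<in> D i" and x: "x \<in> set (xs i (dfst v))" and y: "y \<in> set (xs i (dfst v))"
    then have f: "x \<in> feasible P (dfst v)" "y \<in> feasible P (dfst v)" using feas by blast+
    then show "Cell v (Cell x y) \<in> D2 i" using v by (auto simp: D2_def)
    show "le i (Cell v (Cell x y)) = Num (if N i (real_vec_of_rat (key i v x)) \<le> N i (real_vec_of_rat (key i v y)) then 1 else 0)"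
      using dec vec_key[OF v] f unfolding decides_def by (simp add: le_def)
  qed (use ne in auto)
  show thesis by (rule that[OF b(1,2)]) (use b(3) real_key in auto)
qed

lemma norm_int_weights:
  fixes w :: "rat ^ 'k::enum"
  assumes "is_norm N"
  shows "N (\<chi> j. real_of_int (int_weight j (enc_ratvec w) * (int (y $ j) - int (\<rho> $ j)))) =
    real_of_int (denominator TYPE('k) (enc_ratvec w)) *
    weighted N w (real_vec_of_nat y - real_vec_of_nat \<rho>)"
proof -
  let ?d = "real_of_int (denominator TYPE('k) (enc_ratvec w))"
  have "(\<chi> j. real_of_int (int_weight j (enc_ratvec w) * (int (y $ j) - int (\<rho> $ j)))) =
    ?d *\<^sub>R (\<chi> j. real_of_rat (w $ j) * (real_vec_of_nat y - real_vec_of_nat \<rho>) $ j)"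
    by (simp add: vec_eq_iff int_weight_enc_ratvec)
  moreover have "N (?d *\<^sub>R u) = ?d * N u" for u
    using assms denominator_pos[of w] unfolding is_norm_def by simp
  ultimately show ?thesis unfolding weighted_def by (simp only:)
qed

lemma approx_pareto_nonempty:
  assumes "finite Y" "Y \<noteq> {}" "approx_pareto_set \<alpha> Y Z"
  shows "Z \<noteq> {}"
proof -
  obtain y where "y \<in> pareto_set Y" using assms(1,2) pareto_set_below by blast
  then show ?thesis using assms(3) unfolding approx_pareto_set_def by blast
qed

text \<open>A minimizer of the reference objective need not be Pareto optimal, for instance when a
  weight is 0. By monotonicity a Pareto optimal vector below it is a minimizer as well, and that one
  is covered by \<open>Z\<close>.\<close>

lemma approx_pareto_covers_optimum:
  fixes N :: "real ^ 'k::finite \<Rightarrow> real"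
  assumes N: "is_norm N" "monotone_norm N" and w: "0 \<le> w" and Y: "finite Y" "Y \<noteq> {}"
    and r: "r \<le> ideal_point Y" and Z: "approx_pareto_set \<alpha> Y Z"
  obtains y z where "y \<in> Y" "z \<in> Z" "\<And>j. real (z $ j) \<le> \<alpha> * real (y $ j)"
    "ref_obj N r w y = Min (ref_obj N r w ` Y)"
proof -
  have "Min (ref_obj N r w ` Y) \<in> ref_obj N r w ` Y" using Y by (intro Min_in) auto
  then obtain y0 where y0: "y0 \<in> Y" "ref_obj N r w y0 = Min (ref_obj N r w ` Y)" by auto
  obtain y where y: "y \<in> pareto_set Y" "y \<le> y0" using pareto_set_below[OF Y(1) y0(1)] by blast
  have yY: "y \<in> Y" using y(1) by (simp add: pareto_set_def)
  have ry: "r \<le> y" using r ideal_point_le[OF Y(1) yY] by (rule order_trans)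
  have "ref_obj N r w y \<le> Min (ref_obj N r w ` Y)"
    using ref_obj_mono[OF N w ry y(2)] unfolding y0(2) .
  moreover have "Min (ref_obj N r w ` Y) \<le> ref_obj N r w y" using Y(1) yY by (intro Min_le) auto
  moreover obtain z where "z \<in> Z" "\<forall>j. real (z $ j) \<le> \<alpha> * real (y $ j)"
    using Z y(1) unfolding approx_pareto_set_def by blast
  ultimately show thesis using that[OF yY] by auto
qed

theorem rp_family_of_pareto_family:
  fixes P :: "'k::enum problem" and N :: "'i \<Rightarrow> real ^ 'k::enum \<Rightarrow> real"
  assumes P: "multicriteria_problem P" and pareto: "poly_family X s (\<lambda>i. pareto_algorithm P (\<alpha> i))"
    and \<alpha>: "\<And>i. i \<in> X \<Longrightarrow> 1 \<le> \<alpha> i"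
    and N: "\<And>i. i \<in> X \<Longrightarrow> is_norm (N i)" "\<And>i. i \<in> X \<Longrightarrow> monotone_norm (N i)" and dec: "decides s N dec"
  shows "poly_family X s (\<lambda>i. rp_algorithm P (N i) (\<alpha> i))"
    and "poly_family X s (\<lambda>i. cp_algorithm P (N i) (2 * \<alpha> i - 1))"
proof -
  obtain f where f: "polytime s (\<lambda>i. {I \<in> instances P. i \<in> X}) f"
    "\<forall>i \<in> X. \<forall>I \<in> instances P. \<exists>xs. f i I = enc_list xs \<and> set xs \<subseteq> feasible P I \<and>
       approx_pareto_set (\<alpha> i) (objvecs P I) (objective P I ` set xs)"
    using pareto unfolding pareto_algorithm_eq poly_family_solves_iff by blast
  then obtain xs where xs: "\<And>i I. i \<in> X \<Longrightarrow> I \<in> instances P \<Longrightarrow> f i I = enc_list (xs i I) \<and>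
      set (xs i I) \<subseteq> feasible P I \<and> approx_pareto_set (\<alpha> i) (objvecs P I) (objective P I ` set (xs i I))"
    by metis
  have ne: "xs i I \<noteq> []" if "i \<in> X" "I \<in> instances P" for i I
    using approx_pareto_nonempty[OF finite_objvecs[OF P that(2)]] xs[OF that] by fastforce
  have xs_D: "polytime s D (\<lambda>i v. enc_list (xs i (dfst v)))"
    if D: "\<And>i v. v \<in> D i \<Longrightarrow> i \<in> X \<and> dfst v \<in> instances P" for D
  proof -
    have "polytime s D (\<lambda>i v. f i (dfst v))"
      by (rule polytime_comp[OF f(1)]) (use D in \<open>auto intro: polytime_prim polytime_id\<close>)
    then show ?thesis by (rule polytime_cong) (use D xs in auto)
  qed
  show "poly_family X s (\<lambda>i. rp_algorithm P (N i) (\<alpha> i))"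
  proof -
    define D where "D i = {v \<in> rp_inputs P. i \<in> X}" for i
    have D: "i \<in> X \<and> dfst v \<in> instances P" if "v \<in> D i" for i v
      using that by (auto simp: D_def rp_inputs_def)
    define W where "W j i v = int_weight (j :: 'k) (dsnd (dsnd v))" for j and i :: 'i and v
    define \<rho> where "\<rho> j i v = dint (component (j :: 'k) (dfst (dsnd v)))" for j and i :: 'i and v
    have W_pt: "polytime s D (\<lambda>i v. Num (W j i v))" and \<rho>_pt: "polytime s D (\<lambda>i v. Num (\<rho> j i v))" for j
      unfolding W_def \<rho>_def by (intro polytime_int_weight polytime_dint polytime_dcomp polytime_prim polytime_id)+
    obtain b where b: "polytime s D b" "\<And>i v. v \<in> D i \<Longrightarrow> b i v \<in> set (xs i (dfst v))"
      "\<And>i v x. v \<in> D i \<Longrightarrow> x \<in> set (xs i (dfst v)) \<Longrightarrow>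
        N i (\<chi> j. real_of_int (W j i v * (int (objective P (dfst v) (b i v) $ j) - \<rho> j i v))) \<le>
        N i (\<chi> j. real_of_int (W j i v * (int (objective P (dfst v) x $ j) - \<rho> j i v)))"
    proof (rule pareto_select[where W = W and \<rho> = \<rho>, OF P xs_D _ _ _ dec W_pt \<rho>_pt])
      fix i v
      assume v: "v \<in> D i"
      show "i \<in> X \<and> dfst v \<in> instances P" "dfst v \<in> instances P" using D[OF v] by auto
      show "set (xs i (dfst v)) \<subseteq> feasible P (dfst v)" "xs i (dfst v) \<noteq> []"
        using D[OF v] xs ne by auto
    qed blast
    have "approx_solution P (N i) (\<alpha> i) I r w (b i (Cell I (Cell (enc_natvec r) (enc_ratvec w))))"
      if i: "i \<in> X" and I: "I \<in> instances P" and r: "r \<le> ideal_point (objvecs P I)" and w: "0 \<le> w" for i I r w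
    proof -
      let ?v = "Cell I (Cell (enc_natvec r) (enc_ratvec w))"
      note fin = finite_objvecs[OF P I]
      have v: "?v \<in> D i" using i I r w by (auto simp: D_def rp_inputs_def)
      define x where "x = b i ?v"
      have x: "x \<in> set (xs i I)" using b(2)[OF v] by (simp add: x_def)
      then have xf: "x \<in> feasible P I" using xs[OF i I] by blast
      obtain y z where yz: "y \<in> objvecs P I" "z \<in> objective P I ` set (xs i I)"
          "\<And>j. real (z $ j) \<le> \<alpha> i * real (y $ j)"
          "ref_obj (N i) r w y = Min (ref_obj (N i) r w ` objvecs P I)"
        using approx_pareto_covers_optimum[OF N[OF i] w fin r] xs[OF i I] by metis
      obtain x' where x': "x' \<in> set (xs i I)" "z = objective P I x'" using yz(2) by blast
      have zY: "z \<in> objvecs P I" using x' xs[OF i I] by (auto simp: objvecs_def)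
      have "N i (\<chi> j. real_of_int (int_weight j (enc_ratvec w) * (int (objective P I x $ j) - int (r $ j)))) \<le>
          N i (\<chi> j. real_of_int (int_weight j (enc_ratvec w) * (int (z $ j) - int (r $ j))))"
        using b(3)[OF v, of x'] x' unfolding W_def \<rho>_def by (simp only: prim_val_simps component_enc_natvec dint.simps x_def)
      then have best: "weighted (N i) w (real_vec_of_nat (objective P I x) - real_vec_of_nat r) \<le>
          weighted (N i) w (real_vec_of_nat z - real_vec_of_nat r)"
        unfolding norm_int_weights[OF N(1)[OF i]] using denominator_pos[of w] by (simp add: mult_le_cancel_left_pos)
      have "r \<le> z" "r \<le> y" using r ideal_point_le[OF fin(1)] zY yz(1) order_trans by blast+
      from rp_quality[OF N[OF i] w \<alpha>[OF i] this(1) yz(3) this(2) best]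
      show ?thesis using xf yz(4) unfolding approx_solution_def x_def by simp
    qed
    then have "\<forall>i \<in> X. \<forall>v \<in> rp_inputs P. \<forall>I r w. v = Cell I (Cell (enc_natvec r) (enc_ratvec w)) \<longrightarrow>
        approx_solution P (N i) (\<alpha> i) I r w (b i v)"
      unfolding rp_inputs_def by auto
    then show ?thesis
      unfolding rp_algorithm_eq poly_family_solves_iff using b(1) unfolding D_def by blast
  qed
  show "poly_family X s (\<lambda>i. cp_algorithm P (N i) (2 * \<alpha> i - 1))"
  proof -
    define D where "D i = {v \<in> cp_inputs P. i \<in> X}" for i
    have D: "i \<in> X \<and> dfst v \<in> instances P" if "v \<in> D i" for i v
      using that by (auto simp: D_def cp_inputs_def)
    obtain ev where ev: "polytime s (\<lambda>i. {Cell I x | I x. I \<in> instances P \<and> x \<in> feasible P I}) (\<lambda>i. ev)"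
      "\<And>I x. I \<in> instances P \<Longrightarrow> x \<in> feasible P I \<Longrightarrow> ev (Cell I x) = enc_natvec (objective P I x)"
      by (rule polytime_objective[OF P, of s]) blast
    \<comment> \<open>For each objective, a solution attaining its minimum over the approximate
      Pareto set; together these minima form the substitute for the ideal point.\<close>
    have "\<exists>c. polytime s D c \<and> (\<forall>i. \<forall>v \<in> D i. c i v \<in> set (xs i (dfst v)) \<and>
        (\<forall>x \<in> set (xs i (dfst v)).
          objective P (dfst v) (c i v) $ j \<le> objective P (dfst v) x $ j))" for j
    proof -
      define D2 where "D2 i = {Cell v (Cell x y) | v x y. v \<in> D i \<and>
        x \<in> feasible P (dfst v) \<and> y \<in> feasible P (dfst v)}" for i
      define le where "le i u = Num (if dint (component j (ev (Cell (dfst (dfst u)) (dfst (dsnd u)))))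
        \<le> dint (component j (ev (Cell (dfst (dfst u)) (dsnd (dsnd u))))) then 1 else 0)" for i :: 'i and u
      have le: "polytime s D2 le"
        unfolding le_def
        by (intro polytime_le polytime_dint polytime_dcomp polytime_comp[OF ev(1)] polytime_Cell polytime_prim polytime_id)
          (auto simp: D2_def D)
      obtain c where c: "polytime s D c" "\<And>i v. v \<in> D i \<Longrightarrow> c i v \<in> set (xs i (dfst v))"
        "\<And>i v x. v \<in> D i \<Longrightarrow> x \<in> set (xs i (dfst v)) \<Longrightarrow>
          real (objective P (dfst v) (c i v) $ j) \<le> real (objective P (dfst v) x $ j)"
      proof (rule polytime_argmin[OF xs_D le, where key = "\<lambda>i v x. real (objective P (dfst v) x $ j)"])
        fix i v
        assume v: "v \<in> D i"
        then show "i \<in> X \<and> dfst v \<in> instances P" by (rule D)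
        show "xs i (dfst v) \<noteq> []" using D[OF v] ne by blast
        fix x y
        assume "x \<in> set (xs i (dfst v))" "y \<in> set (xs i (dfst v))"
        then have f: "x \<in> feasible P (dfst v)" "y \<in> feasible P (dfst v)" using D[OF v] xs by blast+
        then show "Cell v (Cell x y) \<in> D2 i" using v by (auto simp: D2_def)
        show "le i (Cell v (Cell x y)) =
            Num (if real (objective P (dfst v) x $ j) \<le> real (objective P (dfst v) y $ j) then 1 else 0)"
          using f D[OF v] by (simp add: le_def ev(2))
      qed blast
      then show ?thesis by (intro exI[of _ c]) auto
    qed
    then have "\<exists>c. \<forall>j. polytime s D (c j) \<and> (\<forall>i. \<forall>v \<in> D i. c j i v \<in> set (xs i (dfst v)) \<and>
        (\<forall>x \<in> set (xs i (dfst v)).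
          objective P (dfst v) (c j i v) $ j \<le> objective P (dfst v) x $ j))"
      by (intro choice allI)
    then obtain c where "\<forall>j. polytime s D (c j) \<and> (\<forall>i. \<forall>v \<in> D i. c j i v \<in> set (xs i (dfst v)) \<and>
        (\<forall>x \<in> set (xs i (dfst v)).
          objective P (dfst v) (c j i v) $ j \<le> objective P (dfst v) x $ j))" ..
    then have c: "\<And>j. polytime s D (c j)"
      "\<And>i v j. v \<in> D i \<Longrightarrow> c j i v \<in> set (xs i (dfst v))"
      "\<And>i v j x. v \<in> D i \<Longrightarrow> x \<in> set (xs i (dfst v)) \<Longrightarrow>
          objective P (dfst v) (c j i v) $ j \<le> objective P (dfst v) x $ j" by blast+
    define W where "W j i v = int_weight (j :: 'k) (dsnd v)" for j and i :: 'i and v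
    define \<rho> where "\<rho> j i v = dint (component (j :: 'k) (ev (Cell (dfst v) (c j i v))))" for j and i :: 'i and v
    have W_pt: "polytime s D (\<lambda>i v. Num (W j i v))" for j
      unfolding W_def by (intro polytime_int_weight polytime_prim polytime_id)
    have \<rho>_pt: "polytime s D (\<lambda>i v. Num (\<rho> j i v))" for j
      unfolding \<rho>_def
    proof (intro polytime_dint polytime_dcomp, rule polytime_comp[OF ev(1)])
      show "polytime s D (\<lambda>i v. Cell (dfst v) (c j i v))"
        by (rule polytime_Cell[OF polytime_prim[OF polytime_id] c(1)])
      fix i v
      assume v: "v \<in> D i"
      have "c j i v \<in> feasible P (dfst v)" using c(2)[OF v] D[OF v] xs by blast
      then show "Cell (dfst v) (c j i v) \<in> {Cell I x | I x. I \<in> instances P \<and> x \<in> feasible P I}"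
        using D[OF v] by blast
    qed
    obtain b where b: "polytime s D b" "\<And>i v. v \<in> D i \<Longrightarrow> b i v \<in> set (xs i (dfst v))"
      "\<And>i v x. v \<in> D i \<Longrightarrow> x \<in> set (xs i (dfst v)) \<Longrightarrow>
        N i (\<chi> j. real_of_int (W j i v * (int (objective P (dfst v) (b i v) $ j) - \<rho> j i v))) \<le>
        N i (\<chi> j. real_of_int (W j i v * (int (objective P (dfst v) x $ j) - \<rho> j i v)))"
    proof (rule pareto_select[where W = W and \<rho> = \<rho>, OF P xs_D _ _ _ dec W_pt \<rho>_pt])
      fix i v
      assume v: "v \<in> D i"
      show "i \<in> X \<and> dfst v \<in> instances P" "dfst v \<in> instances P" using D[OF v] by auto
      show "set (xs i (dfst v)) \<subseteq> feasible P (dfst v)" "xs i (dfst v) \<noteq> []"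
        using D[OF v] xs ne by auto
    qed blast
    have "approx_solution P (N i) (2 * \<alpha> i - 1) I (ideal_point (objvecs P I)) w (b i (Cell I (enc_ratvec w)))"
      if i: "i \<in> X" and I: "I \<in> instances P" and w: "0 \<le> w" for i I w
    proof -
      let ?v = "Cell I (enc_ratvec w)" and ?r = "ideal_point (objvecs P I)"
      note fin = finite_objvecs[OF P I]
      have v: "?v \<in> D i" using i I w by (auto simp: D_def cp_inputs_def)
      define x where "x = b i ?v"
      have x: "x \<in> set (xs i I)" using b(2)[OF v] by (simp add: x_def)
      then have xf: "x \<in> feasible P I" using xs[OF i I] by blast
      define q :: "nat ^ 'k::enum" where "q = (\<chi> j. objective P I (c j i ?v) $ j)"
      have c_mem: "c j i ?v \<in> set (xs i I)" for j using c(2)[OF v] by simp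
      have q_le: "q \<le> objective P I x'" if "x' \<in> set (xs i I)" for x'
        using c(3)[OF v, of x'] that by (simp add: q_def less_eq_vec_def)
      have \<rho>q: "\<rho> j i ?v = int (q $ j)" for j
        using c_mem[of j] xs[OF i I] I by (auto simp: \<rho>_def q_def ev(2) subset_iff)
      have rq: "?r \<le> q"
        unfolding less_eq_vec_def
      proof
        fix j
        have "objective P I (c j i ?v) \<in> objvecs P I" using c_mem[of j] xs[OF i I] by (auto simp: objvecs_def)
        from ideal_point_le[OF fin(1) this] show "?r $ j \<le> q $ j" by (simp add: q_def less_eq_vec_def)
      qed
      have q_approx: "real (q $ j) \<le> \<alpha> i * real (?r $ j)" for j
      proof -
        obtain y where y: "y \<in> pareto_set (objvecs P I)" "y $ j = ?r $ j" using ideal_point_attained[OF fin] by blast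
        then obtain x' where x': "x' \<in> set (xs i I)" "real (objective P I x' $ j) \<le> \<alpha> i * real (y $ j)"
          using xs[OF i I] unfolding approx_pareto_set_def by blast
        have "q $ j \<le> objective P I x' $ j" using q_le[OF x'(1)] by (simp add: less_eq_vec_def)
        then show ?thesis using x'(2) y(2) by simp
      qed
      obtain y z where yz: "y \<in> objvecs P I" "z \<in> objective P I ` set (xs i I)"
          "\<And>j. real (z $ j) \<le> \<alpha> i * real (y $ j)"
          "ref_obj (N i) ?r w y = Min (ref_obj (N i) ?r w ` objvecs P I)"
        using approx_pareto_covers_optimum[OF N[OF i] w fin order_refl] xs[OF i I] by metis
      obtain x' where x': "x' \<in> set (xs i I)" "z = objective P I x'" using yz(2) by blast
      have "N i (\<chi> j. real_of_int (int_weight j (enc_ratvec w) * (int (objective P I x $ j) - int (q $ j)))) \<le>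
          N i (\<chi> j. real_of_int (int_weight j (enc_ratvec w) * (int (z $ j) - int (q $ j))))"
        using b(3)[OF v, of x'] x' unfolding W_def \<rho>q by (simp only: prim_val_simps x_def)
      then have best: "weighted (N i) w (real_vec_of_nat (objective P I x) - real_vec_of_nat q) \<le>
          weighted (N i) w (real_vec_of_nat z - real_vec_of_nat q)"
        unfolding norm_int_weights[OF N(1)[OF i]] using denominator_pos[of w] by (simp add: mult_le_cancel_left_pos)
      have "q \<le> z" using q_le x' by simp
      from cp_quality[OF N[OF i] w \<alpha>[OF i] rq this q_le[OF x] q_approx yz(3) ideal_point_le[OF fin(1) yz(1)] best]
      show ?thesis using xf yz(4) unfolding approx_solution_def x_def by simp
    qed
    then have "\<forall>i \<in> X. \<forall>v \<in> cp_inputs P. \<forall>I w. v = Cell I (enc_ratvec w) \<longrightarrow>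
        approx_solution P (N i) (2 * \<alpha> i - 1) I (ideal_point (objvecs P I)) w (b i v)"
      unfolding cp_inputs_def by auto
    then show ?thesis
      unfolding cp_algorithm_eq poly_family_solves_iff using b(1) unfolding D_def by blast
  qed
qed

section \<open>The equivalences\<close>

lemma solves_mono:
  "solves D R T A \<Longrightarrow> (\<And>n. T n \<le> T' n) \<Longrightarrow> (\<And>v x. v \<in> D \<Longrightarrow> R v x \<Longrightarrow> R' v x) \<Longrightarrow> solves D R' T' A"
  unfolding solves_def by (meson order_trans)

definition time_monotone :: "(real \<Rightarrow> (nat \<Rightarrow> real) \<Rightarrow> prog \<Rightarrow> bool) \<Rightarrow> bool" where
  "time_monotone S \<longleftrightarrow> (\<forall>\<alpha> T T' A. S \<alpha> T A \<longrightarrow> (\<forall>n. T n \<le> T' n) \<longrightarrow> S \<alpha> T' A)"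

lemma time_monotoneD:
  "time_monotone S \<Longrightarrow> S \<alpha> T A \<Longrightarrow> (\<And>n. T n \<le> T' n) \<Longrightarrow> S \<alpha> T' A"
  unfolding time_monotone_def by simp

lemma time_monotone_pareto: "time_monotone (pareto_algorithm P)"
  unfolding time_monotone_def pareto_algorithm_eq
  by (intro allI impI) (erule solves_mono, auto)

text \<open>The one property that the two problems share in what follows: a program may be kept
  under another norm and guarantee if all its acceptable answers remain acceptable. The reference
  point is arbitrary, which includes the ideal point.\<close>

definition transferable :: "'k::enum problem \<Rightarrow>
    ((real ^ 'k::enum \<Rightarrow> real) \<Rightarrow> real \<Rightarrow> (nat \<Rightarrow> real) \<Rightarrow> prog \<Rightarrow> bool) \<Rightarrow> bool" where
  "transferable P S \<longleftrightarrow> (\<forall>N \<alpha> T A N' \<alpha>' T'. S N \<alpha> T A \<longrightarrow> (\<forall>n. T n \<le> T' n) \<longrightarrow>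
     (\<forall>I \<in> instances P. \<forall>r w x. 0 \<le> w \<longrightarrow> approx_solution P N \<alpha> I r w x \<longrightarrow> approx_solution P N' \<alpha>' I r w x) \<longrightarrow>
     S N' \<alpha>' T' A)"

lemma transferableD:
  assumes "transferable P S" "S N \<alpha> T A" "\<And>n. T n \<le> T' n"
    "\<And>I r w x. I \<in> instances P \<Longrightarrow> 0 \<le> w \<Longrightarrow> approx_solution P N \<alpha> I r w x \<Longrightarrow> approx_solution P N' \<alpha>' I r w x"
  shows "S N' \<alpha>' T' A"
  using assms(1)[unfolded transferable_def, rule_format, OF assms(2-4)] .

lemma transferable_rp:
  fixes P :: "'k::enum problem"
  shows "transferable P (rp_algorithm P)"
  unfolding transferable_def
proof (intro allI impI)
  fix N \<alpha> T A N' \<alpha>' T'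
  assume S: "rp_algorithm P N \<alpha> T A" and T: "\<forall>n. T n \<le> T' n" and R: "\<forall>I \<in> instances P. \<forall>r w x. 0 \<le> w \<longrightarrow>
    approx_solution P N \<alpha> I r w x \<longrightarrow> approx_solution P N' \<alpha>' I r w x"
  show "rp_algorithm P N' \<alpha>' T' A"
    unfolding rp_algorithm_eq
  proof (rule solves_mono[OF S[unfolded rp_algorithm_eq]])
    fix v x
    assume "v \<in> rp_inputs P" and v: "\<forall>I r w. v = Cell I (Cell (enc_natvec r) (enc_ratvec w)) \<longrightarrow>
      approx_solution P N \<alpha> I r w x"
    then obtain I and r :: "nat ^ 'k::enum" and w :: "rat ^ 'k::enum" where "v = Cell I (Cell (enc_natvec r) (enc_ratvec w))" "I \<in> instances P" "0 \<le> w"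
      unfolding rp_inputs_def by blast
    with v R show "\<forall>I r w. v = Cell I (Cell (enc_natvec r) (enc_ratvec w)) \<longrightarrow> approx_solution P N' \<alpha>' I r w x"
      by auto
  qed (use T in blast)
qed

lemma transferable_cp:
  fixes P :: "'k::enum problem"
  shows "transferable P (cp_algorithm P)"
  unfolding transferable_def
proof (intro allI impI)
  fix N \<alpha> T A N' \<alpha>' T'
  assume S: "cp_algorithm P N \<alpha> T A" and T: "\<forall>n. T n \<le> T' n" and R: "\<forall>I \<in> instances P. \<forall>r w x. 0 \<le> w \<longrightarrow>
    approx_solution P N \<alpha> I r w x \<longrightarrow> approx_solution P N' \<alpha>' I r w x"
  show "cp_algorithm P N' \<alpha>' T' A"
    unfolding cp_algorithm_eq
  proof (rule solves_mono[OF S[unfolded cp_algorithm_eq]])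
    fix v x
    assume "v \<in> cp_inputs P" and v: "\<forall>I w. v = Cell I (enc_ratvec w) \<longrightarrow>
      approx_solution P N \<alpha> I (ideal_point (objvecs P I)) w x"
    then obtain I and w :: "rat ^ 'k::enum" where "v = Cell I (enc_ratvec w)" "I \<in> instances P" "0 \<le> w"
      unfolding cp_inputs_def by blast
    with v R show "\<forall>I w. v = Cell I (enc_ratvec w) \<longrightarrow>
        approx_solution P N' \<alpha>' I (ideal_point (objvecs P I)) w x"
      by auto
  qed (use T in blast)
qed

lemma time_monotone_transferable: "transferable P S \<Longrightarrow> time_monotone (S N)"
  unfolding time_monotone_def by (intro allI impI) (erule transferableD, auto)

lemma ref_obj_Min_attained:
  assumes "finite Y" "Y \<noteq> {}"
  obtains y where "y \<in> Y" "Min (ref_obj N r w ` Y) = ref_obj N r w y"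
proof -
  have "Min (ref_obj N r w ` Y) \<in> ref_obj N r w ` Y" using assms by (intro Min_in) auto
  then show thesis using that by blast
qed

text \<open>The factor \<open>c\<close> is lost only once in either direction, since in one of the
  two comparisons, at the answer or at the optimum, \<open>N1 \<le> N2\<close> is free.\<close>

lemma approx_solution_transfer:
  assumes P: "multicriteria_problem P" and I: "I \<in> instances P"
    and nonneg: "\<And>y. 0 \<le> N1 y" and le: "\<And>y. N1 y \<le> N2 y" "\<And>y. N2 y \<le> c * N1 y"
    and c: "0 \<le> c" "0 \<le> \<alpha>" "c * \<alpha> \<le> \<beta>"
  shows "approx_solution P N1 \<alpha> I r w x \<Longrightarrow> approx_solution P N2 \<beta> I r w x"
    and "approx_solution P N2 \<alpha> I r w x \<Longrightarrow> approx_solution P N1 \<beta> I r w x"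
proof -
  let ?Y = "objvecs P I"
  note fin = finite_objvecs[OF P I]
  note tr = ref_obj_transfer[of N1 N2, OF le]
  obtain y1 where y1: "y1 \<in> ?Y" "Min (ref_obj N1 r w ` ?Y) = ref_obj N1 r w y1" using ref_obj_Min_attained[OF fin] .
  obtain y2 where y2: "y2 \<in> ?Y" "Min (ref_obj N2 r w ` ?Y) = ref_obj N2 r w y2" using ref_obj_Min_attained[OF fin] .
  have min: "ref_obj N1 r w y1 \<le> ref_obj N1 r w y2" "ref_obj N2 r w y2 \<le> ref_obj N2 r w y1"
    using fin y1(1) y2(1) unfolding y1(2)[symmetric] y2(2)[symmetric] by (intro Min_le; simp)+
  have pos: "0 \<le> ref_obj N1 r w y" for y unfolding ref_obj_def weighted_def by (intro add_nonneg_nonneg nonneg)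
  show "approx_solution P N2 \<beta> I r w x" if a: "approx_solution P N1 \<alpha> I r w x"
  proof -
    let ?y = "objective P I x"
    have "ref_obj N2 r w ?y \<le> c * ref_obj N1 r w ?y" by (rule tr)
    also have "\<dots> \<le> c * (\<alpha> * ref_obj N1 r w y1)"
      using a c(1) y1(2) unfolding approx_solution_def by (intro mult_left_mono) auto
    also have "\<dots> = (c * \<alpha>) * ref_obj N1 r w y1" by simp
    also have "\<dots> \<le> \<beta> * ref_obj N1 r w y1" using c(3) pos by (intro mult_right_mono)
    also have "\<dots> \<le> \<beta> * ref_obj N2 r w y2"
      using min(1) tr(1)[of r w y2] mult_nonneg_nonneg[OF c(1,2)] c(3) by (intro mult_left_mono) auto
    finally show ?thesis using a y2(2) unfolding approx_solution_def by simp
  qed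
  show "approx_solution P N1 \<beta> I r w x" if a: "approx_solution P N2 \<alpha> I r w x"
  proof -
    let ?y = "objective P I x"
    have "ref_obj N1 r w ?y \<le> ref_obj N2 r w ?y" by (rule tr)
    also have "\<dots> \<le> \<alpha> * ref_obj N2 r w y2" using a y2(2) unfolding approx_solution_def by simp
    also have "\<dots> \<le> \<alpha> * (c * ref_obj N1 r w y1)"
      using min(2) tr(2)[of r w y1] c(2) by (intro mult_left_mono) auto
    also have "\<dots> = (c * \<alpha>) * ref_obj N1 r w y1" by simp
    also have "\<dots> \<le> \<beta> * ref_obj N1 r w y1" using c(3) pos by (intro mult_right_mono)
    finally show ?thesis using a y1(2) unfolding approx_solution_def by simp
  qed
qed

lemma transfer_algorithm:
  assumes P: "multicriteria_problem P" and S: "transferable P S"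
    and nonneg: "\<And>y. 0 \<le> N1 y" and le: "\<And>y. N1 y \<le> N2 y" "\<And>y. N2 y \<le> c * N1 y"
    and c: "0 \<le> c" "0 \<le> \<alpha>" "c * \<alpha> \<le> \<beta>" and T: "\<And>n. T n \<le> T' n"
  shows "S N1 \<alpha> T A \<Longrightarrow> S N2 \<beta> T' A" and "S N2 \<alpha> T A \<Longrightarrow> S N1 \<beta> T' A"
proof -
  note tr = approx_solution_transfer[of P _ N1 N2 c \<alpha> \<beta>, OF P _ nonneg le c]
  show "S N1 \<alpha> T A \<Longrightarrow> S N2 \<beta> T' A" by (erule transferableD[OF S _ T]) (rule tr(1))
  show "S N2 \<alpha> T A \<Longrightarrow> S N1 \<beta> T' A" by (erule transferableD[OF S _ T]) (rule tr(2))
qed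

lemma has_constant_factor_iff:
  assumes "time_monotone S"
  shows "has_constant_factor S \<longleftrightarrow> (\<exists>\<alpha> > 1. poly_family (UNIV :: unit set) (\<lambda>i. 0) (\<lambda>i. S \<alpha>))"
proof
  assume "has_constant_factor S"
  then obtain \<alpha> C d A where \<alpha>: "1 < \<alpha>" and A: "S \<alpha> (\<lambda>n. C * (1 + real n) ^ d) A"
    unfolding has_constant_factor_def by blast
  obtain e where "\<And>n s x. 0 \<le> x \<Longrightarrow> x \<le> real s \<Longrightarrow> C * (1 + real n + x) ^ d \<le> real ((2 + s + n) ^ e)"
    using poly_le_power by blast
  from this[of 0 0] have "\<And>n. C * (1 + real n) ^ d \<le> real ((2 + 0 + n) ^ e)" by simp
  then have "S \<alpha> (\<lambda>n. real ((2 + 0 + n) ^ e)) A" by (rule time_monotoneD[OF assms A])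
  then show "\<exists>\<alpha> > 1. poly_family (UNIV :: unit set) (\<lambda>i. 0) (\<lambda>i. S \<alpha>)"
    using \<alpha> unfolding poly_family_def by blast
next
  assume "\<exists>\<alpha> > 1. poly_family (UNIV :: unit set) (\<lambda>i. 0) (\<lambda>i. S \<alpha>)"
  then obtain \<alpha> d A where \<alpha>: "1 < \<alpha>" and A: "S \<alpha> (\<lambda>n. real ((2 + 0 + n) ^ d)) A"
    unfolding poly_family_def by blast
  have "real ((2 + 0 + n) ^ d) \<le> 2 ^ d * (1 + real n) ^ d" for n
  proof -
    have "real ((2 + 0 + n) ^ d) \<le> (2 * (1 + real n)) ^ d" by (simp add: power_mono)
    then show ?thesis unfolding power_mult_distrib .
  qed
  then have "S \<alpha> (\<lambda>n. 2 ^ d * (1 + real n) ^ d) A" by (rule time_monotoneD[OF assms A])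
  then show "has_constant_factor S" using \<alpha> unfolding has_constant_factor_def by blast
qed

definition inverse_ceiling :: "real \<Rightarrow> nat" where
  "inverse_ceiling \<epsilon> = nat \<lceil>1 / \<epsilon>\<rceil>"

lemma inverse_ceiling_bounds:
  assumes "0 < \<epsilon>" shows "1 / \<epsilon> \<le> inverse_ceiling \<epsilon>" "inverse_ceiling \<epsilon> \<le> 1 + 1 / \<epsilon>"
proof -
  have "0 < 1 / \<epsilon>" using assms by simp
  then show "1 / \<epsilon> \<le> inverse_ceiling \<epsilon>" "inverse_ceiling \<epsilon> \<le> 1 + 1 / \<epsilon>"
    unfolding inverse_ceiling_def by linarith+
qed

lemma inverse_ceiling_eq: "1 / \<epsilon> = real n \<Longrightarrow> inverse_ceiling \<epsilon> = n"
  by (simp only: inverse_ceiling_def ceiling_of_nat nat_int)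

lemma inverse_ceiling_time_le:
  assumes "0 < \<epsilon>" "0 \<le> l"
  shows "real ((2 + inverse_ceiling \<epsilon> + n) ^ d) \<le> 3 ^ d * (1 + real n + 1 / \<epsilon> + l) ^ d"
proof -
  have "2 + \<sigma> + n \<le> 3 * (1 + n + x + l)" if "\<sigma> \<le> 1 + x" "0 \<le> x" "0 \<le> n" for \<sigma> n x :: real
    using that assms(2) by (simp add: distrib_left)
  from this[OF inverse_ceiling_bounds(2)[OF assms(1)], of "real n"]
  have "real (2 + inverse_ceiling \<epsilon> + n) \<le> 3 * (1 + real n + 1 / \<epsilon> + l)" using assms(1) by simp
  then have "real (2 + inverse_ceiling \<epsilon> + n) ^ d \<le> (3 * (1 + real n + 1 / \<epsilon> + l)) ^ d"
    by (intro power_mono) auto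
  then show ?thesis unfolding power_mult_distrib of_nat_power .
qed

lemma inverse_Suc_inverse_ceiling_le:
  assumes "0 < \<epsilon>" shows "1 / (1 + real (inverse_ceiling \<epsilon>)) \<le> \<epsilon>"
proof -
  have "\<epsilon> * (1 / \<epsilon>) \<le> \<epsilon> * (1 + real (inverse_ceiling \<epsilon>))"
    using inverse_ceiling_bounds(1)[OF assms] assms by (intro mult_left_mono) linarith+
  moreover have "\<epsilon> * (1 / \<epsilon>) = 1" using assms by simp
  moreover have "0 < 1 + real (inverse_ceiling \<epsilon>)" by (simp add: add_pos_nonneg)
  ultimately show ?thesis by (simp only: pos_divide_le_eq)
qed

lemma has_fptas_iff:
  assumes "time_monotone S"
  shows "has_fptas S \<longleftrightarrow> poly_family {0<..} inverse_ceiling (\<lambda>\<epsilon>. S (1 + \<epsilon>))"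
proof
  assume "has_fptas S"
  then obtain C d where A: "\<forall>\<epsilon> > 0. \<exists>A. S (1 + \<epsilon>) (\<lambda>n. C * (1 + real n + 1 / \<epsilon>) ^ d) A"
    unfolding has_fptas_def by blast
  obtain e where e: "\<And>n s x. 0 \<le> x \<Longrightarrow> x \<le> real s \<Longrightarrow> C * (1 + real n + x) ^ d \<le> real ((2 + s + n) ^ e)"
    using poly_le_power by blast
  have "\<exists>A. S (1 + \<epsilon>) (\<lambda>n. real ((2 + inverse_ceiling \<epsilon> + n) ^ e)) A" if "0 < \<epsilon>" for \<epsilon>
  proof -
    obtain A where "S (1 + \<epsilon>) (\<lambda>n. C * (1 + real n + 1 / \<epsilon>) ^ d) A" using A \<open>0 < \<epsilon>\<close> by blast
    moreover have "C * (1 + real n + 1 / \<epsilon>) ^ d \<le> real ((2 + inverse_ceiling \<epsilon> + n) ^ e)" for n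
      using inverse_ceiling_bounds(1)[OF that] that by (intro e) auto
    ultimately show ?thesis by (intro exI) (rule time_monotoneD[OF assms])
  qed
  then show "poly_family {0<..} inverse_ceiling (\<lambda>\<epsilon>. S (1 + \<epsilon>))" unfolding poly_family_def by blast
next
  assume "poly_family {0<..} inverse_ceiling (\<lambda>\<epsilon>. S (1 + \<epsilon>))"
  then obtain d where d: "\<forall>\<epsilon> > 0. \<exists>A. S (1 + \<epsilon>) (\<lambda>n. real ((2 + inverse_ceiling \<epsilon> + n) ^ d)) A"
    unfolding poly_family_def by auto
  have "\<exists>A. S (1 + \<epsilon>) (\<lambda>n. 3 ^ d * (1 + real n + 1 / \<epsilon>) ^ d) A" if \<epsilon>: "0 < \<epsilon>" for \<epsilon>
  proof -
    obtain A where "S (1 + \<epsilon>) (\<lambda>n. real ((2 + inverse_ceiling \<epsilon> + n) ^ d)) A" using d \<epsilon> by blast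
    moreover have "real ((2 + inverse_ceiling \<epsilon> + n) ^ d) \<le> 3 ^ d * (1 + real n + 1 / \<epsilon>) ^ d" for n
      using inverse_ceiling_time_le[OF \<epsilon> order_refl, of n d] by simp
    ultimately show ?thesis by (intro exI) (rule time_monotoneD[OF assms])
  qed
  then show "has_fptas S" unfolding has_fptas_def by blast
qed

text \<open>Allows an FPTAS to be called at a finer precision \<open>h j\<close>, whose size
  parameter may be polynomially larger. With \<open>b = 2 + s' j + n\<close>, the new base satisfies
  \<open>2 + s (h j) + n \<le> 2 * b ^ (e + 1) \<le> b ^ (e + 2)\<close>.\<close>

lemma poly_family_reindex:
  assumes "poly_family X s Q" and h: "\<And>j. j \<in> Y \<Longrightarrow> h j \<in> X" and s: "\<And>j. j \<in> Y \<Longrightarrow> s (h j) \<le> (2 + s' j) ^ e"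
    and Q: "\<And>j T T' A. j \<in> Y \<Longrightarrow> Q (h j) T A \<Longrightarrow> (\<And>n. T n \<le> T' n) \<Longrightarrow> Q' j T' A"
  shows "poly_family Y s' Q'"
proof -
  obtain d where d: "\<And>i. i \<in> X \<Longrightarrow> \<exists>A. Q i (\<lambda>n. real ((2 + s i + n) ^ d)) A"
    using assms(1) unfolding poly_family_def by blast
  have "\<exists>A. Q' j (\<lambda>n. real ((2 + s' j + n) ^ ((e + 2) * d))) A" if j: "j \<in> Y" for j
  proof -
    obtain A where A: "Q (h j) (\<lambda>n. real ((2 + s (h j) + n) ^ d)) A" using d h j by blast
    have "(2 + s (h j) + n) ^ d \<le> (2 + s' j + n) ^ ((e + 2) * d)" for n
    proof -
      define b where "b = 2 + s' j + n"
      have b: "2 \<le> b" by (simp add: b_def)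
      have "(2 + s' j) ^ e \<le> b ^ e" by (intro power_mono) (auto simp: b_def)
      moreover have "b ^ e \<le> b ^ (e + 1)" "b ^ 1 \<le> b ^ (e + 1)" using b by (intro power_increasing; simp)+
      ultimately have "2 + s (h j) + n \<le> 2 * b ^ (e + 1)" using s[OF j] by (simp add: b_def)
      also have "\<dots> \<le> b * b ^ (e + 1)" using b by (intro mult_right_mono) auto
      finally have "2 + s (h j) + n \<le> b ^ (e + 2)" by simp
      then show ?thesis unfolding b_def[symmetric] power_mult by (rule power_mono) simp
    qed
    then show ?thesis using Q[OF j A, of "\<lambda>n. real ((2 + s' j + n) ^ ((e + 2) * d))"] of_nat_mono by blast
  qed
  then show ?thesis unfolding poly_family_def by blast
qed

section \<open>Pareto sets from algorithms for the maximum norm\<close>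

lemma pareto_family_of_max_norm:
  fixes P :: "'k::enum problem" and \<alpha> \<gamma> :: "'i \<Rightarrow> real" and c :: real
  assumes P: "multicriteria_problem P"
    and alg: "poly_family X s (\<lambda>i. rp_algorithm P max_norm (\<alpha> i)) \<or>
      poly_family X s (\<lambda>i. cp_algorithm P max_norm (\<alpha> i))"
    and m: "poly_bounded s (\<lambda>i. UNIV) (\<lambda>i v. m i)" "\<And>i. 1 \<le> m i"
    and \<alpha>: "\<And>i. i \<in> X \<Longrightarrow> 1 \<le> \<alpha> i \<and> \<alpha> i \<le> c"
    and \<gamma>: "\<And>i. i \<in> X \<Longrightarrow> (\<alpha> i + m i * (\<alpha> i - 1)) * (1 + 1 / m i) \<le> \<gamma> i"
      "\<And>i. i \<in> X \<Longrightarrow> 1 + (\<alpha> i + m i * (\<alpha> i - 1)) * (1 + 1 / m i) / m i \<le> \<gamma> i"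
  shows "poly_family X s (\<lambda>i. pareto_algorithm P (\<gamma> i))"
  using alg
proof
  assume "poly_family X s (\<lambda>i. rp_algorithm P max_norm (\<alpha> i))"
  then obtain f where f: "polytime s (\<lambda>i. {v \<in> rp_inputs P. i \<in> X}) f"
    "\<forall>i \<in> X. \<forall>v \<in> rp_inputs P. \<forall>I r w. v = Cell I (Cell (enc_natvec r) (enc_ratvec w)) \<longrightarrow>
       approx_solution P max_norm (\<alpha> i) I r w (f i v)"
    unfolding rp_algorithm_eq poly_family_solves_iff by blast
  define z :: "nat ^ 'k::enum" where "z = 0"
  have z: "z \<le> y" for y by (simp add: z_def less_eq_vec_def)
  define g where "g i v = f i (Cell (dfst v) (Cell (enc_natvec z) (dsnd v)))" for i v
  have "polytime s (\<lambda>i. {v \<in> cp_inputs P. i \<in> X}) g"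
    unfolding g_def
    by (intro polytime_comp[OF f(1)] polytime_Cell polytime_prim polytime_id polytime_const)
      (auto simp: cp_inputs_def rp_inputs_def z)
  moreover have "approx_solution P max_norm (\<alpha> i) I z w (g i (Cell I (enc_ratvec w)))"
    if i: "i \<in> X" and I: "I \<in> instances P" and w: "0 \<le> w" for i I w
  proof -
    have "Cell I (Cell (enc_natvec z) (enc_ratvec w)) \<in> rp_inputs P"
      unfolding rp_inputs_def using I w z by blast
    then show ?thesis using f(2) i by (simp add: g_def)
  qed
  ultimately show ?thesis
    by (rule pareto_family_of_max_norm_oracle[where r = "\<lambda>I. z", OF P _ z _ m \<alpha> \<gamma>])
next
  assume "poly_family X s (\<lambda>i. cp_algorithm P max_norm (\<alpha> i))"
  then obtain f where f: "polytime s (\<lambda>i. {v \<in> cp_inputs P. i \<in> X}) f"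
    "\<forall>i \<in> X. \<forall>v \<in> cp_inputs P. \<forall>I w. v = Cell I (enc_ratvec w) \<longrightarrow>
       approx_solution P max_norm (\<alpha> i) I (ideal_point (objvecs P I)) w (f i v)"
    unfolding cp_algorithm_eq poly_family_solves_iff by blast
  have "approx_solution P max_norm (\<alpha> i) I (ideal_point (objvecs P I)) w (f i (Cell I (enc_ratvec w)))"
    if "i \<in> X" "I \<in> instances P" "0 \<le> w" for i I w
    using f(2) that by (auto simp: cp_inputs_def)
  then show ?thesis
    by (rule pareto_family_of_max_norm_oracle[where r = "\<lambda>I. ideal_point (objvecs P I)",
          OF P f(1) order_refl _ m \<alpha> \<gamma>])
qed

lemma has_constant_factor_pareto_of_max_norm:
  assumes P: "multicriteria_problem P"
    and "has_constant_factor (rp_algorithm P max_norm) \<or> has_constant_factor (cp_algorithm P max_norm)"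
  shows "has_constant_factor (pareto_algorithm P)"
proof -
  obtain \<alpha> where \<alpha>: "1 < \<alpha>" and "poly_family (UNIV :: unit set) (\<lambda>i. 0) (\<lambda>i. rp_algorithm P max_norm \<alpha>) \<or>
      poly_family (UNIV :: unit set) (\<lambda>i. 0) (\<lambda>i. cp_algorithm P max_norm \<alpha>)"
    using assms(2) has_constant_factor_iff[OF time_monotone_transferable[OF transferable_rp[of P]]]
      has_constant_factor_iff[OF time_monotone_transferable[OF transferable_cp[of P]]] by blast
  \<comment> \<open>For \<open>m = 1\<close> the quantity \<kappa> is
    \<open>2 * (2 * \<alpha> - 1)\<close>, and both \<kappa> and \<open>1 + \<kappa>\<close> are
    below \<open>4 * \<alpha>\<close>.\<close>
  then have "poly_family (UNIV :: unit set) (\<lambda>i. 0) (\<lambda>i. pareto_algorithm P (4 * \<alpha>))"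
    by (intro pareto_family_of_max_norm[OF P, where m = "\<lambda>i. 1" and c = \<alpha>] poly_bounded_const) auto
  then show ?thesis
    unfolding has_constant_factor_iff[OF time_monotone_pareto] using \<alpha> by (intro exI[of _ "4 * \<alpha>"]) auto
qed

text \<open>The term \<open>m * (\<alpha> - 1)\<close> in \<kappa> forces the oracle's precision
  \<delta> to be of smaller order than \<open>1 / m\<close>. With \<open>t = 1 / m\<close> and
  \<open>\<delta> = t * t\<close> one gets
  \<open>\<kappa> = (1 + t * t + t) * (1 + t) \<le> 1 + 5 * t\<close>, and
  \<open>\<kappa> / m \<le> 6 * t\<close>. The factor 6 in \<open>m\<close> ensures
  \<open>6 * t \<le> \<epsilon>\<close>.\<close>

lemma has_fptas_pareto_of_max_norm:
  assumes P: "multicriteria_problem P"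
    and alg: "has_fptas (rp_algorithm P max_norm) \<or> has_fptas (cp_algorithm P max_norm)"
  shows "has_fptas (pareto_algorithm P)"
proof -
  define m where "m \<epsilon> = 6 * (1 + inverse_ceiling \<epsilon>)" for \<epsilon>
  have m: "6 \<le> m \<epsilon>" for \<epsilon> by (simp add: m_def)
  define \<delta> where "\<delta> \<epsilon> = 1 / real (m \<epsilon>) ^ 2" for \<epsilon>
  have \<delta>: "0 < \<delta> \<epsilon>" for \<epsilon> using m[of \<epsilon>] by (simp add: \<delta>_def)
  have s: "inverse_ceiling (\<delta> \<epsilon>) \<le> (2 + inverse_ceiling \<epsilon>) ^ 8" for \<epsilon>
  proof -
    have "1 / \<delta> \<epsilon> = real ((m \<epsilon>)\<^sup>2)" by (simp add: \<delta>_def)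
    then have "inverse_ceiling (\<delta> \<epsilon>) = (m \<epsilon>)\<^sup>2" by (rule inverse_ceiling_eq)
    also have "\<dots> = 36 * (1 + inverse_ceiling \<epsilon>)\<^sup>2" unfolding m_def power_mult_distrib by simp
    also have "\<dots> \<le> 2 ^ 6 * (2 + inverse_ceiling \<epsilon>)\<^sup>2" by (intro mult_mono power_mono) auto
    also have "\<dots> \<le> (2 + inverse_ceiling \<epsilon>) ^ 6 * (2 + inverse_ceiling \<epsilon>)\<^sup>2" by (intro mult_right_mono power_mono) auto
    also have "\<dots> = (2 + inverse_ceiling \<epsilon>) ^ 8" by (simp only: power_add[symmetric]) simp
    finally show ?thesis .
  qed
  have re: "poly_family {0<..} inverse_ceiling (\<lambda>\<epsilon>. S max_norm (1 + \<delta> \<epsilon>))"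
    if S: "transferable P S" and fptas: "has_fptas (S max_norm)" for S
    using fptas unfolding has_fptas_iff[OF time_monotone_transferable[OF S]]
  proof (rule poly_family_reindex[where h = \<delta>])
    show "S max_norm (1 + \<delta> \<epsilon>) T' A" if "S max_norm (1 + \<delta> \<epsilon>) T A" "\<And>n. T n \<le> T' n" for \<epsilon> T T' A
      using that by (rule time_monotoneD[OF time_monotone_transferable[OF S]])
  qed (use \<delta> s in auto)
  have "poly_family {0<..} inverse_ceiling (\<lambda>\<epsilon>. pareto_algorithm P (1 + \<epsilon>))"
  proof (rule pareto_family_of_max_norm[OF P, where m = m and c = 2])
    show "poly_family {0<..} inverse_ceiling (\<lambda>\<epsilon>. rp_algorithm P max_norm (1 + \<delta> \<epsilon>)) \<or>
        poly_family {0<..} inverse_ceiling (\<lambda>\<epsilon>. cp_algorithm P max_norm (1 + \<delta> \<epsilon>))"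
      using alg re[OF transferable_rp] re[OF transferable_cp] by blast
    show "poly_bounded inverse_ceiling (\<lambda>i. UNIV) (\<lambda>i v. m i)"
      unfolding m_def by (intro poly_bounded_intros)
    show "1 \<le> m \<epsilon>" for \<epsilon> using m[of \<epsilon>] by simp
    fix \<epsilon> :: real
    assume "\<epsilon> \<in> {0<..}"
    then have \<epsilon>: "0 < \<epsilon>" by simp
    define t where "t = 1 / real (m \<epsilon>)"
    have t: "0 < t" "t \<le> 1" "real (m \<epsilon>) * t = 1" using m[of \<epsilon>] by (auto simp: t_def)
    have "real (m \<epsilon>) = 6 * (1 + real (inverse_ceiling \<epsilon>))" by (simp add: m_def)
    then have "6 * t = 1 / (1 + real (inverse_ceiling \<epsilon>))"
      by (simp add: t_def del: distrib_left_numeral)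
    then have t\<epsilon>: "6 * t \<le> \<epsilon>" using inverse_Suc_inverse_ceiling_le[OF \<epsilon>] by linarith
    have \<delta>t: "\<delta> \<epsilon> = t * t" by (simp add: \<delta>_def t_def power2_eq_square)
    have tt: "t * t \<le> t" using mult_left_mono[OF t(2), of t] t(1) by simp
    show "1 \<le> 1 + \<delta> \<epsilon> \<and> 1 + \<delta> \<epsilon> \<le> 2" unfolding \<delta>t using tt t(1,2) mult_pos_pos[OF t(1) t(1)] by linarith
    define \<kappa> where "\<kappa> = (1 + \<delta> \<epsilon> + m \<epsilon> * (1 + \<delta> \<epsilon> - 1)) * (1 + 1 / m \<epsilon>)"
    have "real (m \<epsilon>) * \<delta> \<epsilon> = t" unfolding \<delta>t using t(3) by (simp add: mult.assoc[symmetric])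
    then have "\<kappa> = (1 + t * t + t) * (1 + t)" unfolding \<kappa>_def \<delta>t t_def[symmetric] by simp
    also have "\<dots> = 1 + 2 * t + 2 * (t * t) + t * (t * t)" by (simp add: algebra_simps)
    also have "\<dots> \<le> 1 + 5 * t"
      using tt mult_left_mono[OF tt, of t] t(1) by linarith
    finally have \<kappa>: "\<kappa> \<le> 1 + 5 * t" .
    then show "(1 + \<delta> \<epsilon> + m \<epsilon> * (1 + \<delta> \<epsilon> - 1)) * (1 + 1 / m \<epsilon>) \<le> 1 + \<epsilon>"
      using t(1) t\<epsilon> unfolding \<kappa>_def by linarith
    have "\<kappa> * t \<le> 6 * t" using \<kappa> t by (intro mult_right_mono) auto
    then show "1 + (1 + \<delta> \<epsilon> + m \<epsilon> * (1 + \<delta> \<epsilon> - 1)) * (1 + 1 / m \<epsilon>) / m \<epsilon> \<le> 1 + \<epsilon>"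
      using t\<epsilon> unfolding \<kappa>_def[symmetric] by (simp add: t_def)
  qed
  then show ?thesis unfolding has_fptas_iff[OF time_monotone_pareto] .
qed

section \<open>The families over all \<open>p\<close>\<close>

lemma card_ge_one: "1 \<le> real CARD('k::finite)"
  by (simp add: Suc_le_eq)

text \<open>One program serves all \<open>p\<close>: each cornered norm is within the factor
  \<open>1 + k / p \<le> 1 + k\<close> of the maximum norm, where \<open>k\<close> is the number of
  objectives.\<close>

lemma constant_factor_family_of_max_norm:
  fixes P :: "'k::enum problem"
  assumes P: "multicriteria_problem P" and S: "transferable P S" and "has_constant_factor (S max_norm)"
  shows "has_constant_factor_family S"
proof -
  obtain \<alpha> C d A where \<alpha>: "1 < \<alpha>" and A: "S max_norm \<alpha> (\<lambda>n. C * (1 + real n) ^ d) A"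
    using assms(3) unfolding has_constant_factor_def by blast
  let ?k = "real CARD('k)"
  have "\<exists>\<alpha> > 1. \<exists>A. S (cornered_norm p) \<alpha> (\<lambda>n. \<bar>C\<bar> * (1 + real n + log 2 p) ^ d) A" if p: "1 \<le> p" for p
  proof (intro exI conjI)
    show "S (cornered_norm p) ((1 + ?k) * \<alpha>) (\<lambda>n. \<bar>C\<bar> * (1 + real n + log 2 p) ^ d) A"
      unfolding cornered_norm_eq
    proof (rule transfer_algorithm(1)[OF P S max_norm_nonneg _ _ _ _ order_refl _ A])
      show "max_norm y \<le> sum_max_norm (1 / p) y" for y :: "real ^ 'k::enum" using p by (intro max_norm_le_sum_max_norm) auto
      have "1 / p * ?k \<le> ?k" using p by (simp add: divide_le_eq mult_le_cancel_left1)
      then have "(1 + 1 / p * ?k) * max_norm y \<le> (1 + ?k) * max_norm y" for y :: "real ^ 'k::enum"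
        by (intro mult_right_mono max_norm_nonneg) auto
      then show "sum_max_norm (1 / p) y \<le> (1 + ?k) * max_norm y" for y :: "real ^ 'k::enum"
        using sum_max_norm_le_max_norm[of "1 / p" y] p order_trans by fastforce
      show "C * (1 + real n) ^ d \<le> \<bar>C\<bar> * (1 + real n + log 2 p) ^ d" for n
        using p by (intro mult_mono power_mono) auto
    qed (use \<alpha> in auto)
    have "1 * 1 < (1 + ?k) * \<alpha>" using \<alpha> by (intro mult_less_le_imp_less) auto
    then show "1 < (1 + ?k) * \<alpha>" by simp
  qed
  then show ?thesis unfolding has_constant_factor_family_def by blast
qed

text \<open>The member \<open>p = 1\<close> is enough, and \<open>log 2 1 = 0\<close> removes the
  parameter from its time bound.\<close>

lemma max_norm_of_constant_factor_family:
  fixes P :: "'k::enum problem"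
  assumes P: "multicriteria_problem P" and S: "transferable P S" and "has_constant_factor_family S"
  shows "has_constant_factor (S max_norm)"
proof -
  obtain C d where Cd: "\<forall>p \<ge> 1. (\<exists>\<alpha> > 1. \<exists>A. S (p_norm p) \<alpha> (\<lambda>n. C * (1 + real n + log 2 p) ^ d) A) \<or>
        (\<exists>\<alpha> > 1. \<exists>A. S (cornered_norm p) \<alpha> (\<lambda>n. C * (1 + real n + log 2 p) ^ d) A)"
    using assms(3) unfolding has_constant_factor_family_def by blast
  let ?k = "real CARD('k)"
  have k: "1 < (1 + ?k) * \<alpha>" if "1 < \<alpha>" for \<alpha>
  proof -
    have "1 * 1 < (1 + ?k) * \<alpha>" using that by (intro mult_less_le_imp_less) auto
    then show ?thesis by simp
  qed
  have T: "C * (1 + real n + log 2 1) ^ d \<le> C * (1 + real n) ^ d" for n by simp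
  from Cd have "(\<exists>\<alpha> > 1. \<exists>A. S (p_norm 1) \<alpha> (\<lambda>n. C * (1 + real n + log 2 1) ^ d) A) \<or>
        (\<exists>\<alpha> > 1. \<exists>A. S (cornered_norm 1) \<alpha> (\<lambda>n. C * (1 + real n + log 2 1) ^ d) A)" by blast
  then show ?thesis
  proof
    assume "\<exists>\<alpha> > 1. \<exists>A. S (p_norm 1) \<alpha> (\<lambda>n. C * (1 + real n + log 2 1) ^ d) A"
    then obtain \<alpha> A where \<alpha>: "1 < \<alpha>" and A: "S (p_norm 1) \<alpha> (\<lambda>n. C * (1 + real n + log 2 1) ^ d) A" by blast
    have "S max_norm ((1 + ?k) * \<alpha>) (\<lambda>n. C * (1 + real n) ^ d) A"
    proof (rule transfer_algorithm(2)[OF P S max_norm_nonneg max_norm_le_p_norm _ _ _ order_refl T A])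
      have "?k * max_norm y \<le> (1 + ?k) * max_norm y" for y :: "real ^ 'k::enum"
        by (intro mult_right_mono max_norm_nonneg) auto
      then show "p_norm 1 y \<le> (1 + ?k) * max_norm y" for y :: "real ^ 'k::enum"
        using p_norm_le_max_norm[of 1 y] order_trans by fastforce
    qed (use \<alpha> in auto)
    then show ?thesis using k[OF \<alpha>] unfolding has_constant_factor_def by blast
  next
    assume "\<exists>\<alpha> > 1. \<exists>A. S (cornered_norm 1) \<alpha> (\<lambda>n. C * (1 + real n + log 2 1) ^ d) A"
    then obtain \<alpha> A where \<alpha>: "1 < \<alpha>" and A: "S (cornered_norm 1) \<alpha> (\<lambda>n. C * (1 + real n + log 2 1) ^ d) A" by blast
    have "S max_norm ((1 + ?k) * \<alpha>) (\<lambda>n. C * (1 + real n) ^ d) A"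
    proof (rule transfer_algorithm(2)[OF P S max_norm_nonneg _ _ _ _ order_refl T A])
      show "max_norm y \<le> cornered_norm 1 y" for y :: "real ^ 'k::enum"
        unfolding cornered_norm_eq by (intro max_norm_le_sum_max_norm) auto
      show "cornered_norm 1 y \<le> (1 + ?k) * max_norm y" for y :: "real ^ 'k::enum"
        unfolding cornered_norm_eq using sum_max_norm_le_max_norm[of "1 / 1" y] by simp
    qed (use \<alpha> in auto)
    then show ?thesis using k[OF \<alpha>] unfolding has_constant_factor_def by blast
  qed
qed

text \<open>Bernoulli's inequality:
  \<open>k \<le> n * \<delta> \<le> (1 + \<delta>) ^ n\<close>.\<close>

lemma powr_inverse_le:
  fixes k \<delta> :: real and n :: nat
  assumes "1 \<le> k" "0 < \<delta>" "k / \<delta> \<le> n" "1 \<le> n"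
  shows "k powr (1 / n) \<le> 1 + \<delta>"
proof -
  have "k \<le> n * \<delta>" using assms by (simp add: field_simps)
  also have "\<dots> \<le> (1 + \<delta>) ^ n" using Bernoulli_inequality[of \<delta> n] assms by simp
  also have "\<dots> = (1 + \<delta>) powr n" using assms by (simp add: powr_realpow)
  finally have "k powr (1 / n) \<le> ((1 + \<delta>) powr n) powr (1 / n)" using assms by (intro powr_mono2) auto
  also have "\<dots> = 1 + \<delta>" using assms by (simp add: powr_powr)
  finally show ?thesis .
qed

lemma max_norm_of_fptas_family:
  fixes P :: "'k::enum problem"
  assumes P: "multicriteria_problem P" and S: "transferable P S" and "has_fptas_family S"
  shows "has_fptas (S max_norm)"
proof -
  obtain C d where Cd: "\<forall>p \<ge> 1.
        (\<forall>\<epsilon> > 0. \<exists>A. S (p_norm p) (1 + \<epsilon>) (\<lambda>n. C * (1 + real n + 1 / \<epsilon> + log 2 p) ^ d) A) \<or>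
        (\<forall>\<epsilon> > 0. \<exists>A. S (cornered_norm p) (1 + \<epsilon>) (\<lambda>n. C * (1 + real n + 1 / \<epsilon> + log 2 p) ^ d) A)"
    using assms(3) unfolding has_fptas_family_def by blast
  let ?k = "real CARD('k)"
  \<comment> \<open>Absorbs the time at precision \<delta> and parameter \<open>p\<close>, using
    \<open>1 / \<delta> \<le> 3 + 3 / \<epsilon>\<close> and
    \<open>log 2 p \<le> p \<le> k / \<delta> + 1\<close>.\<close>
  define K where "K = 3 * ?k + 5"
  have "\<exists>A. S max_norm (1 + \<epsilon>) (\<lambda>n. (\<bar>C\<bar> * K ^ d) * (1 + real n + 1 / \<epsilon>) ^ d) A" if \<epsilon>: "0 < \<epsilon>" for \<epsilon>
  proof -
    \<comment> \<open>One factor \<open>1 + \<delta>\<close> is lost by the change of norm and one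
      by the algorithm. The cap \<open>\<delta> \<le> 1\<close> gives
      \<open>(1 + \<delta>) * (1 + \<delta>) \<le> 1 + 3 * \<delta>\<close>.\<close>
    define \<delta> where "\<delta> = min 1 \<epsilon> / 3"
    have \<delta>: "0 < \<delta>" "\<delta> \<le> 1" "3 * \<delta> \<le> \<epsilon>" using \<epsilon> by (auto simp: \<delta>_def)
    \<comment> \<open>Large enough for both norms: \<open>k powr (1 / n)\<close> and
      \<open>1 + k / n\<close> are at most \<open>1 + \<delta>\<close>. Which norm is available may
      change with \<epsilon>, but the programs for different \<epsilon> are independent.\<close>
    define n where "n = nat \<lceil>?k / \<delta>\<rceil>"
    have kd: "0 < ?k / \<delta>" using \<delta> by (intro divide_pos_pos) auto
    then have n: "?k / \<delta> \<le> n" "real n \<le> ?k / \<delta> + 1" "1 \<le> n" unfolding n_def by linarith+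
    define p where "p = real n"
    have p: "1 \<le> p" using n by (simp add: p_def)
    have inv: "1 / \<delta> \<le> 3 + 3 * (1 / \<epsilon>)"
    proof (cases "\<epsilon> \<le> 1")
      case True
      then show ?thesis using \<epsilon> by (simp add: \<delta>_def)
    next
      case False
      then show ?thesis using \<epsilon> by (simp add: \<delta>_def)
    qed
    have lg: "0 \<le> log 2 p" "log 2 p \<le> p"
    proof -
      show "0 \<le> log 2 p" using p by simp
      have "p \<le> 2 powr p" using of_nat_less_two_power[of n, where 'a = real] by (simp add: p_def powr_realpow)
      then show "log 2 p \<le> p" using p by (subst log_le_iff) auto
    qed
    have T: "C * (1 + real j + 1 / \<delta> + log 2 p) ^ d \<le> (\<bar>C\<bar> * K ^ d) * (1 + real j + 1 / \<epsilon>) ^ d" for j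
    proof -
      have "?k * (1 / \<delta>) \<le> ?k * (3 + 3 * (1 / \<epsilon>))" using inv by (intro mult_left_mono) auto
      then have "1 + real j + 1 / \<delta> + log 2 p \<le> 1 + real j + (3 + 3 * (1 / \<epsilon>)) + (?k * (3 + 3 * (1 / \<epsilon>)) + 1)"
        using inv lg n(2) unfolding p_def by simp
      also have "\<dots> \<le> K * (1 + real j + 1 / \<epsilon>)"
      proof -
        have "1 + j + (3 + 3 * x) + (k * (3 + 3 * x) + 1) \<le> (3 * k + 5) * (1 + j + x)"
          if "0 \<le> k" "0 \<le> j" "0 \<le> x" for k j x :: real
          using mult_nonneg_nonneg[OF that(1,2)] that by (simp add: algebra_simps)
        from this[of ?k "real j" "1 / \<epsilon>"] show ?thesis unfolding K_def using \<epsilon> by simp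
      qed
      finally have "1 + real j + 1 / \<delta> + log 2 p \<le> K * (1 + real j + 1 / \<epsilon>)" .
      moreover have pos: "0 \<le> 1 + real j + 1 / \<delta> + log 2 p" using lg(1) \<delta>(1) by (simp add: add_nonneg_nonneg)
      ultimately have "(1 + real j + 1 / \<delta> + log 2 p) ^ d \<le> (K * (1 + real j + 1 / \<epsilon>)) ^ d"
        by (intro power_mono)
      then have "C * (1 + real j + 1 / \<delta> + log 2 p) ^ d \<le> \<bar>C\<bar> * (K * (1 + real j + 1 / \<epsilon>)) ^ d"
        using pos by (intro mult_mono) auto
      then show ?thesis by (simp add: power_mult_distrib mult.assoc)
    qed
    have "\<delta> * \<delta> \<le> \<delta>" using mult_left_mono[OF \<delta>(2), of \<delta>] \<delta>(1) by simp
    then have fac: "(1 + \<delta>) * (1 + \<delta>) \<le> 1 + \<epsilon>" using \<delta>(3) by (simp add: algebra_simps)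
    from Cd p \<delta>(1) have "(\<exists>A. S (p_norm p) (1 + \<delta>) (\<lambda>n. C * (1 + real n + 1 / \<delta> + log 2 p) ^ d) A) \<or>
        (\<exists>A. S (cornered_norm p) (1 + \<delta>) (\<lambda>n. C * (1 + real n + 1 / \<delta> + log 2 p) ^ d) A)" by blast
    then show ?thesis
    proof
      assume "\<exists>A. S (p_norm p) (1 + \<delta>) (\<lambda>n. C * (1 + real n + 1 / \<delta> + log 2 p) ^ d) A"
      then obtain A where A: "S (p_norm p) (1 + \<delta>) (\<lambda>n. C * (1 + real n + 1 / \<delta> + log 2 p) ^ d) A" by blast
      have "?k powr (1 / p) \<le> 1 + \<delta>" unfolding p_def using powr_inverse_le[OF card_ge_one \<delta>(1) n(1,3)] .
      then have "p_norm p y \<le> (1 + \<delta>) * max_norm y" for y :: "real ^ 'k::enum"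
        using p_norm_le_max_norm[OF p, of y] mult_right_mono[OF _ max_norm_nonneg[of y]] order_trans by blast
      from transfer_algorithm(2)[of P S max_norm "p_norm p" "1 + \<delta>" "1 + \<delta>" "1 + \<epsilon>",
          OF P S max_norm_nonneg max_norm_le_p_norm[OF p] this _ _ fac T A]
      show ?thesis using \<delta> by auto
    next
      assume "\<exists>A. S (cornered_norm p) (1 + \<delta>) (\<lambda>n. C * (1 + real n + 1 / \<delta> + log 2 p) ^ d) A"
      then obtain A where A: "S (cornered_norm p) (1 + \<delta>) (\<lambda>n. C * (1 + real n + 1 / \<delta> + log 2 p) ^ d) A" by blast
      have ge: "max_norm y \<le> cornered_norm p y" for y :: "real ^ 'k::enum"
        unfolding cornered_norm_eq using p by (intro max_norm_le_sum_max_norm) auto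
      have "1 / p * ?k \<le> \<delta>" using n(1) p \<delta>(1) by (simp add: p_def field_simps)
      then have "(1 + 1 / p * ?k) * max_norm y \<le> (1 + \<delta>) * max_norm y" for y :: "real ^ 'k::enum"
        by (intro mult_right_mono max_norm_nonneg) auto
      then have "cornered_norm p y \<le> (1 + \<delta>) * max_norm y" for y :: "real ^ 'k::enum"
        unfolding cornered_norm_eq using sum_max_norm_le_max_norm[of "1 / p" y] p order_trans by fastforce
      from transfer_algorithm(2)[of P S max_norm "cornered_norm p" "1 + \<delta>" "1 + \<delta>" "1 + \<epsilon>",
          OF P S max_norm_nonneg ge this _ _ fac T A]
      show ?thesis using \<delta> by auto
    qed
  qed
  then show ?thesis unfolding has_fptas_def by blast
qed

text \<open>Cornered norms are used for every \<open>p\<close>. Rounding \<open>1 / p\<close> down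
  to \<open>a / m\<close> changes the norm by at most \<open>1 / m\<close> times the sum of the
  absolute values, hence by at most \<open>k / m = \<delta>\<close> times the maximum norm. Since
  \<open>a \<le> m\<close>, the size parameter depends on \<epsilon> alone and not on
  \<open>p\<close>.\<close>

lemma fptas_family_of_pareto:
  fixes P :: "'k::enum problem"
  assumes P: "multicriteria_problem P" and "has_fptas (pareto_algorithm P)"
  shows "has_fptas_family (rp_algorithm P)" and "has_fptas_family (cp_algorithm P)"
proof -
  let ?k = "CARD('k)"
  define X where "X = {(p :: real, \<epsilon> :: real). 1 \<le> p \<and> 0 < \<epsilon>}"
  define s where "s i = inverse_ceiling (snd i)" for i :: "real \<times> real"
  \<comment> \<open>The factor 5 comes from
    \<open>(1 + \<delta>) * (1 + 2 * \<delta>) \<le> 1 + 5 * \<delta>\<close>, rounding of the norm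
    times the guarantee for compromise programming.\<close>
  define \<delta> where "\<delta> i = 1 / (5 * (1 + real (s i)))" for i
  define m where "m i = 5 * ?k * (1 + s i)" for i
  \<comment> \<open>For \<open>p \<ge> 1\<close> the minimum is the floor; the cap keeps
    \<open>a\<close> polynomially bounded at indices outside \<open>X\<close> too.\<close>
  define a where "a i = min (m i) (nat \<lfloor>m i / fst i\<rfloor>)" for i
  define N where "N i = (sum_max_norm (a i / m i) :: real ^ 'k::enum \<Rightarrow> real)" for i
  have m: "1 \<le> m i" for i by (simp add: m_def Suc_le_eq)
  have \<delta>: "0 < \<delta> i" "\<delta> i \<le> 1" for i by (auto simp: \<delta>_def add_pos_nonneg)
  have \<delta>\<epsilon>: "5 * \<delta> (p, \<epsilon>) \<le> \<epsilon>" if "0 < \<epsilon>" for p \<epsilon>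
    using inverse_Suc_inverse_ceiling_le[OF that] by (simp add: \<delta>_def s_def del: distrib_left_numeral)
  have k\<delta>: "?k / m i = \<delta> i" for i
  proof -
    have "real (m i) = real ?k * (5 * (1 + real (s i)))" by (simp add: m_def algebra_simps)
    then show ?thesis by (simp add: \<delta>_def del: distrib_left_numeral)
  qed
  have pareto: "poly_family X s (\<lambda>i. pareto_algorithm P (1 + \<delta> i))"
    using assms(2) unfolding has_fptas_iff[OF time_monotone_pareto]
  proof (rule poly_family_reindex[where h = \<delta>])
    show "inverse_ceiling (\<delta> i) \<le> (2 + s i) ^ 4" for i
    proof -
      have "1 / \<delta> i = real (5 * (1 + s i))" by (simp add: \<delta>_def)
      then have "inverse_ceiling (\<delta> i) = 5 * (1 + s i)" by (rule inverse_ceiling_eq)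
      also have "\<dots> \<le> 2 ^ 3 * (2 + s i)" by simp
      also have "\<dots> \<le> (2 + s i) ^ 3 * (2 + s i)" by (intro mult_right_mono power_mono) auto
      also have "\<dots> = (2 + s i) ^ 4" by (simp only: power_Suc2[symmetric]) simp
      finally show ?thesis .
    qed
    show "pareto_algorithm P (1 + \<delta> i) T' A" if "pareto_algorithm P (1 + \<delta> i) T A" "\<And>n. T n \<le> T' n" for i T T' A
      using that by (rule time_monotoneD[OF time_monotone_pareto])
  qed (use \<delta> in auto)
  have m_pb: "poly_bounded s (\<lambda>i. UNIV) (\<lambda>i v. m i)" unfolding m_def by (intro poly_bounded_intros)
  have a_pb: "poly_bounded s (\<lambda>i. UNIV) (\<lambda>i v. a i)"
    by (rule poly_bounded_mono[OF m_pb]) (simp add: a_def)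
  obtain dec where dec: "decides s N dec" using decides_sum_max_norm[OF a_pb m_pb m] unfolding N_def by blast
  have N: "is_norm (N i)" "monotone_norm (N i)" for i
    unfolding N_def by (intro is_norm_sum_max_norm monotone_norm_sum_max_norm; simp)+
  have N_nonneg: "0 \<le> N i y" for i y
    unfolding N_def using max_norm_le_sum_max_norm[of "a i / m i" y] max_norm_nonneg[of y] by simp
  have close: "N i y \<le> cornered_norm (fst i) y" "cornered_norm (fst i) y \<le> (1 + \<delta> i) * N i y"
    if "i \<in> X" for i y
  proof -
    have p: "1 \<le> fst i" using that by (auto simp: X_def)
    have m0: "0 < real (m i)" using m[of i] by simp
    have quot: "0 \<le> m i / fst i" "m i / fst i \<le> m i" using p by (auto simp: divide_le_eq mult_le_cancel_left1)
    then have "nat \<lfloor>m i / fst i\<rfloor> \<le> m i" by linarith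
    then have a: "real (a i) \<le> m i / fst i" "m i / fst i \<le> real (a i) + 1"
      unfolding a_def using quot(1) by (simp add: min_absorb2, linarith)
    define q where "q = a i / m i"
    have q: "0 \<le> q" "q \<le> 1 / fst i" "1 / fst i \<le> q + 1 / m i"
      using a m0 p by (auto simp: q_def field_simps)
    let ?s = "\<Sum>j \<in> UNIV. \<bar>y $ j\<bar>"
    have s0: "0 \<le> ?s" by (simp add: sum_nonneg)
    show "N i y \<le> cornered_norm (fst i) y"
      unfolding N_def cornered_norm_eq q_def[symmetric] sum_max_norm_def
      using q s0 by (intro add_left_mono mult_right_mono)
    have "cornered_norm (fst i) y \<le> max_norm y + (q + 1 / m i) * ?s"
      unfolding cornered_norm_eq sum_max_norm_def using q s0 by (intro add_left_mono mult_right_mono)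
    also have "\<dots> = N i y + 1 / m i * ?s" by (simp add: N_def sum_max_norm_def q_def algebra_simps)
    also have "1 / m i * ?s \<le> 1 / m i * (?k * max_norm y)" by (intro mult_left_mono sum_abs_le_max_norm) auto
    also have "1 / m i * (?k * max_norm y) = \<delta> i * max_norm y" unfolding k\<delta>[of i, symmetric] by simp
    also have "\<dots> \<le> \<delta> i * N i y"
      unfolding N_def using \<delta>(1)[of i] by (intro mult_left_mono max_norm_le_sum_max_norm) auto
    finally show "cornered_norm (fst i) y \<le> (1 + \<delta> i) * N i y" by (simp add: algebra_simps)
  qed
  \<comment> \<open>The guarantee \<open>1 + 2 * \<delta> = 2 * (1 + \<delta>) - 1\<close> is the
    one of compromise programming; the better reference point algorithm is weakened to it, so that
    one argument covers both.\<close>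
  have fam: "has_fptas_family S"
    if S: "transferable P S" and alg: "poly_family X s (\<lambda>i. S (N i) (1 + 2 * \<delta> i))" for S
  proof -
    obtain d where d: "\<And>i. i \<in> X \<Longrightarrow> \<exists>A. S (N i) (1 + 2 * \<delta> i) (\<lambda>n. real ((2 + s i + n) ^ d)) A"
      using alg unfolding poly_family_def by blast
    have "\<exists>A. S (cornered_norm p) (1 + \<epsilon>) (\<lambda>n. 3 ^ d * (1 + real n + 1 / \<epsilon> + log 2 p) ^ d) A"
      if p: "1 \<le> p" and \<epsilon>: "0 < \<epsilon>" for p \<epsilon>
    proof -
      let ?i = "(p, \<epsilon>)"
      have i: "?i \<in> X" using p \<epsilon> by (simp add: X_def)
      obtain A where A: "S (N ?i) (1 + 2 * \<delta> ?i) (\<lambda>n. real ((2 + s ?i + n) ^ d)) A" using d[OF i] by blast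
      have T: "real ((2 + s ?i + n) ^ d) \<le> 3 ^ d * (1 + real n + 1 / \<epsilon> + log 2 p) ^ d" for n
        using inverse_ceiling_time_le[OF \<epsilon>, of "log 2 p" n d] p by (simp add: s_def)
      have "\<delta> ?i * \<delta> ?i \<le> \<delta> ?i" using mult_left_mono[OF \<delta>(2)[of ?i], of "\<delta> ?i"] \<delta>(1)[of ?i] by simp
      then have fac: "(1 + \<delta> ?i) * (1 + 2 * \<delta> ?i) \<le> 1 + \<epsilon>"
        using \<delta>\<epsilon>[OF \<epsilon>, of p] by (simp add: algebra_simps)
      have "0 \<le> 1 + \<delta> ?i" "0 \<le> 1 + 2 * \<delta> ?i" using \<delta>(1)[of ?i] by auto
      from transfer_algorithm(1)[of P S "N ?i" "cornered_norm p" "1 + \<delta> ?i" "1 + 2 * \<delta> ?i" "1 + \<epsilon>",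
          OF P S N_nonneg close[OF i, unfolded fst_conv] this fac T A]
      show ?thesis by auto
    qed
    then show ?thesis unfolding has_fptas_family_def by blast
  qed
  have \<alpha>: "1 \<le> 1 + \<delta> i" for i using \<delta>(1)[of i] by simp
  note algs = rp_family_of_pareto_family[OF P pareto \<alpha> N dec]
  show "has_fptas_family (cp_algorithm P)"
    using algs(2) by (intro fam transferable_cp) (simp add: algebra_simps)
  have "poly_family X s (\<lambda>i. rp_algorithm P (N i) (1 + 2 * \<delta> i))"
    using algs(1)
  proof (rule poly_family_reindex[where h = "\<lambda>i. i" and e = 1])
    fix i T T' A
    assume A: "rp_algorithm P (N i) (1 + \<delta> i) T A" and T: "\<And>n. T n \<le> T' n"
    show "rp_algorithm P (N i) (1 + 2 * \<delta> i) T' A"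
      by (rule transfer_algorithm(1)[OF P transferable_rp N_nonneg, where c = 1, OF _ _ _ _ _ T A])
        (use \<delta>(1)[of i] in auto)
  qed auto
  then show "has_fptas_family (rp_algorithm P)" by (intro fam transferable_rp)
qed

section \<open>Arbitrary monotone decidable norms and the final equivalences\<close>

lemma constant_factor_of_pareto:
  fixes P :: "'k::enum problem"
  assumes P: "multicriteria_problem P" and "has_constant_factor (pareto_algorithm P)"
    and N: "is_norm N" "monotone_norm N" "polynomially_decidable N"
  shows "has_constant_factor (rp_algorithm P N)" and "has_constant_factor (cp_algorithm P N)"
proof -
  obtain \<alpha> where \<alpha>: "1 < \<alpha>" and pareto: "poly_family (UNIV :: unit set) (\<lambda>i. 0) (\<lambda>i. pareto_algorithm P \<alpha>)"
    using assms(2) unfolding has_constant_factor_iff[OF time_monotone_pareto] by blast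
  obtain dec where dec: "decides (\<lambda>i::unit. 0) (\<lambda>i. N) dec" using polynomially_decidable_decides[OF N(3)] by blast
  have \<alpha>': "1 \<le> \<alpha>" "1 < 2 * \<alpha> - 1" using \<alpha> by auto
  note algs = rp_family_of_pareto_family[OF P pareto \<alpha>'(1) N(1,2) dec]
  show "has_constant_factor (rp_algorithm P N)"
    unfolding has_constant_factor_iff[OF time_monotone_transferable[OF transferable_rp]] using algs(1) \<alpha> by blast
  show "has_constant_factor (cp_algorithm P N)"
    unfolding has_constant_factor_iff[OF time_monotone_transferable[OF transferable_cp]] using algs(2) \<alpha>'(2) by blast
qed

lemma fptas_of_pareto:
  fixes P :: "'k::enum problem"
  assumes P: "multicriteria_problem P" and "has_fptas (pareto_algorithm P)"
    and N: "is_norm N" "monotone_norm N" "polynomially_decidable N"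
  shows "has_fptas (rp_algorithm P N)" and "has_fptas (cp_algorithm P N)"
proof -
  have pareto: "poly_family {0<..} inverse_ceiling (\<lambda>\<epsilon>. pareto_algorithm P (1 + \<epsilon>))"
    using assms(2) unfolding has_fptas_iff[OF time_monotone_pareto] .
  obtain dec where dec: "decides inverse_ceiling (\<lambda>i. N) dec" using polynomially_decidable_decides[OF N(3)] by blast
  have "1 \<le> 1 + \<epsilon>" if "\<epsilon> \<in> {0<..}" for \<epsilon> :: real using that by simp
  note algs = rp_family_of_pareto_family[OF P pareto this N(1,2) dec]
  show "has_fptas (rp_algorithm P N)"
    unfolding has_fptas_iff[OF time_monotone_transferable[OF transferable_rp]] using algs(1) by simp
  have "poly_family {0<..} inverse_ceiling (\<lambda>\<epsilon>. cp_algorithm P N (1 + \<epsilon>))"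
  \<comment> \<open>Half the precision compensates for the guarantee:
    \<open>2 * (1 + \<epsilon> / 2) - 1 = 1 + \<epsilon>\<close>.\<close>
  proof (rule poly_family_reindex[where h = "\<lambda>\<epsilon>. \<epsilon> / 2" and e = 2])
    show "poly_family {0<..} inverse_ceiling (\<lambda>\<epsilon>. cp_algorithm P N (2 * (1 + \<epsilon>) - 1))" using algs(2) by simp
    show "\<epsilon> \<in> {0<..} \<Longrightarrow> \<epsilon> / 2 \<in> {0<..}" for \<epsilon> :: real by simp
    show "inverse_ceiling (\<epsilon> / 2) \<le> (2 + inverse_ceiling \<epsilon>) ^ 2" if "\<epsilon> \<in> {0<..}" for \<epsilon> :: real
    proof -
      have \<epsilon>: "0 < \<epsilon>" using that by simp
      have "1 / (\<epsilon> / 2) = 2 * (1 / \<epsilon>)" by simp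
      also have "\<dots> \<le> of_int (int (2 * inverse_ceiling \<epsilon>))" using inverse_ceiling_bounds(1)[OF \<epsilon>] by simp
      finally have "\<lceil>1 / (\<epsilon> / 2)\<rceil> \<le> int (2 * inverse_ceiling \<epsilon>)" by (rule ceiling_le)
      then have "inverse_ceiling (\<epsilon> / 2) \<le> 2 * inverse_ceiling \<epsilon>"
        unfolding inverse_ceiling_def[of "\<epsilon> / 2"] by linarith
      also have "\<dots> \<le> (2 + inverse_ceiling \<epsilon>) ^ 2" by (simp add: power2_eq_square)
      finally show ?thesis .
    qed
    show "cp_algorithm P N (1 + \<epsilon>) T' A" if "cp_algorithm P N (2 * (1 + \<epsilon> / 2) - 1) T A" "\<And>n. T n \<le> T' n" for \<epsilon> T T' A
    proof -
      have "2 * (1 + \<epsilon> / 2) - 1 = 1 + \<epsilon>" by simp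
      then show ?thesis
        using time_monotoneD[OF time_monotone_transferable[OF transferable_cp] that] by simp
    qed
  qed
  then show "has_fptas (cp_algorithm P N)"
    unfolding has_fptas_iff[OF time_monotone_transferable[OF transferable_cp]] .
qed

lemma polynomially_decidable_max_norm: "polynomially_decidable (max_norm :: real ^ 'k::enum \<Rightarrow> real)"
proof -
  obtain dec where "decides (\<lambda>i::unit. 0) (\<lambda>i. sum_max_norm (real 0 / real 1) :: real ^ 'k::enum \<Rightarrow> real) dec"
    using decides_sum_max_norm[where a = "\<lambda>i::unit. 0" and m = "\<lambda>i. 1" and s = "\<lambda>i. 0", OF poly_bounded_const poly_bounded_const]
    by blast
  then show ?thesis by (intro decides_polynomially_decidable[of max_norm dec]) (simp add: sum_max_norm_0)
qed

text \<open>The Pareto statement \<open>a1\<close> is the hub: everything is derived from it, and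
  the way back passes through the maximum norm statements \<open>a3\<close> and
  \<open>a6\<close>.\<close>

lemma all_equivalentI:
  assumes "a1 \<Longrightarrow> a2" "a1 \<Longrightarrow> a4" "a1 \<Longrightarrow> a5" "a1 \<Longrightarrow> a7" "a2 \<Longrightarrow> a3" "a5 \<Longrightarrow> a6"
    "a4 \<Longrightarrow> a3" "a7 \<Longrightarrow> a6" "a3 \<Longrightarrow> a1" "a6 \<Longrightarrow> a1"
  shows "all_equivalent [a1, a2, a3, a4, a5, a6, a7]"
proof -
  have "a2 = a1" "a3 = a1" "a4 = a1" "a5 = a1" "a6 = a1" "a7 = a1" using assms by iprover+
  then show ?thesis by (simp add: all_equivalent_def)
qed

theorem theorem1:
  fixes P :: "'k::enum problem"
  assumes "multicriteria_problem P"
  shows "all_equivalent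
      [has_constant_factor (pareto_algorithm P),
       \<forall>N. is_norm N \<and> monotone_norm N \<and> polynomially_decidable N \<longrightarrow>
         has_constant_factor (rp_algorithm P N),
       has_constant_factor (rp_algorithm P max_norm),
       has_constant_factor_family (rp_algorithm P),
       \<forall>N. is_norm N \<and> monotone_norm N \<and> polynomially_decidable N \<longrightarrow>
         has_constant_factor (cp_algorithm P N),
       has_constant_factor (cp_algorithm P max_norm),
       has_constant_factor_family (cp_algorithm P)] \<and>
    all_equivalent
      [has_fptas (pareto_algorithm P),
       \<forall>N. is_norm N \<and> monotone_norm N \<and> polynomially_decidable N \<longrightarrow>
         has_fptas (rp_algorithm P N),
       has_fptas (rp_algorithm P max_norm),
       has_fptas_family (rp_algorithm P),
       \<forall>N. is_norm N \<and> monotone_norm N \<and> polynomially_decidable N \<longrightarrow>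
         has_fptas (cp_algorithm P N),
       has_fptas (cp_algorithm P max_norm),
       has_fptas_family (cp_algorithm P)]"
proof -
  note P = assms
  note max_norm = is_norm_max_norm monotone_norm_max_norm polynomially_decidable_max_norm
  note const = constant_factor_of_pareto[OF P]
  show ?thesis
  proof (intro conjI all_equivalentI)
    assume "has_constant_factor (pareto_algorithm P)"
    note alg = const[OF this]
    show "\<forall>N. is_norm N \<and> monotone_norm N \<and> polynomially_decidable N \<longrightarrow> has_constant_factor (rp_algorithm P N)"
      "\<forall>N. is_norm N \<and> monotone_norm N \<and> polynomially_decidable N \<longrightarrow> has_constant_factor (cp_algorithm P N)"
      using alg by blast+
    show "has_constant_factor_family (rp_algorithm P)"
      by (rule constant_factor_family_of_max_norm[OF P transferable_rp alg(1)[OF max_norm]])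
    show "has_constant_factor_family (cp_algorithm P)"
      by (rule constant_factor_family_of_max_norm[OF P transferable_cp alg(2)[OF max_norm]])
  next
    assume "has_fptas (pareto_algorithm P)"
    note alg = fptas_of_pareto[OF P this] and family = fptas_family_of_pareto[OF P this]
    show "\<forall>N. is_norm N \<and> monotone_norm N \<and> polynomially_decidable N \<longrightarrow> has_fptas (rp_algorithm P N)"
      "\<forall>N. is_norm N \<and> monotone_norm N \<and> polynomially_decidable N \<longrightarrow> has_fptas (cp_algorithm P N)"
      using alg by blast+
    show "has_fptas_family (rp_algorithm P)" "has_fptas_family (cp_algorithm P)" by (rule family)+
  next
    assume "has_constant_factor_family (rp_algorithm P)"
    then show "has_constant_factor (rp_algorithm P max_norm)"
      by (rule max_norm_of_constant_factor_family[OF P transferable_rp])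
  next
    assume "has_constant_factor_family (cp_algorithm P)"
    then show "has_constant_factor (cp_algorithm P max_norm)"
      by (rule max_norm_of_constant_factor_family[OF P transferable_cp])
  next
    assume "has_fptas_family (rp_algorithm P)"
    then show "has_fptas (rp_algorithm P max_norm)"
      by (rule max_norm_of_fptas_family[OF P transferable_rp])
  next
    assume "has_fptas_family (cp_algorithm P)"
    then show "has_fptas (cp_algorithm P max_norm)"
      by (rule max_norm_of_fptas_family[OF P transferable_cp])
  qed (simp_all add: max_norm has_constant_factor_pareto_of_max_norm[OF P] has_fptas_pareto_of_max_norm[OF P])
qed

end
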